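(* Let $G$ be an almost polycyclic group admitting a fully invariant polycyclic subgroup of finite index. Then for any endomorphism $\varphi:G\to G$ with $R(\varphi)<\infty$, TBFT$_{ff}$ is true, i.e. $R(\varphi)$ is equal to the number of $\widehat\varphi$-f-points in $\widehat G_{ff}$.
   Context: A group is almost polycyclic (polycyclic-by-finite) if it has a polycyclic subgroup of finite index. A subgroup $H\subset G$ is fully invariant if $\psi(H)\subset H$ for every endomorphism $\psi$ of $G$. For an endomorphism $\varphi$ of a (discrete) group $G$, the Reidemeister ($\varphi$-conjugacy) classes are the equivalence classes of the relation $g\sim xg\varphi(x^{-1})$, $x\in G$, and $R(\varphi)$ is the number of these classes. The unitary dual $\widehat G$ is the set of (unitary) equivalence classes of irreducible unitary representations of $G$; $\widehat G_{ff}\subset \widehat G$ is the part formed by finite-dimensional representations that are finite, i.e. factor through a finite group. A class $[\rho]\in\widehat G$ is called a $\widehat\varphi$-f-point if $\rho$ is equivalent to $\rho\circ\varphi$. One says that TBFT$_{ff}$ is true for $\varphi$ if $R(\varphi)<\infty$ and $R(\varphi)$ coincides with the number of $\widehat\varphi$-f-points in $\widehat G_{ff}$. *)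

theory Defs
  imports
    "HOL-Algebra.Elementary_Groups"
    "Jordan_Normal_Form.Schur_Decomposition"
    "Jordan_Normal_Form.VS_Connect"
begin

hide_const (open) Multiset.mult
hide_const (open) Real_Vector_Spaces.subspace

section \<open>Polycyclic groups and fully invariant subgroups\<close>

text \<open>Same pattern as \<open>solvable_seq\<close> in HOL-Algebra: a finite subnormal series
  ending in \<open>H\<close>, with cyclic instead of abelian factors.\<close>

inductive polycyclic_seq :: "('a, 'b) monoid_scheme \<Rightarrow> 'a set \<Rightarrow> bool"
  for G where
    unity: "polycyclic_seq G {\<one>\<^bsub>G\<^esub>}"
  | extension: "\<lbrakk> polycyclic_seq G K; K \<lhd> (G\<lparr>carrier := H\<rparr>); subgroup H G;
                  cyclic_group ((G\<lparr>carrier := H\<rparr>) Mod K) \<rbrakk> \<Longrightarrow> polycyclic_seq G H"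

definition polycyclic :: "('a, 'b) monoid_scheme \<Rightarrow> bool"
  where "polycyclic G \<longleftrightarrow> group G \<and> polycyclic_seq G (carrier G)"

definition polycyclic_finite_index_subgroup :: "'a set \<Rightarrow> ('a, 'b) monoid_scheme \<Rightarrow> bool"
  where "polycyclic_finite_index_subgroup H G \<longleftrightarrow>
    subgroup H G \<and> polycyclic (G\<lparr>carrier := H\<rparr>) \<and> finite (rcosets\<^bsub>G\<^esub> H)"

definition almost_polycyclic :: "('a, 'b) monoid_scheme \<Rightarrow> bool"
  where "almost_polycyclic G \<longleftrightarrow>
    group G \<and> (\<exists>H. polycyclic_finite_index_subgroup H G)"

definition fully_invariant :: "'a set \<Rightarrow> ('a, 'b) monoid_scheme \<Rightarrow> bool"
  where "fully_invariant H G \<longleftrightarrow> subgroup H G \<and> (\<forall>\<psi> \<in> hom G G. \<psi> ` H \<subseteq> H)"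


section \<open>Reidemeister classes\<close>

definition reidemeister_rel :: "('a, 'b) monoid_scheme \<Rightarrow> ('a \<Rightarrow> 'a) \<Rightarrow> ('a \<times> 'a) set"
  where "reidemeister_rel G \<phi> =
    {(g, h). g \<in> carrier G \<and> h \<in> carrier G \<and>
       (\<exists>x \<in> carrier G. h = x \<otimes>\<^bsub>G\<^esub> g \<otimes>\<^bsub>G\<^esub> \<phi> (inv\<^bsub>G\<^esub> x))}"

definition reidemeister_classes :: "('a, 'b) monoid_scheme \<Rightarrow> ('a \<Rightarrow> 'a) \<Rightarrow> 'a set set"
  where "reidemeister_classes G \<phi> = carrier G // reidemeister_rel G \<phi>"

text \<open>Meaningful only when there are finitely many classes; infinitely many classes give 0,
  so every use is accompanied by a finiteness condition.\<close>

definition reidemeister_number :: "('a, 'b) monoid_scheme \<Rightarrow> ('a \<Rightarrow> 'a) \<Rightarrow> nat"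
  where "reidemeister_number G \<phi> = card (reidemeister_classes G \<phi>)"


section \<open>Finite-dimensional unitary representations\<close>

text \<open>A finite-dimensional Hilbert space is taken to be \<open>\<complex>\<^sup>n\<close> with its standard inner product,
  as every \<open>n\<close>-dimensional Hilbert space is isometrically isomorphic to it.\<close>

definition unitary_group :: "nat \<Rightarrow> complex mat monoid"
  where "unitary_group n =
    \<lparr> carrier = {U \<in> carrier_mat n n. U * mat_adjoint U = 1\<^sub>m n \<and> mat_adjoint U * U = 1\<^sub>m n},
      mult = (*), one = 1\<^sub>m n \<rparr>"

definition unitary_rep :: "('a, 'b) monoid_scheme \<Rightarrow> nat \<Rightarrow> ('a \<Rightarrow> complex mat) \<Rightarrow> bool"
  where "unitary_rep G n \<rho> \<longleftrightarrow> \<rho> \<in> hom G (unitary_group n)"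

definition irreducible_unitary_rep ::
    "('a, 'b) monoid_scheme \<Rightarrow> nat \<Rightarrow> ('a \<Rightarrow> complex mat) \<Rightarrow> bool"
  where "irreducible_unitary_rep G n \<rho> \<longleftrightarrow>
    unitary_rep G n \<rho> \<and> 0 < n \<and>
    (\<forall>W. subspace class_ring W (module_vec TYPE(complex) n) \<and>
         (\<forall>g \<in> carrier G. \<forall>v \<in> W. \<rho> g *\<^sub>v v \<in> W) \<longrightarrow>
         W = {0\<^sub>v n} \<or> W = carrier_vec n)"

text \<open>Every finite group is isomorphic to one whose elements are natural numbers, so fixing
  the element type of \<open>F\<close> loses nothing.\<close>

definition factors_through_finite_group ::
    "('a, 'b) monoid_scheme \<Rightarrow> nat \<Rightarrow> ('a \<Rightarrow> complex mat) \<Rightarrow> bool"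
  where "factors_through_finite_group G n \<rho> \<longleftrightarrow>
    (\<exists>F :: nat monoid. group F \<and> finite (carrier F) \<and>
      (\<exists>\<pi> \<in> hom G F. \<exists>\<sigma>. unitary_rep F n \<sigma> \<and> (\<forall>g \<in> carrier G. \<rho> g = \<sigma> (\<pi> g))))"

text \<open>Unitary equivalence only looks at values on the carrier, so functions differing
  outside \<open>carrier G\<close>, which are the same representation, lie in one class.\<close>

definition unitary_equiv ::
    "('a, 'b) monoid_scheme \<Rightarrow> (('a \<Rightarrow> complex mat) \<times> ('a \<Rightarrow> complex mat)) set"
  where "unitary_equiv G =
    {(\<rho>, \<sigma>). \<exists>n. unitary_rep G n \<rho> \<and> unitary_rep G n \<sigma> \<and>
       (\<exists>U \<in> carrier (unitary_group n). \<forall>g \<in> carrier G. U * \<rho> g = \<sigma> g * U)}"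

text \<open>The part of the unitary dual formed by the classes of finite-dimensional irreducible
  representations that factor through a finite group.\<close>

definition unitary_dual_ff :: "('a, 'b) monoid_scheme \<Rightarrow> ('a \<Rightarrow> complex mat) set set"
  where "unitary_dual_ff G =
    {\<rho>. \<exists>n. irreducible_unitary_rep G n \<rho> \<and> factors_through_finite_group G n \<rho>}
      // unitary_equiv G"

text \<open>If \<open>\<phi>\<close> is not surjective, \<open>\<rho> \<circ> \<phi>\<close> may be reducible; then \<open>[\<rho>]\<close> is not an f-point.\<close>

definition f_points_ff ::
    "('a, 'b) monoid_scheme \<Rightarrow> ('a \<Rightarrow> 'a) \<Rightarrow> ('a \<Rightarrow> complex mat) set set"
  where "f_points_ff G \<phi> =
    {c \<in> unitary_dual_ff G. \<exists>\<rho> \<in> c. (\<rho>, \<rho> \<circ> \<phi>) \<in> unitary_equiv G}"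

definition TBFT_ff :: "('a, 'b) monoid_scheme \<Rightarrow> ('a \<Rightarrow> 'a) \<Rightarrow> bool"
  where "TBFT_ff G \<phi> \<longleftrightarrow>
    finite (reidemeister_classes G \<phi>) \<and> finite (f_points_ff G \<phi>) \<and>
    reidemeister_number G \<phi> = card (f_points_ff G \<phi>)"


section \<open>The relations are equivalence relations\<close>

lemma reidemeister_relI:
  "g \<in> carrier G \<Longrightarrow> h \<in> carrier G \<Longrightarrow> x \<in> carrier G \<Longrightarrow>
   h = x \<otimes>\<^bsub>G\<^esub> g \<otimes>\<^bsub>G\<^esub> \<phi> (inv\<^bsub>G\<^esub> x) \<Longrightarrow> (g, h) \<in> reidemeister_rel G \<phi>"
  by (auto simp only: reidemeister_rel_def)

lemma equiv_reidemeister_rel: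
  assumes "group G" "\<phi> \<in> hom G G"
  shows "equiv (carrier G) (reidemeister_rel G \<phi>)"
proof -
  interpret group G by fact
  interpret group_hom G G \<phi> using assms by unfold_locales
  show ?thesis
  proof (rule equivI)
    show "reidemeister_rel G \<phi> \<subseteq> carrier G \<times> carrier G"
      by (auto simp: reidemeister_rel_def)
    show "refl_on (carrier G) (reidemeister_rel G \<phi>)"
      by (rule refl_onI) (auto simp: reidemeister_rel_def intro!: bexI[of _ "\<one>\<^bsub>G\<^esub>"])
    show "sym (reidemeister_rel G \<phi>)"
    proof (rule symI)
      fix g h assume "(g, h) \<in> reidemeister_rel G \<phi>"
      then obtain x where x: "g \<in> carrier G" "x \<in> carrier G" "h = x \<otimes>\<^bsub>G\<^esub> g \<otimes>\<^bsub>G\<^esub> \<phi> (inv\<^bsub>G\<^esub> x)"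
        by (auto simp: reidemeister_rel_def)
      have "\<phi> (inv\<^bsub>G\<^esub> x) \<otimes>\<^bsub>G\<^esub> \<phi> x = \<one>\<^bsub>G\<^esub>" using x by simp
      then have "g = inv\<^bsub>G\<^esub> x \<otimes>\<^bsub>G\<^esub> h \<otimes>\<^bsub>G\<^esub> \<phi> (inv\<^bsub>G\<^esub> (inv\<^bsub>G\<^esub> x))"
        using x by (simp add: m_assoc inv_solve_left)
      moreover have "h \<in> carrier G" using x by simp
      ultimately show "(h, g) \<in> reidemeister_rel G \<phi>"
        by (intro reidemeister_relI[OF _ x(1) group.inv_closed[OF assms(1) x(2)]])
    qed
    show "trans (reidemeister_rel G \<phi>)"
    proof (rule transI)
      fix g h k assume "(g, h) \<in> reidemeister_rel G \<phi>" "(h, k) \<in> reidemeister_rel G \<phi>"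
      then obtain x y where x: "g \<in> carrier G" "x \<in> carrier G" "h = x \<otimes>\<^bsub>G\<^esub> g \<otimes>\<^bsub>G\<^esub> \<phi> (inv\<^bsub>G\<^esub> x)"
         "y \<in> carrier G" "k = y \<otimes>\<^bsub>G\<^esub> h \<otimes>\<^bsub>G\<^esub> \<phi> (inv\<^bsub>G\<^esub> y)"
        by (auto simp: reidemeister_rel_def)
      have "k = (y \<otimes>\<^bsub>G\<^esub> x) \<otimes>\<^bsub>G\<^esub> g \<otimes>\<^bsub>G\<^esub> \<phi> (inv\<^bsub>G\<^esub> (y \<otimes>\<^bsub>G\<^esub> x))"
        using x by (simp add: m_assoc inv_mult_group)
      moreover have "k \<in> carrier G" using x by simp
      ultimately show "(g, k) \<in> reidemeister_rel G \<phi>"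
        by (intro reidemeister_relI[OF x(1) _ m_closed[OF x(4,2)]])
    qed
  qed
qed

lemma index_mat_adjoint:
  "i < dim_col A \<Longrightarrow> j < dim_row A \<Longrightarrow> mat_adjoint A $$ (i, j) = conjugate (A $$ (j, i))"
  by (simp add: mat_adjoint_def mat_of_rows_index)

lemma dim_mat_adjoint [simp]:
  "dim_row (mat_adjoint A) = dim_col A" "dim_col (mat_adjoint A) = dim_row A"
  by (simp_all add: mat_adjoint_def)

lemma mat_adjoint_mult:
  fixes A B :: "complex mat"
  assumes "A \<in> carrier_mat n n" "B \<in> carrier_mat n n"
  shows "mat_adjoint (A * B) = mat_adjoint B * mat_adjoint A"
  using assms
  by (intro eq_matI)
     (auto simp: index_mat_adjoint scalar_prod_def mult.commute intro!: sum.cong)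

lemma group_unitary_group: "group (unitary_group n)"
proof (rule groupI)
  fix x y z assume xyz: "x \<in> carrier (unitary_group n)" "y \<in> carrier (unitary_group n)"
    "z \<in> carrier (unitary_group n)"
  have [simp]: "mat_adjoint A \<in> carrier_mat n n" if "A \<in> carrier_mat n n" for A :: "complex mat"
    using that by (auto intro!: carrier_matI)
  have x: "x \<in> carrier_mat n n" "mat_adjoint x \<in> carrier_mat n n"
      "x * mat_adjoint x = 1\<^sub>m n" "mat_adjoint x * x = 1\<^sub>m n"
    and y: "y \<in> carrier_mat n n" "mat_adjoint y \<in> carrier_mat n n"
      "y * mat_adjoint y = 1\<^sub>m n" "mat_adjoint y * y = 1\<^sub>m n"
    and z: "z \<in> carrier_mat n n"
    using xyz by (auto simp: unitary_group_def)
  have assoc: "A * B * (C * D) = A * (B * C) * D"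
    if "A \<in> carrier_mat n n" "B \<in> carrier_mat n n" "C \<in> carrier_mat n n" "D \<in> carrier_mat n n"
    for A B C D :: "complex mat"
    using assoc_mult_mat[OF that(1,2) mult_carrier_mat[OF that(3,4)]] assoc_mult_mat[OF that(2-4)]
      assoc_mult_mat[OF that(1) mult_carrier_mat[OF that(2,3)] that(4)]
    by simp
  have "x * y * (mat_adjoint y * mat_adjoint x) = x * (y * mat_adjoint y) * mat_adjoint x"
    by (rule assoc[OF x(1) y(1,2) x(2)])
  moreover have "mat_adjoint y * mat_adjoint x * (x * y) = mat_adjoint y * (mat_adjoint x * x) * y"
    by (rule assoc[OF y(2) x(2,1) y(1)])
  ultimately show "x \<otimes>\<^bsub>unitary_group n\<^esub> y \<in> carrier (unitary_group n)"
    using x y by (simp add: unitary_group_def mat_adjoint_mult[of _ n])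
  show "x \<otimes>\<^bsub>unitary_group n\<^esub> y \<otimes>\<^bsub>unitary_group n\<^esub> z
      = x \<otimes>\<^bsub>unitary_group n\<^esub> (y \<otimes>\<^bsub>unitary_group n\<^esub> z)"
    using x y z by (simp add: unitary_group_def)
next
  have "mat_adjoint (1\<^sub>m n) = (1\<^sub>m n :: complex mat)"
    by (intro eq_matI) (auto simp: index_mat_adjoint)
  then show "\<one>\<^bsub>unitary_group n\<^esub> \<in> carrier (unitary_group n)"
    by (simp add: unitary_group_def)
next
  fix x assume x: "x \<in> carrier (unitary_group n)"
  then show "\<one>\<^bsub>unitary_group n\<^esub> \<otimes>\<^bsub>unitary_group n\<^esub> x = x"
    by (auto simp: unitary_group_def)
  have "mat_adjoint (mat_adjoint x) = x"
    by (intro eq_matI) (auto simp: index_mat_adjoint)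
  then show "\<exists>y \<in> carrier (unitary_group n). y \<otimes>\<^bsub>unitary_group n\<^esub> x = \<one>\<^bsub>unitary_group n\<^esub>"
    using x by (intro bexI[of _ "mat_adjoint x"]) (auto simp: unitary_group_def intro!: carrier_matI)
qed

lemma unitary_equivI:
  "unitary_rep G n \<rho> \<Longrightarrow> unitary_rep G n \<sigma> \<Longrightarrow> U \<in> carrier (unitary_group n) \<Longrightarrow>
   (\<And>g. g \<in> carrier G \<Longrightarrow> U * \<rho> g = \<sigma> g * U) \<Longrightarrow> (\<rho>, \<sigma>) \<in> unitary_equiv G"
  by (auto simp only: unitary_equiv_def)

lemma equiv_unitary_equiv:
  assumes "group G"
  shows "equiv {\<rho>. \<exists>n. unitary_rep G n \<rho>} (unitary_equiv G)"
proof (rule equivI)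
  show "unitary_equiv G \<subseteq> {\<rho>. \<exists>n. unitary_rep G n \<rho>} \<times> {\<rho>. \<exists>n. unitary_rep G n \<rho>}"
    by (auto simp: unitary_equiv_def)
  show "refl_on {\<rho>. \<exists>n. unitary_rep G n \<rho>} (unitary_equiv G)"
  proof (rule refl_onI)
    fix \<rho> assume "\<rho> \<in> {\<rho>. \<exists>n. unitary_rep G n \<rho>}"
    then obtain n where n: "unitary_rep G n \<rho>" by auto
    interpret U: group "unitary_group n" by (rule group_unitary_group)
    have "\<rho> g \<in> carrier_mat n n" if "g \<in> carrier G" for g
      using n that by (auto simp: unitary_rep_def hom_def unitary_group_def)
    then have "1\<^sub>m n * \<rho> g = \<rho> g * 1\<^sub>m n" if "g \<in> carrier G" for g
      using left_mult_one_mat[of "\<rho> g" n n] right_mult_one_mat[of "\<rho> g" n n] that by simp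
    moreover have "1\<^sub>m n \<in> carrier (unitary_group n)"
      using U.one_closed by (simp add: unitary_group_def)
    ultimately show "(\<rho>, \<rho>) \<in> unitary_equiv G"
      using unitary_equivI[OF n n] by blast
  qed
  show "sym (unitary_equiv G)"
  proof (rule symI)
    fix \<rho> \<sigma> assume "(\<rho>, \<sigma>) \<in> unitary_equiv G"
    then obtain n U where n: "unitary_rep G n \<rho>" "unitary_rep G n \<sigma>"
      and U: "U \<in> carrier (unitary_group n)" "\<forall>g \<in> carrier G. U * \<rho> g = \<sigma> g * U"
      by (auto simp: unitary_equiv_def)
    interpret U: group "unitary_group n" by (rule group_unitary_group)
    let ?V = "inv\<^bsub>unitary_group n\<^esub> U"
    have mult: "A \<otimes>\<^bsub>unitary_group n\<^esub> B = A * B" for A B by (simp add: unitary_group_def)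
    have "?V * \<sigma> g = \<rho> g * ?V" if g: "g \<in> carrier G" for g
    proof -
      have c: "\<rho> g \<in> carrier (unitary_group n)" "\<sigma> g \<in> carrier (unitary_group n)"
        using n g by (auto simp: unitary_rep_def hom_def)
      have eq: "U \<otimes>\<^bsub>unitary_group n\<^esub> \<rho> g = \<sigma> g \<otimes>\<^bsub>unitary_group n\<^esub> U"
        using U(2) g by (simp add: mult)
      have "U \<otimes>\<^bsub>unitary_group n\<^esub> (\<rho> g \<otimes>\<^bsub>unitary_group n\<^esub> ?V) = U \<otimes>\<^bsub>unitary_group n\<^esub> \<rho> g \<otimes>\<^bsub>unitary_group n\<^esub> ?V"
        by (rule U.m_assoc[symmetric, OF U(1) c(1) U.inv_closed[OF U(1)]])
      also have "\<dots> = \<sigma> g \<otimes>\<^bsub>unitary_group n\<^esub> (U \<otimes>\<^bsub>unitary_group n\<^esub> ?V)"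
        unfolding eq by (rule U.m_assoc[OF c(2) U(1) U.inv_closed[OF U(1)]])
      also have "\<dots> = \<sigma> g"
        using U.r_inv[OF U(1)] U.r_one[OF c(2)] by simp
      finally have "?V \<otimes>\<^bsub>unitary_group n\<^esub> \<sigma> g = \<rho> g \<otimes>\<^bsub>unitary_group n\<^esub> ?V"
        using U.inv_solve_left'[OF U.m_closed[OF c(1) U.inv_closed[OF U(1)]] U(1) c(2)] by simp
      then show ?thesis by (simp add: mult)
    qed
    then show "(\<sigma>, \<rho>) \<in> unitary_equiv G"
      by (rule unitary_equivI[OF n(2,1) U.inv_closed[OF U(1)]])
  qed
  show "trans (unitary_equiv G)"
  proof (rule transI)
    fix \<rho> \<sigma> \<tau> assume "(\<rho>, \<sigma>) \<in> unitary_equiv G" "(\<sigma>, \<tau>) \<in> unitary_equiv G"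
    then obtain n U m V where n: "unitary_rep G n \<rho>" "unitary_rep G n \<sigma>"
        "unitary_rep G m \<sigma>" "unitary_rep G m \<tau>"
      and U: "U \<in> carrier (unitary_group n)" "\<forall>g \<in> carrier G. U * \<rho> g = \<sigma> g * U"
      and V: "V \<in> carrier (unitary_group m)" "\<forall>g \<in> carrier G. V * \<sigma> g = \<tau> g * V"
      by (auto simp: unitary_equiv_def)
    show "(\<rho>, \<tau>) \<in> unitary_equiv G"
    proof -
      interpret group G by fact
      have "\<sigma> \<one>\<^bsub>G\<^esub> \<in> carrier_mat n n" "\<sigma> \<one>\<^bsub>G\<^esub> \<in> carrier_mat m m"
        using n(2,3) one_closed by (auto simp: unitary_rep_def unitary_group_def dest: hom_in_carrier)
      then have [simp]: "m = n" by auto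
      interpret U: group "unitary_group n" by (rule group_unitary_group)
      have mult: "A \<otimes>\<^bsub>unitary_group n\<^esub> B = A * B" for A B by (simp add: unitary_group_def)
      have "(V * U) * \<rho> g = \<tau> g * (V * U)" if g: "g \<in> carrier G" for g
      proof -
        have "\<rho> g \<in> carrier (unitary_group n)" "\<sigma> g \<in> carrier (unitary_group n)"
          "\<tau> g \<in> carrier (unitary_group n)"
          using n g by (auto simp: unitary_rep_def hom_def)
        then show ?thesis
          using U V g U.m_assoc[of V U "\<rho> g"] U.m_assoc[of V "\<sigma> g" U] U.m_assoc[of "\<tau> g" V U]
          by (simp add: mult)
      qed
      moreover have "V * U \<in> carrier (unitary_group n)"
        using U.m_closed[of V U] U(1) V(1) by (simp add: mult)
      ultimately show ?thesis
        using unitary_equivI[of G n \<rho> \<tau> "V * U"] n by simp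
    qed
  qed
qed

end

theory Submission
  imports Defs "Jordan_Normal_Form.Spectral_Radius"
begin

text \<open>
  The theorem compares \<open>G\<close> with its finite quotients.

  For a finite group both numbers are the dimension of the space of functions that are constant on
  Reidemeister classes. The indicators of the classes form one orthonormal basis. The other one
  comes from the Schur orthogonality relations: the function \<open>g \<mapsto> tr (A \<rho>(g))\<close>, with \<open>\<rho>\<close>
  irreducible, is constant on Reidemeister classes when \<open>A\<close> intertwines \<open>\<rho>\<close> and \<open>\<rho> \<circ> \<phi>\<close>.
  These two representations have the same dimension, so by Schur's lemma the intertwiners form a
  line if \<open>\<rho>\<close> is an f-point and vanish otherwise, even if \<open>\<rho> \<circ> \<phi>\<close> is reducible. Averaging over
  the twisted action shows that these functions, one for each f-point, span. This is
  \<open>TBFT_ff_finite\<close>.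

  Now let \<open>G\<close> be arbitrary with \<open>R(\<phi>)\<close> finite. The kernel of an f-point is \<open>\<phi>\<close>-invariant, so any
  finite set of f-points lives on one finite quotient on which \<open>\<phi>\<close> acts. Hence there are at most
  \<open>R(\<phi>)\<close> of them (\<open>finite_f_points_le\<close>). For equality it suffices to find one finite quotient with
  the same Reidemeister number, that is, a \<open>\<phi>\<close>-invariant normal subgroup of finite index such that
  every Reidemeister class is a union of its cosets (\<open>twisted_classes_saturated\<close>). Right translation
  turns the class of \<open>g\<close> under \<open>\<phi>\<close> into the class of the identity under \<open>x \<mapsto> g \<phi>(x) g\<inverse>\<close>, and a
  fully invariant subgroup is stable under all these endomorphisms. So everything rests on the
  following property of a polycyclic group \<open>H\<close> with an endomorphism \<open>\<psi>\<close> that has finitely many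
  classes: the set of all \<open>x \<psi>(x)\<inverse>\<close> contains a subgroup of finite index
  (\<open>twisted_orbit_contains_finite_index\<close>).

  This is proved by induction on the derived length. Let \<open>K\<close> be the derived subgroup of \<open>H\<close>. On the
  finitely generated abelian group \<open>H/K\<close> the endomorphism \<open>x \<mapsto> x \<psi>(x)\<inverse>\<close> has finite cokernel,
  hence finite kernel, and therefore \<open>\<psi>\<close> has finitely many classes on \<open>K\<close> as well. By induction
  the elements \<open>x \<psi>(x)\<inverse>\<close> with \<open>x \<in> K\<close> contain a subgroup \<open>L\<close> of finite index in \<open>K\<close>, which may be
  taken normal in \<open>H\<close>. A polycyclic group induces the full profinite topology on its subgroups
  (\<open>polycyclic_separates_subgroup\<close>), so some \<open>M\<close> of finite index in \<open>H\<close> meets \<open>K\<close> inside \<open>L\<close>. Modulo \<open>L\<close>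
  the group \<open>M\<close> is abelian, so there the elements \<open>x \<psi>(x)\<inverse>\<close> form a subgroup, again of finite index,
  and \<open>L\<close> itself is absorbed by what was found in \<open>K\<close>.
\<close>

hide_const (open) Multiset.mult
hide_const (open) Real_Vector_Spaces.subspace

section \<open>Subgroups of finite index\<close>

text \<open>Finitely many right cosets of \<open>N\<close> cover \<open>H\<close>. The formulation with sets inside one ambient group
makes it unnecessary to regard \<open>H\<close> as a group of its own.\<close>

definition finite_index :: "('a, 'b) monoid_scheme \<Rightarrow> 'a set \<Rightarrow> 'a set \<Rightarrow> bool"
  where "finite_index G N H \<longleftrightarrow>
    (\<exists>T. finite T \<and> T \<subseteq> H \<and> (\<forall>h \<in> H. \<exists>t \<in> T. h \<otimes>\<^bsub>G\<^esub> inv\<^bsub>G\<^esub> t \<in> N))"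

context group
begin

lemma inv_cancel_assoc [simp]:
  assumes "x \<in> carrier G" "y \<in> carrier G"
  shows "inv x \<otimes> (x \<otimes> y) = y" "x \<otimes> (inv x \<otimes> y) = y"
  using assms by (simp_all add: m_assoc [symmetric])

text \<open>Finite index is mostly established by a map with finite range whose fibres lie in single
cosets; \<open>finite_index_mapE\<close> provides such a map.\<close>

lemma finite_indexI_map:
  assumes "finite (f ` H)"
    and "\<And>x y. x \<in> H \<Longrightarrow> y \<in> H \<Longrightarrow> f x = f y \<Longrightarrow> x \<otimes> inv y \<in> N"
  shows "finite_index G N H"
proof -
  define r where "r v = (SOME x. x \<in> H \<and> f x = v)" for v
  have r: "r (f x) \<in> H \<and> f (r (f x)) = f x" if "x \<in> H" for x
    unfolding r_def by (rule someI[of _ x]) (use that in simp)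
  show ?thesis
    unfolding finite_index_def
  proof (intro exI[of _ "r ` f ` H"] conjI ballI)
    show "finite (r ` f ` H)" using assms(1) by simp
    show "r ` f ` H \<subseteq> H" using r by blast
    fix h assume h: "h \<in> H"
    have "h \<otimes> inv (r (f h)) \<in> N" using r[OF h] by (intro assms(2) h) simp_all
    then show "\<exists>t \<in> r ` f ` H. h \<otimes> inv t \<in> N" using h by blast
  qed
qed

lemma finite_index_mapE:
  assumes "finite_index G N H" "subgroup N G" "H \<subseteq> carrier G"
  obtains f :: "'a \<Rightarrow> 'a" where "finite (f ` H)"
    "\<And>x y. x \<in> H \<Longrightarrow> y \<in> H \<Longrightarrow> f x = f y \<Longrightarrow> x \<otimes> inv y \<in> N"
proof -
  obtain T where T: "finite T" "T \<subseteq> H" "\<forall>h \<in> H. \<exists>t \<in> T. h \<otimes> inv t \<in> N"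
    using assms(1) unfolding finite_index_def by blast
  then obtain f where f: "\<And>h. h \<in> H \<Longrightarrow> f h \<in> T \<and> h \<otimes> inv (f h) \<in> N" by metis
  show thesis
  proof (rule that[of f])
    show "finite (f ` H)" using f T(1) by (meson finite_subset image_subsetI)
    fix x y assume xy: "x \<in> H" "y \<in> H" "f x = f y"
    have c: "x \<in> carrier G" "y \<in> carrier G" "f y \<in> carrier G"
      using xy f T(2) assms(3) by auto
    have "(x \<otimes> inv (f y)) \<otimes> inv (y \<otimes> inv (f y)) \<in> N"
      using f[OF xy(1)] f[OF xy(2)] xy(3) assms(2) by (simp add: subgroup.m_closed subgroup.m_inv_closed)
    also have "(x \<otimes> inv (f y)) \<otimes> inv (y \<otimes> inv (f y)) = x \<otimes> inv y"
      using c by (simp add: inv_mult_group m_assoc)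
    finally show "x \<otimes> inv y \<in> N" .
  qed
qed

lemma finite_index_self:
  assumes "subgroup H G"
  shows "finite_index G H H"
proof (rule finite_indexI_map[of "\<lambda>_. \<one>"])
  show "finite ((\<lambda>_. \<one>) ` H)" by (rule finite_subset[of _ "{\<one>}"]) auto
qed (use assms in \<open>simp add: subgroup.m_closed subgroup.m_inv_closed\<close>)

lemma finite_index_trans:
  assumes "finite_index G N M" "finite_index G M H" "M \<subseteq> H" "subgroup H G"
  shows "finite_index G N H"
proof -
  obtain S T where S: "finite S" "S \<subseteq> M" "\<forall>h \<in> M. \<exists>t \<in> S. h \<otimes> inv t \<in> N"
    and T: "finite T" "T \<subseteq> H" "\<forall>h \<in> H. \<exists>t \<in> T. h \<otimes> inv t \<in> M"
    using assms(1,2) unfolding finite_index_def by blast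
  have HC: "H \<subseteq> carrier G" using assms(4) by (rule subgroup.subset)
  show ?thesis unfolding finite_index_def
  proof (intro exI[of _ "(\<lambda>(s,t). s \<otimes> t) ` (S \<times> T)"] conjI ballI)
    show "finite ((\<lambda>(s,t). s \<otimes> t) ` (S \<times> T))" using S T by simp
    show "(\<lambda>(s,t). s \<otimes> t) ` (S \<times> T) \<subseteq> H"
    proof clarify
      fix s t assume "s \<in> S" "t \<in> T"
      then show "s \<otimes> t \<in> H" using S(2) T(2) assms(3) by (intro subgroup.m_closed[OF assms(4)]) blast+
    qed
    fix h assume h: "h \<in> H"
    then obtain t where t: "t \<in> T" "h \<otimes> inv t \<in> M" using T by blast
    then obtain s where s: "s \<in> S" "h \<otimes> inv t \<otimes> inv s \<in> N" using S by blast
    have "h \<otimes> inv (s \<otimes> t) = h \<otimes> inv t \<otimes> inv s"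
    proof -
      have "h \<in> carrier G" "s \<in> carrier G" "t \<in> carrier G"
        using h t(1) s(1) S(2) T(2) assms(3) HC by blast+
      then show ?thesis by (simp add: inv_mult_group m_assoc)
    qed
    then show "\<exists>u \<in> (\<lambda>(s,t). s \<otimes> t) ` (S \<times> T). h \<otimes> inv u \<in> N"
      using s t by (intro bexI[of _ "s \<otimes> t"]) auto
  qed
qed

lemma finite_index_Inter:
  assumes "finite I" "subgroup H G"
    and "\<And>i. i \<in> I \<Longrightarrow> subgroup (N i) G" "\<And>i. i \<in> I \<Longrightarrow> finite_index G (N i) H"
  shows "finite_index G {h \<in> H. \<forall>i \<in> I. h \<in> N i} H"
proof -
  have HC: "H \<subseteq> carrier G" using assms(2) by (rule subgroup.subset)
  have "\<exists>f :: 'a \<Rightarrow> 'a. finite (f ` H) \<and> (\<forall>x\<in>H. \<forall>y\<in>H. f x = f y \<longrightarrow> x \<otimes> inv y \<in> N i)"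
    if "i \<in> I" for i
    using finite_index_mapE[OF assms(4)[OF that] assms(3)[OF that] HC] by metis
  then obtain f :: "'c \<Rightarrow> 'a \<Rightarrow> 'a" where
    f: "\<And>i. i \<in> I \<Longrightarrow> finite (f i ` H)"
       "\<And>i x y. i \<in> I \<Longrightarrow> x \<in> H \<Longrightarrow> y \<in> H \<Longrightarrow> f i x = f i y \<Longrightarrow> x \<otimes> inv y \<in> N i"
    by metis
  show ?thesis
  proof (rule finite_indexI_map[of "\<lambda>x. restrict (\<lambda>i. f i x) I"])
    have "(\<lambda>x. restrict (\<lambda>i. f i x) I) ` H \<subseteq> (\<Pi>\<^sub>E i\<in>I. f i ` H)" by auto
    then show "finite ((\<lambda>x. restrict (\<lambda>i. f i x) I) ` H)"
      using f(1) assms(1) by (meson finite_PiE finite_subset)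
    fix x y assume xy: "x \<in> H" "y \<in> H" "restrict (\<lambda>i. f i x) I = restrict (\<lambda>i. f i y) I"
    have "f i x = f i y" if "i \<in> I" for i
      using fun_cong[OF xy(3), of i] that by simp
    then show "x \<otimes> inv y \<in> {h \<in> H. \<forall>i \<in> I. h \<in> N i}"
      using xy f(2) assms(2) by (auto simp: subgroup.m_closed subgroup.m_inv_closed)
  qed
qed

lemma finite_index_Int_subgroup:
  assumes "finite_index G N H" "subgroup N G" "subgroup K G" "K \<subseteq> H" "H \<subseteq> carrier G"
  shows "finite_index G (N \<inter> K) K"
proof -
  obtain f :: "'a \<Rightarrow> 'a" where f: "finite (f ` H)"
    "\<And>x y. x \<in> H \<Longrightarrow> y \<in> H \<Longrightarrow> f x = f y \<Longrightarrow> x \<otimes> inv y \<in> N"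
    using finite_index_mapE[OF assms(1,2,5)] by metis
  show ?thesis
    by (rule finite_indexI_map[of f])
      (use f assms(3,4) in \<open>auto intro: finite_subset[OF image_mono[of K H f]] simp: subgroup.m_closed subgroup.m_inv_closed subset_iff\<close>)
qed

lemma finite_index_if_finite_rcosets:
  assumes "subgroup H G" "finite (rcosets H)"
  shows "finite_index G H (carrier G)"
proof (rule finite_indexI_map[of "\<lambda>x. H #> x"])
  show "finite ((#>) H ` carrier G)"
    using assms(2) by (rule finite_subset[rotated]) (auto simp: RCOSETS_def)
  fix x y assume "x \<in> carrier G" "y \<in> carrier G" "H #> x = H #> y"
  then show "x \<otimes> inv y \<in> H"
    using assms(1) by (metis is_group rcos_self subgroup.rcos_module_imp)
qed

lemma finite_rcosets_if_finite_index:
  assumes "subgroup N G" "finite_index G N (carrier G)"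
  shows "finite (rcosets N)"
proof -
  obtain T where T: "finite T" "T \<subseteq> carrier G" "\<forall>h \<in> carrier G. \<exists>t \<in> T. h \<otimes> inv t \<in> N"
    using assms(2) unfolding finite_index_def by blast
  have "rcosets N \<subseteq> (\<lambda>t. N #> t) ` T"
  proof
    fix C assume "C \<in> rcosets N"
    then obtain h where h: "h \<in> carrier G" "C = N #> h" by (auto simp: RCOSETS_def)
    then obtain t where t: "t \<in> T" "h \<otimes> inv t \<in> N" using T by blast
    have "h \<in> N #> t" using t T h by (intro subgroup.rcos_module_rev[OF assms(1) is_group]) auto
    then have "N #> h = N #> t" using repr_independence[of h N t] assms(1) t T by auto
    then show "C \<in> (\<lambda>t. N #> t) ` T" using h t by auto
  qed
  then show ?thesis using T(1) by (meson finite_imageI finite_subset)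
qed

subsection \<open>Fully invariant subgroups of finite index\<close>

text \<open>A homomorphism is determined on a subgroup by its values on generators; this makes the set
of homomorphisms from a finitely generated group to a finite group finite.\<close>

lemma hom_eq_on_generate:
  assumes "group Q" "f \<in> hom (G\<lparr>carrier := H\<rparr>) Q" "g \<in> hom (G\<lparr>carrier := H\<rparr>) Q"
    and "subgroup H G" "X \<subseteq> H" "\<And>x. x \<in> X \<Longrightarrow> f x = g x" "y \<in> generate G X"
  shows "f y = g y"
proof -
  interpret H: group "G\<lparr>carrier := H\<rparr>" using assms(4) by (rule subgroup_imp_group)
  interpret f: group_hom "G\<lparr>carrier := H\<rparr>" Q f
    using assms by (simp add: group_hom_def group_hom_axioms_def H.is_group)
  interpret g: group_hom "G\<lparr>carrier := H\<rparr>" Q g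
    using assms by (simp add: group_hom_def group_hom_axioms_def H.is_group)
  have gen: "generate G X \<subseteq> H" using generate_subgroup_incl[OF assms(5,4)] .
  show ?thesis using assms(7)
  proof (induction y rule: generate.induct)
    case one
    show ?case using f.hom_one g.hom_one by simp
  next
    case (incl h)
    then show ?case using assms(6) by blast
  next
    case (inv h)
    then show ?case
      using f.hom_inv[of h] g.hom_inv[of h] assms(4,5,6) m_inv_consistent[OF assms(4), of h] by auto
  next
    case (eng h1 h2)
    then have "h1 \<in> H" "h2 \<in> H" using gen by blast+
    then show ?case using f.hom_mult[of h1 h2] g.hom_mult[of h1 h2] eng by simp
  qed
qed

text \<open>The normal core is the intersection of all conjugates, equivalently the kernel of the action on
the finitely many cosets of \<open>M\<close>; the second description gives the finite index.\<close>

lemma normal_core: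
  assumes H: "subgroup H G" and M: "subgroup M G" "M \<subseteq> H" "finite_index G M H"
  obtains C where "C \<lhd> G\<lparr>carrier := H\<rparr>" "C \<subseteq> M" "finite_index G C H"
proof -
  have HC: "H \<subseteq> carrier G" using H by (rule subgroup.subset)
  define C where "C = {x \<in> H. \<forall>h \<in> H. h \<otimes> x \<otimes> inv h \<in> M}"
  interpret H: group "G\<lparr>carrier := H\<rparr>" using H by (rule subgroup_imp_group)
  have [simp]: "\<And>x. x \<in> H \<Longrightarrow> x \<in> carrier G" using HC by blast
  note H_cl = subgroup.m_closed[OF H] subgroup.m_inv_closed[OF H] subgroup.one_closed[OF H]
  have "subgroup C G"
  proof (rule subgroupI)
    show "C \<subseteq> carrier G" unfolding C_def by auto
    have "\<one> \<in> C" unfolding C_def using H_cl M(1) by (auto simp: subgroup.one_closed)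
    then show "C \<noteq> {}" by blast
  next
    fix a assume a: "a \<in> C"
    have "h \<otimes> inv a \<otimes> inv h \<in> M" if h: "h \<in> H" for h
    proof -
      have "inv (h \<otimes> a \<otimes> inv h) \<in> M" using a h M(1) unfolding C_def by (auto intro: subgroup.m_inv_closed)
      also have "inv (h \<otimes> a \<otimes> inv h) = h \<otimes> inv a \<otimes> inv h"
        using a h unfolding C_def by (simp add: inv_mult_group m_assoc)
      finally show ?thesis .
    qed
    then show "inv a \<in> C" using a H_cl unfolding C_def by auto
  next
    fix a b assume ab: "a \<in> C" "b \<in> C"
    have "h \<otimes> (a \<otimes> b) \<otimes> inv h \<in> M" if h: "h \<in> H" for h
    proof -
      have "(h \<otimes> a \<otimes> inv h) \<otimes> (h \<otimes> b \<otimes> inv h) \<in> M"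
        using ab h M(1) unfolding C_def by (auto intro: subgroup.m_closed)
      also have "(h \<otimes> a \<otimes> inv h) \<otimes> (h \<otimes> b \<otimes> inv h) = h \<otimes> (a \<otimes> b) \<otimes> inv h"
        using ab h unfolding C_def by (simp add: m_assoc)
      finally show ?thesis .
    qed
    then show "a \<otimes> b \<in> C" using ab H_cl unfolding C_def by auto
  qed
  then have sC: "subgroup C (G\<lparr>carrier := H\<rparr>)"
    by (rule subgroup_incl[OF _ H]) (auto simp: C_def)
  have "C \<lhd> G\<lparr>carrier := H\<rparr>"
    unfolding H.normal_inv_iff
  proof (intro conjI ballI)
    fix x k assume xk: "x \<in> carrier (G\<lparr>carrier := H\<rparr>)" "k \<in> C"
    have "x \<otimes> k \<otimes> inv x \<in> C"
    proof -
      have "h \<otimes> (x \<otimes> k \<otimes> inv x) \<otimes> inv h \<in> M" if h: "h \<in> H" for h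
      proof -
        have "(h \<otimes> x) \<otimes> k \<otimes> inv (h \<otimes> x) \<in> M" using xk h H_cl unfolding C_def by auto
        also have "(h \<otimes> x) \<otimes> k \<otimes> inv (h \<otimes> x) = h \<otimes> (x \<otimes> k \<otimes> inv x) \<otimes> inv h"
          using xk h unfolding C_def by (simp add: inv_mult_group m_assoc)
        finally show ?thesis .
      qed
      then show ?thesis using xk H_cl unfolding C_def by auto
    qed
    then show "x \<otimes>\<^bsub>G\<lparr>carrier := H\<rparr>\<^esub> k \<otimes>\<^bsub>G\<lparr>carrier := H\<rparr>\<^esub> inv\<^bsub>G\<lparr>carrier := H\<rparr>\<^esub> x \<in> C"
      using xk m_inv_consistent[OF H, of x] by simp
  qed (rule sC)
  moreover have "C \<subseteq> M"
  proof
    fix x assume "x \<in> C"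
    then have "\<one> \<otimes> x \<otimes> inv \<one> \<in> M" "x \<in> H" unfolding C_def using H_cl by auto
    then show "x \<in> M" by simp
  qed
  moreover have "finite_index G C H"
  proof -
    obtain T where T: "finite T" "T \<subseteq> H" "\<forall>h \<in> H. \<exists>t \<in> T. h \<otimes> inv t \<in> M"
      using M(3) unfolding finite_index_def by blast
    define f where "f x = (SOME t. t \<in> T \<and> x \<otimes> inv t \<in> M)" for x
    have f: "f x \<in> T \<and> x \<otimes> inv (f x) \<in> M" if "x \<in> H" for x
      unfolding f_def by (rule someI_ex) (use T that in blast)
    show ?thesis
    \<comment> \<open>\<open>x\<close> is recorded by how right multiplication by it permutes the right cosets of \<open>M\<close>.\<close>
    proof (rule finite_indexI_map[of "\<lambda>x. restrict (\<lambda>t. f (t \<otimes> x)) T"])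
      have "(\<lambda>x. restrict (\<lambda>t. f (t \<otimes> x)) T) ` H \<subseteq> (\<Pi>\<^sub>E t\<in>T. T)"
        using f T(2) H_cl by (auto simp: PiE_def Pi_def)
      then show "finite ((\<lambda>x. restrict (\<lambda>t. f (t \<otimes> x)) T) ` H)"
        using T(1) by (meson finite_PiE finite_subset)
    next
      fix x y assume xy: "x \<in> H" "y \<in> H" "restrict (\<lambda>t. f (t \<otimes> x)) T = restrict (\<lambda>t. f (t \<otimes> y)) T"
      have "h \<otimes> (x \<otimes> inv y) \<otimes> inv h \<in> M" if h: "h \<in> H" for h
      proof -
        obtain t where t: "t \<in> T" "h \<otimes> inv t \<in> M" using T h by blast
        let ?s = "f (t \<otimes> x)"
        have tH: "t \<in> H" using t T by blast
        have s: "f (t \<otimes> y) = ?s" using fun_cong[OF xy(3), of t] t by simp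
        have sT: "?s \<in> H" "(t \<otimes> x) \<otimes> inv ?s \<in> M" "(t \<otimes> y) \<otimes> inv ?s \<in> M"
          using f[of "t \<otimes> x"] f[of "t \<otimes> y"] T(2) s xy tH H_cl by auto
        have "(h \<otimes> inv t) \<otimes> ((t \<otimes> x) \<otimes> inv ?s) \<otimes> inv ((t \<otimes> y) \<otimes> inv ?s) \<otimes> inv (h \<otimes> inv t) \<in> M"
          using subgroup.m_closed[OF M(1)] subgroup.m_inv_closed[OF M(1)] t sT by meson
        also have "(h \<otimes> inv t) \<otimes> ((t \<otimes> x) \<otimes> inv ?s) \<otimes> inv ((t \<otimes> y) \<otimes> inv ?s) \<otimes> inv (h \<otimes> inv t)
          = h \<otimes> (x \<otimes> inv y) \<otimes> inv h"
          using h tH sT(1) xy by (simp add: inv_mult_group m_assoc)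
        finally show ?thesis .
      qed
      then show "x \<otimes> inv y \<in> C" using xy H_cl unfolding C_def by auto
    qed
  qed
  ultimately show thesis by (rule that)
qed

text \<open>Intersect the kernels of all homomorphisms from \<open>H\<close> to one fixed finite quotient. Composition
with an endomorphism maps this family of homomorphisms into itself, so the intersection is
invariant, and it has finite index because a finitely generated group has only finitely many
homomorphisms to a finite group.\<close>

lemma fully_invariant_core:
  assumes H: "subgroup H G" and X: "finite X" "X \<subseteq> H" "H = generate G X"
    and M: "subgroup M G" "M \<subseteq> H" "finite_index G M H"
  obtains N where "subgroup N G" "N \<subseteq> M" "finite_index G N H"
    "\<And>\<psi>. \<psi> \<in> hom (G\<lparr>carrier := H\<rparr>) (G\<lparr>carrier := H\<rparr>) \<Longrightarrow> \<psi> ` N \<subseteq> N"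
proof -
  let ?H = "G\<lparr>carrier := H\<rparr>"
  have HC: "H \<subseteq> carrier G" using H by (rule subgroup.subset)
  interpret H: group ?H using H by (rule subgroup_imp_group)
  obtain C where C: "C \<lhd> ?H" "C \<subseteq> M" "finite_index G C H"
    using normal_core[OF H M] by blast
  interpret C: normal C ?H by fact
  let ?Q = "?H Mod C"
  have Q: "group ?Q" by (rule C.factorgroup_is_group)
  have inv_H: "inv\<^bsub>?H\<^esub> x = inv x" if "x \<in> H" for x using m_inv_consistent[OF H that] by simp
  have "finite_index ?H C (carrier ?H)"
  proof -
    obtain T where T: "finite T" "T \<subseteq> H" "\<forall>h \<in> H. \<exists>t \<in> T. h \<otimes> inv t \<in> C"
      using C(3) unfolding finite_index_def by blast
    have "\<forall>h \<in> H. \<exists>t \<in> T. h \<otimes> inv\<^bsub>?H\<^esub> t \<in> C"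
    proof
      fix h assume "h \<in> H"
      then obtain t where t: "t \<in> T" "h \<otimes> inv t \<in> C" using T(3) by blast
      then have "t \<in> H" using T(2) by blast
      have "h \<otimes> inv\<^bsub>?H\<^esub> t \<in> C" unfolding inv_H[OF \<open>t \<in> H\<close>] by (rule t(2))
      then show "\<exists>t \<in> T. h \<otimes> inv\<^bsub>?H\<^esub> t \<in> C" using t(1) by (rule bexI)
    qed
    then have "\<forall>h \<in> carrier ?H. \<exists>t \<in> T. h \<otimes>\<^bsub>?H\<^esub> inv\<^bsub>?H\<^esub> t \<in> C" by simp
    moreover have "T \<subseteq> carrier ?H" using T(2) by simp
    ultimately show ?thesis unfolding finite_index_def using T(1) by blast
  qed
  then have finQ: "finite (carrier ?Q)"
    using H.finite_rcosets_if_finite_index[OF C.subgroup_axioms] by (simp add: FactGroup_def)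
  interpret Q: group ?Q by (rule Q)
  have hom_div: "f (x \<otimes> inv y) = f x \<otimes>\<^bsub>?Q\<^esub> inv\<^bsub>?Q\<^esub> f y \<and> f x \<in> carrier ?Q \<and> f y \<in> carrier ?Q"
    if "f \<in> hom ?H ?Q" "x \<in> H" "y \<in> H" for f x y
  proof -
    interpret f: group_hom ?H ?Q f using that(1) by unfold_locales
    show ?thesis
      using that f.hom_mult[of x "inv y"] f.hom_inv[of y] inv_H[of y] subgroup.m_inv_closed[OF H]
        f.hom_closed[of x] f.hom_closed[of y] by simp
  qed
  have hom1: "f \<one> = \<one>\<^bsub>?Q\<^esub>" if "f \<in> hom ?H ?Q" for f
    using hom_one[OF that H.is_group Q] by simp
  \<comment> \<open>A subgroup cut out by all homomorphisms into one group is stable under endomorphisms.\<close>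
  define N where "N = {x \<in> H. \<forall>f \<in> hom ?H ?Q. f x = \<one>\<^bsub>?Q\<^esub>}"
  have div_N: "x \<otimes> inv y \<in> N" if "x \<in> H" "y \<in> H" and eq: "\<And>f. f \<in> hom ?H ?Q \<Longrightarrow> f x = f y" for x y
  proof -
    have "f (x \<otimes> inv y) = \<one>\<^bsub>?Q\<^esub>" if "f \<in> hom ?H ?Q" for f
      using hom_div[OF that \<open>x \<in> H\<close> \<open>y \<in> H\<close>] eq[OF that] Q.r_inv[of "f y"] by metis
    moreover have "x \<otimes> inv y \<in> H"
      using that(1,2) subgroup.m_closed[OF H] subgroup.m_inv_closed[OF H] by simp
    ultimately show ?thesis unfolding N_def by simp
  qed
  have sN: "subgroup N G"
  proof (rule subgroupI)
    show "N \<subseteq> carrier G" using HC unfolding N_def by auto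
    have one_H: "\<one> \<in> H" using subgroup.one_closed[OF H] .
    have one_N: "\<one> \<in> N" unfolding N_def using hom1 one_H by simp
    then show "N \<noteq> {}" by blast
    have N_D: "a \<in> H" "a \<in> carrier G" "\<And>f. f \<in> hom ?H ?Q \<Longrightarrow> f a = f \<one>" if "a \<in> N" for a
      using that hom1 HC unfolding N_def by auto
    fix a assume a: "a \<in> N"
    have inv_N: "inv b \<in> N" if "b \<in> N" for b
      using div_N[OF one_H N_D(1)[OF that] N_D(3)[OF that, symmetric]] N_D(2)[OF that] by simp
    show "inv a \<in> N" by (rule inv_N[OF a])
    fix b assume b: "b \<in> N"
    have "a \<otimes> inv (inv b) \<in> N"
      by (rule div_N[OF N_D(1)[OF a] N_D(1)[OF inv_N[OF b]]])
        (simp only: N_D(3)[OF a] N_D(3)[OF inv_N[OF b]])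
    then show "a \<otimes> b \<in> N" using N_D(2)[OF b] by simp
  qed
  have NM: "N \<subseteq> M"
  proof
    fix x assume x: "x \<in> N"
    then have "C #>\<^bsub>?H\<^esub> x = C" "x \<in> H"
      using C.r_coset_hom_Mod unfolding N_def by (auto simp: FactGroup_def)
    then have "x \<in> C" using H.rcos_self[of x C] C.subgroup_axioms by auto
    then show "x \<in> M" using C(2) by blast
  qed
  have fiN: "finite_index G N H"
  proof -
    define E where "E = (\<lambda>f. restrict f X) ` hom ?H ?Q"
    have "E \<subseteq> (\<Pi>\<^sub>E x\<in>X. carrier ?Q)"
      unfolding E_def hom_def using X(2) by (auto simp: PiE_def Pi_def subset_iff)
    then have finE: "finite E" using X(1) finQ by (meson finite_PiE finite_subset)
    define F where "F e = (SOME f. f \<in> hom ?H ?Q \<and> restrict f X = e)" for e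
    have F: "F (restrict f X) \<in> hom ?H ?Q" "restrict (F (restrict f X)) X = restrict f X"
      if "f \<in> hom ?H ?Q" for f
      using someI[of "\<lambda>g. g \<in> hom ?H ?Q \<and> restrict g X = restrict f X" f] that
      unfolding F_def by auto
    have F_eq: "F (restrict f X) y = f y" if f: "f \<in> hom ?H ?Q" and y: "y \<in> H" for f y
    proof (rule hom_eq_on_generate[OF Q F(1)[OF f] f H X(2)])
      fix x assume "x \<in> X"
      then show "F (restrict f X) x = f x" using fun_cong[OF F(2)[OF f], of x] by simp
    next
      show "y \<in> generate G X" using y X(3) by simp
    qed
    show ?thesis
    proof (rule finite_indexI_map[of "\<lambda>x. restrict (\<lambda>e. F e x) E"])
      have "(\<lambda>x. restrict (\<lambda>e. F e x) E) ` H \<subseteq> (\<Pi>\<^sub>E e\<in>E. carrier ?Q)"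
        using F(1) unfolding E_def by (auto simp: hom_def Pi_def)
      then show "finite ((\<lambda>x. restrict (\<lambda>e. F e x) E) ` H)"
        using finE finQ by (meson finite_PiE finite_subset)
      fix x y assume xy: "x \<in> H" "y \<in> H" "restrict (\<lambda>e. F e x) E = restrict (\<lambda>e. F e y) E"
      show "x \<otimes> inv y \<in> N"
      proof (rule div_N[OF xy(1,2)])
        fix f assume f: "f \<in> hom ?H ?Q"
        then have "restrict f X \<in> E" unfolding E_def by blast
        then have "F (restrict f X) x = F (restrict f X) y" using fun_cong[OF xy(3), of "restrict f X"] by simp
        then show "f x = f y" using F_eq[OF f] xy by simp
      qed
    qed
  qed
  have "\<psi> ` N \<subseteq> N" if "\<psi> \<in> hom ?H ?H" for \<psi>
  proof
    fix y assume "y \<in> \<psi> ` N"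
    then obtain x where x: "x \<in> N" "y = \<psi> x" by blast
    have "y \<in> H" using that x unfolding N_def hom_def by auto
    moreover have "f y = \<one>\<^bsub>?Q\<^esub>" if f: "f \<in> hom ?H ?Q" for f
    proof -
      have "f \<circ> \<psi> \<in> hom ?H ?Q" using Group.hom_compose[OF \<open>\<psi> \<in> hom ?H ?H\<close> f] .
      then show ?thesis using x unfolding N_def by auto
    qed
    ultimately show "y \<in> N" unfolding N_def by blast
  qed
  then show thesis using that[OF sN NM fiN] by blast
qed

end

section \<open>Polycyclic groups\<close>

text \<open>One step of a polycyclic series: \<open>P\<close> is normal in \<open>H\<close> and \<open>H/P\<close> is generated by the coset of \<open>t\<close>.
In the locale, \<open>level x i\<close> says that \<open>x\<close> lies in the coset \<open>P t\<^sup>i\<close>; when \<open>H/P\<close> is finite, an element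
has infinitely many levels.\<close>

locale cyclic_extension = group G for G (structure) +
  fixes P H :: "'a set" and t :: 'a
  assumes P: "subgroup P G" and H: "subgroup H G" and P_H: "P \<subseteq> H"
    and normalised: "\<lbrakk>h \<in> H; p \<in> P\<rbrakk> \<Longrightarrow> h \<otimes> p \<otimes> inv h \<in> P"
    and t: "t \<in> H"
    and covered: "h \<in> H \<Longrightarrow> \<exists>i::int. h \<otimes> t [^] (- i) \<in> P"
begin

definition level :: "'a \<Rightarrow> int \<Rightarrow> bool"
  where "level x i \<longleftrightarrow> x \<otimes> t [^] (- i) \<in> P"

lemma H_carrier: "x \<in> H \<Longrightarrow> x \<in> carrier G"
  using subgroup.subset[OF H] by blast

lemma t_carrier [simp]: "t \<in> carrier G"
  using t H_carrier by blast

lemma t_pow_H [simp]: "t [^] (i::int) \<in> H"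
  using subgroup_int_pow_closed[OF H t] .

lemma level_exists: "h \<in> H \<Longrightarrow> \<exists>i. level h i"
  unfolding level_def by (rule covered)

lemma level_0: "x \<in> H \<Longrightarrow> level x 0 \<longleftrightarrow> x \<in> P"
  unfolding level_def using H_carrier by simp

lemma level_mult:
  assumes "x \<in> H" "y \<in> H" "level x i" "level y j"
  shows "level (x \<otimes> y) (i + j)"
proof -
  have c: "x \<in> carrier G" "y \<in> carrier G" using assms H_carrier by blast+
  have "(x \<otimes> t [^] (-i)) \<otimes> (t [^] i \<otimes> (y \<otimes> t [^] (-j)) \<otimes> inv (t [^] i)) \<in> P"
    by (rule subgroup.m_closed[OF P]) (use assms(3,4) normalised[OF t_pow_H] level_def in auto)
  also have "(x \<otimes> t [^] (-i)) \<otimes> (t [^] i \<otimes> (y \<otimes> t [^] (-j)) \<otimes> inv (t [^] i))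
      = x \<otimes> y \<otimes> (t [^] (-j) \<otimes> t [^] (-i))"
    using c by (simp add: m_assoc int_pow_neg)
  also have "t [^] (-j) \<otimes> t [^] (-i) = t [^] (- (i + j))"
    by (simp add: int_pow_mult[symmetric] add.commute)
  finally show ?thesis unfolding level_def .
qed

lemma level_inv:
  assumes "x \<in> H" "level x i"
  shows "level (inv x) (- i)"
proof -
  have c: "x \<in> carrier G" using assms H_carrier by blast
  have "inv (t [^] i) \<otimes> inv (x \<otimes> t [^] (-i)) \<otimes> inv (inv (t [^] i)) \<in> P"
    using assms(2) unfolding level_def
    by (intro normalised subgroup.m_inv_closed[OF P] subgroup.m_inv_closed[OF H]) auto
  also have "inv (t [^] i) \<otimes> inv (x \<otimes> t [^] (-i)) \<otimes> inv (inv (t [^] i)) = inv x \<otimes> t [^] i"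
    using c by (simp add: m_assoc int_pow_neg inv_mult_group)
  finally show ?thesis unfolding level_def by simp
qed

lemma level_pow:
  assumes "x \<in> H" "level x i"
  shows "level (x [^] (q::int)) (q * i)"
proof -
  have nat: "level (x [^] (n::nat)) (int n * i)" for n
  proof (induction n)
    case 0
    then show ?case using level_0[of \<one>] subgroup.one_closed[OF H] subgroup.one_closed[OF P] by simp
  next
    case (Suc n)
    have "x [^] n \<in> H" using subgroup_int_pow_closed[OF H assms(1), of "int n"] by (simp add: int_pow_int)
    then have "level (x [^] n \<otimes> x) (int n * i + i)" using Suc assms by (intro level_mult)
    then show ?case by (simp add: algebra_simps)
  qed
  show ?thesis
  proof (cases "q \<ge> 0")
    case True
    then show ?thesis using nat[of "nat q"] by (simp add: int_pow_int[symmetric])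
  next
    case False
    have "x [^] (nat (-q)) \<in> H"
      using subgroup_int_pow_closed[OF H assms(1), of "int (nat (-q))"] unfolding int_pow_int .
    then have "level (inv (x [^] nat (-q))) (- (int (nat (-q)) * i))" using nat by (intro level_inv)
    moreover have "x [^] q = inv (x [^] nat (-q))"
      using int_pow_neg_int[OF H_carrier[OF assms(1)], of "nat (-q)"] False by simp
    ultimately show ?thesis using False by simp
  qed
qed

text \<open>The image of \<open>U\<close> in the cyclic group \<open>H/P\<close> is cyclic, generated by an element of least positive
level.\<close>

lemma subgroup_cyclic_mod:
  assumes U: "subgroup U G" "U \<subseteq> H"
  obtains u where "u \<in> U" "\<And>x. x \<in> U \<Longrightarrow> \<exists>q::int. x \<otimes> u [^] q \<in> P"
proof (cases "\<exists>n::nat. n > 0 \<and> (\<exists>x \<in> U. level x (int n))")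
  case True
  define d where "d = (LEAST n::nat. n > 0 \<and> (\<exists>x \<in> U. level x (int n)))"
  have "d > 0 \<and> (\<exists>x \<in> U. level x (int d))" unfolding d_def using True by (rule LeastI_ex)
  then obtain u where d: "d > 0" and u: "u \<in> U" "level u (int d)" by blast
  show thesis
  proof (rule that[OF u(1)])
    fix x assume x: "x \<in> U"
    obtain i where i: "level x i" using level_exists x U(2) by blast
    let ?q = "- (i div int d)"
    have uq: "u [^] ?q \<in> U" using subgroup_int_pow_closed[OF U(1) u(1)] .
    have "level (x \<otimes> u [^] ?q) (i + ?q * int d)"
      using x u uq U(2) i by (intro level_mult level_pow) auto
    then have lev: "level (x \<otimes> u [^] ?q) (i mod int d)"
      by (simp add: minus_div_mult_eq_mod)
    have mem: "x \<otimes> u [^] ?q \<in> U" using x uq by (rule subgroup.m_closed[OF U(1)])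
    have "i mod int d = 0"
    proof (rule ccontr)
      assume nz: "i mod int d \<noteq> 0"
      let ?r = "nat (i mod int d)"
      have r: "int ?r = i mod int d" using d by simp
      have "?r > 0 \<and> (\<exists>x \<in> U. level x (int ?r))"
        using nz d lev mem r by (metis nat_eq_iff2 neq0_conv of_nat_0)
      then have "d \<le> ?r" unfolding d_def by (rule Least_le)
      moreover have "?r < d" using d r pos_mod_bound[of "int d" i] by linarith
      ultimately show False by simp
    qed
    then show "\<exists>q::int. x \<otimes> u [^] q \<in> P" using lev level_0 mem U(2) by auto
  qed
next
  case False
  show thesis
  proof (rule that[OF subgroup.one_closed[OF U(1)]])
    fix x assume x: "x \<in> U"
    obtain i where i: "level x i" using level_exists x U(2) by blast
    then have "level (inv x) (-i)" using x U(2) by (intro level_inv) auto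
    moreover have "inv x \<in> U" using x by (rule subgroup.m_inv_closed[OF U(1)])
    ultimately have "i = 0" using False i x
      by (metis (no_types, opaque_lifting) neg_0_less_iff_less not_less_iff_gr_or_eq of_nat_0_less_iff zero_less_imp_eq_int)
    then show "\<exists>q::int. x \<otimes> \<one> [^] q \<in> P"
      using i x U(2) level_0[of x] H_carrier by (intro exI[of _ 0]) auto
  qed
qed

end

context group
begin

lemma conj_hom:
  assumes "subgroup P G" "h \<in> carrier G" "\<And>p. p \<in> P \<Longrightarrow> h \<otimes> p \<otimes> inv h \<in> P"
  shows "(\<lambda>x. h \<otimes> x \<otimes> inv h) \<in> hom (G\<lparr>carrier := P\<rparr>) (G\<lparr>carrier := P\<rparr>)"
  using assms subgroup.mem_carrier[OF assms(1)] by (auto simp: hom_def m_assoc)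

lemma polycyclic_seq_subgroup: "polycyclic_seq G H \<Longrightarrow> subgroup H G"
  by (induction rule: polycyclic_seq.induct) (auto simp: triv_subgroup)

lemma polycyclic_seq_cyclic_extension:
  assumes "polycyclic_seq G P" "P \<lhd> (G\<lparr>carrier := H\<rparr>)" "subgroup H G"
    "cyclic_group ((G\<lparr>carrier := H\<rparr>) Mod P)"
  obtains t where "cyclic_extension G P H t"
proof -
  let ?H = "G\<lparr>carrier := H\<rparr>"
  interpret H: group ?H using assms(3) by (rule subgroup_imp_group)
  interpret P: normal P ?H by fact
  interpret Q: group "?H Mod P" by (rule P.factorgroup_is_group)
  obtain T where T: "T \<in> carrier (?H Mod P)" "carrier (?H Mod P) = range (\<lambda>n::int. T [^]\<^bsub>?H Mod P\<^esub> n)"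
    using assms(4) Q.cyclic_group by blast
  from T(1) obtain t where t: "t \<in> H" "T = P #>\<^bsub>?H\<^esub> t"
    unfolding carrier_FactGroup by auto
  have PH: "P \<subseteq> H" using P.subset by simp
  have sP: "subgroup P G" using polycyclic_seq_subgroup[OF assms(1)] .
  have norm: "h \<otimes> p \<otimes> inv h \<in> P" if "h \<in> H" "p \<in> P" for h p
    using P.inv_op_closed2[of h p] that m_inv_consistent[OF assms(3) that(1)] by simp
  have cov: "\<exists>i::int. h \<otimes> t [^] (- i) \<in> P" if h: "h \<in> H" for h
  proof -
    have "P #>\<^bsub>?H\<^esub> h \<in> carrier (?H Mod P)" using h by (auto simp: carrier_FactGroup)
    then obtain i :: int where i: "P #>\<^bsub>?H\<^esub> h = T [^]\<^bsub>?H Mod P\<^esub> i" using T(2) by blast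
    have "T [^]\<^bsub>?H Mod P\<^esub> i = P #>\<^bsub>?H\<^esub> (t [^]\<^bsub>?H\<^esub> i)"
      unfolding t(2) using t(1) by (intro P.FactGroup_int_pow) auto
    then have eq: "P #> h = P #> (t [^] i)" using i int_pow_consistent[OF assms(3) t(1)] by simp
    have ti: "t [^] i \<in> carrier G"
      using subgroup_int_pow_closed[OF assms(3) t(1)] subgroup.mem_carrier[OF assms(3)] by blast
    have "h \<in> P #> (t [^] i)"
      using rcos_self[of h P] eq sP subgroup.mem_carrier[OF assms(3) h] by auto
    then have "h \<otimes> inv (t [^] i) \<in> P"
      using subgroup.rcos_module_imp[OF sP is_group ti] by blast
    then show ?thesis
      using int_pow_neg[of t i] subgroup.mem_carrier[OF assms(3) t(1)] by (intro exI[of _ i]) simp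
  qed
  have "cyclic_extension G P H t"
    by (intro cyclic_extension.intro cyclic_extension_axioms.intro is_group sP assms(3) PH norm t(1) cov)
  then show thesis by (rule that)
qed

text \<open>The induction used below: it exposes a generator of each cyclic factor in place of the abstract
condition on the quotient.\<close>

lemma polycyclic_induct [consumes 1, case_names trivial extension]:
  assumes "polycyclic_seq G H" "Q {\<one>}"
    and "\<And>P H t. polycyclic_seq G P \<Longrightarrow> cyclic_extension G P H t \<Longrightarrow> Q P \<Longrightarrow> Q H"
  shows "Q H"
  using assms(1)
proof (induction rule: polycyclic_seq.induct)
  case unity
  show ?case by fact
next
  case (extension K H)
  obtain t where "cyclic_extension G K H t"
    by (rule polycyclic_seq_cyclic_extension[OF extension.hyps(1-4)])
  then show ?case by (rule assms(3)[OF extension.hyps(1) _ extension.IH])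
qed

text \<open>\<open>U\<close> is generated by generators of \<open>U \<inter> P\<close> and one element that generates the image of \<open>U\<close> in the
cyclic group \<open>H/P\<close>. Equivalently, polycyclic groups satisfy the ascending chain condition on
subgroups.\<close>

lemma polycyclic_subgroup_finitely_generated:
  assumes "polycyclic_seq G H" "subgroup U G" "U \<subseteq> H"
  shows "\<exists>X. finite X \<and> X \<subseteq> U \<and> U = generate G X"
  using assms
proof (induction arbitrary: U rule: polycyclic_induct)
  case trivial
  have "\<one> \<in> U" using trivial(1) by (rule subgroup.one_closed)
  then have "U = generate G {}" using trivial(2) generate_empty by auto
  then show ?case by blast
next
  case (extension P H t)
  interpret E: cyclic_extension G P H t by fact
  have sI: "subgroup (U \<inter> P) G" using extension.prems(1) E.P by (rule subgroups_Inter_pair)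
  then obtain X where X: "finite X" "X \<subseteq> U \<inter> P" "U \<inter> P = generate G X"
    using extension.IH[OF sI] by blast
  obtain u where u: "u \<in> U" "\<And>x. x \<in> U \<Longrightarrow> \<exists>q::int. x \<otimes> u [^] q \<in> P"
    using E.subgroup_cyclic_mod[OF extension.prems] by blast
  have UC: "U \<subseteq> carrier G" using extension.prems(1) by (rule subgroup.subset)
  have sub: "insert u X \<subseteq> U" using X u by blast
  have gS: "subgroup (generate G (insert u X)) G"
    using sub UC by (intro generate_is_subgroup) auto
  have "U \<subseteq> generate G (insert u X)"
  proof
    fix x assume x: "x \<in> U"
    obtain q :: int where q: "x \<otimes> u [^] q \<in> P" using u(2)[OF x] by blast
    have uq: "u [^] q \<in> U" using subgroup_int_pow_closed[OF extension.prems(1) u(1)] .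
    have "x \<otimes> u [^] q \<in> U \<inter> P" using q subgroup.m_closed[OF extension.prems(1) x uq] by simp
    then have 1: "x \<otimes> u [^] q \<in> generate G (insert u X)"
      using X(3) mono_generate[of X "insert u X"] by blast
    have 2: "inv (u [^] q) \<in> generate G (insert u X)"
      by (intro subgroup.m_inv_closed[OF gS] subgroup_int_pow_closed[OF gS] generate.incl) simp
    have "(x \<otimes> u [^] q) \<otimes> inv (u [^] q) = x"
      using x uq UC by (auto simp: m_assoc subset_iff)
    then show "x \<in> generate G (insert u X)" using subgroup.m_closed[OF gS 1 2] by simp
  qed
  then have "U = generate G (insert u X)" using generate_subgroup_incl[OF sub extension.prems(1)] by blast
  then show ?case using X(1) sub by blast
qed

lemma polycyclic_derived_trivial:
  assumes "polycyclic_seq G H"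
  shows "\<exists>n. (derived G ^^ n) H = {\<one>}"
  using assms
proof (induction rule: polycyclic_seq.induct)
  case unity
  have "(derived G ^^ 0) {\<one>} = {\<one>}" by simp
  then show ?case by blast
next
  case (extension K H)
  interpret H: group "G\<lparr>carrier := H\<rparr>" using extension.hyps(3) by (rule subgroup_imp_group)
  interpret Q: group "(G\<lparr>carrier := H\<rparr>) Mod K"
    using extension.hyps(2) by (rule normal.factorgroup_is_group)
  have "comm_group ((G\<lparr>carrier := H\<rparr>) Mod K)"
    using extension.hyps(4) by (rule Q.cyclic_imp_abelian_group)
  then have "derived G H \<subseteq> K" using extension.hyps by (intro derived_of_subgroup_minimal)
  moreover obtain n where n: "(derived G ^^ n) K = {\<one>}" using extension.IH by blast
  ultimately have "(derived G ^^ n) (derived G H) \<subseteq> {\<one>}"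
    using mono_exp_of_derived[of "derived G H" K n] by simp
  then have "(derived G ^^ Suc n) H \<subseteq> {\<one>}" by (simp add: funpow_swap1)
  then have "(derived G ^^ Suc n) H = {\<one>}"
    using subgroup.one_closed[OF exp_of_derived_is_subgroup[OF extension.hyps(3), of "Suc n"]] by blast
  then show ?case by blast
qed

lemma adjoin_subgroup:
  assumes M: "subgroup M G" and l: "l \<in> carrier G"
    and norm: "\<And>(i::int) m. m \<in> M \<Longrightarrow> l [^] i \<otimes> m \<otimes> inv (l [^] i) \<in> M"
  shows "subgroup {m \<otimes> l [^] (i::int) | m i. m \<in> M} G"
proof (rule subgroupI)
  have [simp]: "\<And>m. m \<in> M \<Longrightarrow> m \<in> carrier G" using subgroup.mem_carrier[OF M] .
  show "{m \<otimes> l [^] (i::int) | m i. m \<in> M} \<subseteq> carrier G" using l by auto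
  show "{m \<otimes> l [^] (i::int) | m i. m \<in> M} \<noteq> {}" using subgroup.one_closed[OF M] by blast
next
  note Mc [simp] = subgroup.mem_carrier[OF M]
  fix a assume "a \<in> {m \<otimes> l [^] (i::int) | m i. m \<in> M}"
  then obtain m and i :: int where a: "a = m \<otimes> l [^] i" "m \<in> M" by blast
  have "inv a = (l [^] (-i) \<otimes> inv m \<otimes> inv (l [^] (-i))) \<otimes> l [^] (-i)"
    unfolding a using a(2) l by (simp add: m_assoc inv_mult_group int_pow_neg)
  then show "inv a \<in> {m \<otimes> l [^] (i::int) | m i. m \<in> M}"
    using norm[OF subgroup.m_inv_closed[OF M a(2)], of "-i"] by blast
next
  note Mc [simp] = subgroup.mem_carrier[OF M]
  fix a b assume "a \<in> {m \<otimes> l [^] (i::int) | m i. m \<in> M}" "b \<in> {m \<otimes> l [^] (i::int) | m i. m \<in> M}"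
  then obtain m n and i j :: int where a: "a = m \<otimes> l [^] i" "m \<in> M" and b: "b = n \<otimes> l [^] j" "n \<in> M"
    by blast
  have "a \<otimes> b = (m \<otimes> (l [^] i \<otimes> n \<otimes> inv (l [^] i))) \<otimes> (l [^] i \<otimes> l [^] j)"
    unfolding a b using a(2) b(2) l by (simp add: m_assoc)
  also have "l [^] i \<otimes> l [^] j = l [^] (i + j)" using l by (simp add: int_pow_mult)
  finally show "a \<otimes> b \<in> {m \<otimes> l [^] (i::int) | m i. m \<in> M}"
    using subgroup.m_closed[OF M a(2) norm[OF b(2), of i]] by blast
qed

lemma polycyclic_fully_invariant_core:
  assumes "polycyclic_seq G P" "subgroup H G" "H \<subseteq> P"
    and "subgroup M G" "M \<subseteq> H" "finite_index G M H"
  obtains N where "subgroup N G" "N \<subseteq> M" "finite_index G N H"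
    "\<And>\<psi>. \<psi> \<in> hom (G\<lparr>carrier := H\<rparr>) (G\<lparr>carrier := H\<rparr>) \<Longrightarrow> \<psi> ` N \<subseteq> N"
proof -
  obtain X where "finite X" "X \<subseteq> H" "H = generate G X"
    using polycyclic_subgroup_finitely_generated[OF assms(1-3)] by blast
  then show thesis using fully_invariant_core[OF assms(2) _ _ _ assms(4-6)] that by metis
qed

text \<open>The profinite topology of a polycyclic group induces the full profinite topology on every
subgroup \<open>A\<close>. In the step, induction gives a subgroup \<open>N\<close> of finite index in \<open>P\<close>, normal in \<open>H\<close>, with
\<open>N \<inter> A \<subseteq> L\<close>. It is enlarged to finite index in \<open>H\<close> by adjoining a single element \<open>l\<close> whose image in
\<open>H/P\<close> generates a subgroup of finite index.\<close>

lemma polycyclic_separates_subgroup: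
  assumes "polycyclic_seq G H" "subgroup A G" "A \<subseteq> H" "subgroup L G" "L \<subseteq> A" "finite_index G L A"
  shows "\<exists>M. subgroup M G \<and> M \<subseteq> H \<and> finite_index G M H \<and> M \<inter> A \<subseteq> L"
  using assms
proof (induction arbitrary: A L rule: polycyclic_induct)
  case trivial
  then have "A \<inter> {\<one>} \<subseteq> L" using subgroup.one_closed[of L G] by auto
  then show ?case
    using triv_subgroup finite_index_self[OF triv_subgroup] by (intro exI[of _ "{\<one>}"]) blast
next
  case (extension P H t)
  note A = extension.prems(1,2) and L = extension.prems(3,4) and fiL = extension.prems(5)
  interpret E: cyclic_extension G P H t by fact
  have AC: "A \<subseteq> carrier G" using A(1) by (rule subgroup.subset)
  have sAP: "subgroup (A \<inter> P) G" using A(1) E.P by (rule subgroups_Inter_pair)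
  have sLP: "subgroup (L \<inter> (A \<inter> P)) G" using L(1) sAP by (rule subgroups_Inter_pair)
  have fi_P: "finite_index G (L \<inter> (A \<inter> P)) (A \<inter> P)"
    using finite_index_Int_subgroup[OF fiL L(1) sAP _ AC] by simp
  obtain M0 where M0: "subgroup M0 G" "M0 \<subseteq> P" "finite_index G M0 P" "M0 \<inter> (A \<inter> P) \<subseteq> L \<inter> (A \<inter> P)"
    using extension.IH[OF sAP Int_lower2 sLP Int_lower2 fi_P] by blast
  obtain N where N: "subgroup N G" "N \<subseteq> M0" "finite_index G N P"
    and N_inv: "\<And>\<psi>. \<psi> \<in> hom (G\<lparr>carrier := P\<rparr>) (G\<lparr>carrier := P\<rparr>) \<Longrightarrow> \<psi> ` N \<subseteq> N"
    using polycyclic_fully_invariant_core[OF extension.hyps(1) E.P subset_refl M0(1-3)] by metis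
  have NP: "N \<subseteq> P" using N M0 by blast
  have NA: "x \<in> L" if "x \<in> N" "x \<in> A" for x using that N M0 by blast
  have N_norm: "h \<otimes> n \<otimes> inv h \<in> N" if "h \<in> H" "n \<in> N" for h n
    using N_inv[OF conj_hom[OF E.P E.H_carrier[OF that(1)] E.normalised[OF that(1)]]] that(2) by auto
  let ?S = "\<lambda>l. {n \<otimes> l [^] (i::int) | n i. n \<in> N}"
  have "\<exists>l m. l \<in> H \<and> m > 0 \<and> E.level l m \<and> ?S l \<inter> A \<subseteq> L"
  \<comment> \<open>If \<open>L\<close> has an element of positive level, adjoin it: powers of \<open>l\<close> lie in \<open>L\<close>, so they do no harm.
Otherwise \<open>H/P\<close> is infinite and \<open>A \<subseteq> P\<close>, and adjoining \<open>t\<close> adds nothing to the intersection with \<open>P\<close>.\<close>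
  proof (cases "\<exists>l \<in> L. \<exists>m > 0. E.level l m")
    case True
    then obtain l m where l: "l \<in> L" "m > 0" "E.level l m" by blast
    have "?S l \<inter> A \<subseteq> L"
    proof clarify
      fix n and i :: int assume n: "n \<in> N" "n \<otimes> l [^] i \<in> A"
      have li: "l [^] i \<in> L" using subgroup_int_pow_closed[OF L(1) l(1)] .
      have nC: "n \<in> carrier G" "l [^] i \<in> carrier G" using subgroup.mem_carrier[OF N(1) n(1)] subgroup.mem_carrier[OF L(1) li] by simp_all
      have "n \<otimes> l [^] i \<otimes> inv (l [^] i) \<in> A"
        by (rule subgroup.m_closed[OF A(1) n(2) subgroup.m_inv_closed[OF A(1)]]) (use li L(2) in blast)
      then have "n \<in> A" using nC by (simp add: m_assoc)
      then show "n \<otimes> l [^] i \<in> L" using NA[OF n(1)] li by (intro subgroup.m_closed[OF L(1)])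
    qed
    then show ?thesis using l L(2) A(2) by blast
  next
    case False
    have lev0: "i = 0" if "x \<in> L" "E.level x i" for x i
    proof (rule ccontr)
      assume "i \<noteq> 0"
      moreover have "E.level (inv x) (- i)" "inv x \<in> L"
        using that L A(2) by (auto intro!: E.level_inv subgroup.m_inv_closed[OF L(1)])
      ultimately show False using False that by (metis neg_0_less_iff_less linorder_neqE_linordered_idom)
    qed
    have AP: "A \<subseteq> P"
    proof
      fix a assume a: "a \<in> A"
      then have aH: "a \<in> H" using A(2) by blast
      obtain i where i: "E.level a i" using E.level_exists[OF aH] by blast
      obtain f :: "'a \<Rightarrow> 'a" where f: "finite (f ` A)"
        "\<And>x y. x \<in> A \<Longrightarrow> y \<in> A \<Longrightarrow> f x = f y \<Longrightarrow> x \<otimes> inv y \<in> L"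
        using finite_index_mapE[OF fiL L(1) AC] by metis
      have powA: "a [^] (int k) \<in> A" for k using subgroup_int_pow_closed[OF A(1) a] .
      have "finite (range (\<lambda>k::nat. f (a [^] (int k))))"
        by (rule finite_subset[OF _ f(1)]) (use powA in blast)
      then have "\<not> inj (\<lambda>k::nat. f (a [^] (int k)))" using finite_imageD infinite_UNIV_nat by blast
      then obtain k k' where k: "k \<noteq> k'" "f (a [^] (int k)) = f (a [^] (int k'))" unfolding inj_def by blast
      have "a [^] (int k) \<otimes> inv (a [^] (int k')) \<in> L" using f(2)[OF powA powA k(2)] .
      moreover have "E.level (a [^] (int k) \<otimes> inv (a [^] (int k'))) (int k * i + - (int k' * i))"
        using powA A(2) i aH by (intro E.level_mult E.level_inv E.level_pow subgroup.m_inv_closed[OF E.H]) auto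
      ultimately have "int k * i + - (int k' * i) = 0" by (rule lev0)
      then have "i = 0" using k(1) by simp
      then show "a \<in> P" using i E.level_0[OF aH] by simp
    qed
    have "?S t \<inter> A \<subseteq> L"
    proof clarify
      fix n and i :: int assume n: "n \<in> N" "n \<otimes> t [^] i \<in> A"
      have nP: "n \<in> P" "n \<otimes> t [^] i \<in> P" using n NP AP by blast+
      have nC: "n \<in> carrier G" using subgroup.mem_carrier[OF E.P nP(1)] .
      have "inv n \<otimes> (n \<otimes> t [^] i) \<in> P"
        by (rule subgroup.m_closed[OF E.P subgroup.m_inv_closed[OF E.P nP(1)] nP(2)])
      then have "t [^] i \<in> P" using nC by simp
      then have "E.level \<one> (- i)" unfolding E.level_def by simp
      then have "i = 0" using lev0 subgroup.one_closed[OF L(1)] by fastforce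
      then show "n \<otimes> t [^] i \<in> L" using n NA nC by simp
    qed
    moreover have "E.level t 1"
      unfolding E.level_def using int_pow_neg[of t 1] subgroup.one_closed[OF E.P] by simp
    ultimately show ?thesis using E.t by (intro exI[of _ t] exI[of _ 1]) simp
  qed
  then obtain l m where l: "l \<in> H" "m > 0" "E.level l m" "?S l \<inter> A \<subseteq> L" by blast
  have lC: "l \<in> carrier G" using E.H_carrier[OF l(1)] .
  have lpow: "l [^] (i::int) \<in> H" for i using subgroup_int_pow_closed[OF E.H l(1)] .
  have sS: "subgroup (?S l) G"
    using adjoin_subgroup[OF N(1) lC N_norm[OF lpow]] .
  have SH: "?S l \<subseteq> H"
    using lpow NP E.P_H by (auto intro!: subgroup.m_closed[OF E.H])
  obtain T where T: "finite T" "T \<subseteq> P" "\<forall>h \<in> P. \<exists>s \<in> T. h \<otimes> inv s \<in> N"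
    using N(3) unfolding finite_index_def by blast
  have "finite_index G (?S l) H"
    unfolding finite_index_def
  proof (intro exI[of _ "(\<lambda>(s,r). s \<otimes> t [^] r) ` (T \<times> {0..<m})"] conjI ballI)
    show "finite ((\<lambda>(s,r). s \<otimes> t [^] r) ` (T \<times> {0..<m}))" using T(1) by simp
    \<comment> \<open>Representatives: \<open>t\<^sup>r\<close> for the cosets of \<open>P \<langle>l\<rangle>\<close> in \<open>H\<close>, and \<open>T\<close> for the cosets of \<open>N\<close> in \<open>P\<close>.\<close>
    show "(\<lambda>(s,r). s \<otimes> t [^] r) ` (T \<times> {0..<m}) \<subseteq> H"
      using T(2) E.P_H by (auto intro!: subgroup.m_closed[OF E.H])
    fix h assume h: "h \<in> H"
    obtain i where i: "E.level h i" using E.level_exists[OF h] by blast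
    let ?q = "i div m" and ?r = "i mod m"
    have hC: "h \<in> carrier G" using E.H_carrier[OF h] .
    have x: "inv (l [^] ?q) \<otimes> h \<in> H"
      using h lpow by (intro subgroup.m_closed[OF E.H] subgroup.m_inv_closed[OF E.H])
    have "E.level (inv (l [^] ?q) \<otimes> h) (- (?q * m) + i)"
      using l h lpow i by (intro E.level_mult E.level_inv E.level_pow subgroup.m_inv_closed[OF E.H])
    then have "E.level (inv (l [^] ?q) \<otimes> h) ?r" by (simp add: minus_div_mult_eq_mod[symmetric])
    then have p: "inv (l [^] ?q) \<otimes> h \<otimes> inv (t [^] ?r) \<in> P"
      unfolding E.level_def by (simp add: int_pow_neg)
    obtain s where s: "s \<in> T" "inv (l [^] ?q) \<otimes> h \<otimes> inv (t [^] ?r) \<otimes> inv s \<in> N" using T(3) p by blast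
    have sC: "s \<in> carrier G" using s(1) T(2) subgroup.mem_carrier[OF E.P] by blast
    let ?n = "inv (l [^] ?q) \<otimes> h \<otimes> inv (t [^] ?r) \<otimes> inv s"
    have "h \<otimes> inv (s \<otimes> t [^] ?r) = (l [^] ?q \<otimes> ?n \<otimes> inv (l [^] ?q)) \<otimes> l [^] ?q"
      using sC hC lC by (simp add: m_assoc inv_mult_group)
    then have "h \<otimes> inv (s \<otimes> t [^] ?r) \<in> ?S l" using N_norm[OF lpow s(2), of ?q] by blast
    moreover have "?r \<in> {0..<m}" using l(2) by simp
    ultimately show "\<exists>w \<in> (\<lambda>(s,r). s \<otimes> t [^] r) ` (T \<times> {0..<m}). h \<otimes> inv w \<in> ?S l"
      using s(1) by (intro bexI[of _ "s \<otimes> t [^] ?r"]) force+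
  qed
  then show ?case using sS SH l(4) by blast
qed

end

section \<open>The twisted orbit of the identity in a polycyclic group\<close>

text \<open>\<open>\<psi>\<close> has finitely many Reidemeister classes on \<open>H\<close>, where only elements of \<open>H\<close> are used for twisted
conjugation.\<close>

definition twisted_finite :: "('a, 'b) monoid_scheme \<Rightarrow> ('a \<Rightarrow> 'a) \<Rightarrow> 'a set \<Rightarrow> bool"
  where "twisted_finite G \<psi> H \<longleftrightarrow>
    (\<exists>R. finite R \<and> R \<subseteq> H \<and> (\<forall>h \<in> H. \<exists>r \<in> R. \<exists>x \<in> H. h = x \<otimes>\<^bsub>G\<^esub> r \<otimes>\<^bsub>G\<^esub> inv\<^bsub>G\<^esub> (\<psi> x)))"

lemma (in comm_group) m_inv_lcancel:
  assumes "a \<in> carrier G" "b \<in> carrier G" "c \<in> carrier G"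
  shows "a \<otimes> (b \<otimes> (inv a \<otimes> c)) = b \<otimes> c"
  using assms m_lcomm[of a b] by simp

text \<open>A Fitting argument. All powers of \<open>d\<close> have finite cokernel, and once the kernels of the powers
are stationary from the \<open>n\<close>-th on, the kernel of \<open>d\<close> meets the image of \<open>d\<^sup>n\<close> trivially, so it embeds
into the cokernel of \<open>d\<^sup>n\<close>.\<close>

lemma (in comm_group) finite_kernel_if_finite_index_image:
  assumes d: "d \<in> hom G G" and coker: "finite_index G (d ` carrier G) (carrier G)"
    and stable: "\<And>a. a \<in> carrier G \<Longrightarrow> (d ^^ Suc n) a = \<one> \<Longrightarrow> (d ^^ n) a = \<one>"
  shows "finite {a \<in> carrier G. d a = \<one>}"
proof -
  interpret d: group_hom G G d using d by unfold_locales
  have dn_hom: "d ^^ k \<in> hom G G" for k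
  proof (induction k)
    case 0
    show ?case by (simp add: hom_def)
  next
    case (Suc k)
    show ?case using Group.hom_compose[OF Suc d] by (simp add: comp_def)
  qed
  have fi: "finite_index G ((d ^^ k) ` carrier G) (carrier G)" for k
  proof (induction k)
    case 0
    show ?case using finite_index_self[OF subgroup_self] by simp
  next
    case (Suc k)
    interpret dk: group_hom G G "d ^^ k" using dn_hom by unfold_locales
    obtain T where T: "finite T" "T \<subseteq> carrier G" "\<forall>h \<in> carrier G. \<exists>t \<in> T. h \<otimes> inv t \<in> d ` carrier G"
      using coker unfolding finite_index_def by blast
    have "finite_index G ((d ^^ Suc k) ` carrier G) ((d ^^ k) ` carrier G)"
      unfolding finite_index_def
    proof (intro exI[of _ "(d ^^ k) ` T"] conjI ballI)
      show "finite ((d ^^ k) ` T)" "(d ^^ k) ` T \<subseteq> (d ^^ k) ` carrier G" using T by blast+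
      fix h assume "h \<in> (d ^^ k) ` carrier G"
      then obtain a where a: "a \<in> carrier G" "h = (d ^^ k) a" by blast
      then obtain t b where t: "t \<in> T" "b \<in> carrier G" "a \<otimes> inv t = d b" using T(3) by blast
      have "h \<otimes> inv ((d ^^ k) t) = (d ^^ k) (a \<otimes> inv t)"
        using a t(1) T(2) dk.hom_mult dk.hom_inv by (simp add: subset_iff)
      also have "\<dots> = (d ^^ Suc k) b" unfolding t(3) by (simp add: funpow_swap1)
      finally show "\<exists>s \<in> (d ^^ k) ` T. h \<otimes> inv s \<in> (d ^^ Suc k) ` carrier G" using t by blast
    qed
    then show ?case
      by (rule finite_index_trans[OF _ Suc])
        (use dk.hom_closed in \<open>auto intro: subgroup_self\<close>)
  qed
  interpret dn: group_hom G G "d ^^ n" using dn_hom by unfold_locales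
  have sI: "subgroup ((d ^^ n) ` carrier G) G" by (rule dn.img_is_subgroup)
  obtain f :: "'a \<Rightarrow> 'a" where f: "finite (f ` carrier G)"
    "\<And>x y. x \<in> carrier G \<Longrightarrow> y \<in> carrier G \<Longrightarrow> f x = f y \<Longrightarrow> x \<otimes> inv y \<in> (d ^^ n) ` carrier G"
    using finite_index_mapE[OF fi sI subset_refl] by metis
  have "inj_on f {a \<in> carrier G. d a = \<one>}"
  proof (rule inj_onI)
    fix a b assume ab: "a \<in> {a \<in> carrier G. d a = \<one>}" "b \<in> {a \<in> carrier G. d a = \<one>}" "f a = f b"
    then obtain y where y: "y \<in> carrier G" "a \<otimes> inv b = (d ^^ n) y" using f(2)[of a b] by blast
    have "(d ^^ Suc n) y = d (a \<otimes> inv b)" using y(2) by simp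
    also have "\<dots> = \<one>" using ab d.hom_mult[of a "inv b"] by simp
    finally have "(d ^^ n) y = \<one>" by (rule stable[OF y(1)])
    then have "a \<otimes> inv b = \<one>" using y(2) by simp
    then show "a = b" using ab inv_equality[of a "inv b"] by simp
  qed
  then show ?thesis
    using inj_on_finite[OF _ _ f(1)] by blast
qed

lemma (in group) ascending_chain_stabilises:
  assumes fg: "\<And>U. subgroup U G \<Longrightarrow> U \<subseteq> H \<Longrightarrow> \<exists>X. finite X \<and> X \<subseteq> U \<and> U = generate G X"
    and V: "\<And>n::nat. subgroup (V n) G" "\<And>n. V n \<subseteq> H" "\<And>n. V n \<subseteq> V (Suc n)"
  shows "\<exists>n. V (Suc n) = V n"
proof -
  have mono: "V m \<subseteq> V n" if "m \<le> n" for m n using V(3) that by (rule lift_Suc_mono_le)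
  let ?U = "\<Union>n. V n"
  have "subgroup ?U G"
  proof (rule subgroupI)
    show "?U \<subseteq> carrier G" using subgroup.subset[OF V(1)] by blast
    show "?U \<noteq> {}" using subgroup.one_closed[OF V(1)] by blast
    show "inv a \<in> ?U" if "a \<in> ?U" for a using that subgroup.m_inv_closed[OF V(1)] by blast
    fix a b assume "a \<in> ?U" "b \<in> ?U"
    then obtain m n where "a \<in> V m" "b \<in> V n" by blast
    then have "a \<in> V (max m n)" "b \<in> V (max m n)" using mono[of m "max m n"] mono[of n "max m n"] by auto
    then have "a \<otimes> b \<in> V (max m n)" by (rule subgroup.m_closed[OF V(1)])
    then show "a \<otimes> b \<in> ?U" by blast
  qed
  then obtain X where X: "finite X" "X \<subseteq> ?U" "?U = generate G X" using fg[of ?U] V(2) by blast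
  have "\<exists>n. X \<subseteq> V n"
    using X(1,2)
  proof (induction X rule: finite_induct)
    case (insert x X)
    then obtain n m where "X \<subseteq> V n" "x \<in> V m" by blast
    then have "insert x X \<subseteq> V (max m n)" using mono[of m "max m n"] mono[of n "max m n"] by auto
    then show ?case by blast
  qed simp
  then obtain n where "X \<subseteq> V n" by blast
  then have "?U \<subseteq> V n" unfolding X(3) by (rule generate_subgroup_incl[OF _ V(1)])
  then have "V (Suc n) = V n" using V(3)[of n] by blast
  then show ?thesis by blast
qed

locale group_endomorphism = group G for G (structure) +
  fixes psi :: "'a \<Rightarrow> 'a"
  assumes psi: "psi \<in> hom G G"
begin

sublocale psi: group_hom G G psi
  using psi by unfold_locales

text \<open>A class of \<open>\<psi>\<close> on \<open>H\<close> may split into several classes on \<open>M\<close>. The pieces are indexed by those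
\<open>x \<in> H\<close>, up to left multiplication by \<open>M\<close>, that move some element of \<open>M\<close> into \<open>M\<close>; the set \<open>T\<close>
represents them.\<close>

lemma twisted_finite_subgroup:
  assumes H: "subgroup H G" "psi ` H \<subseteq> H" "twisted_finite G psi H"
    and M: "subgroup M G" "psi ` M \<subseteq> M" "M \<subseteq> H"
    and T: "finite T" "T \<subseteq> H"
      "\<And>x a. x \<in> H \<Longrightarrow> a \<in> M \<Longrightarrow> x \<otimes> a \<otimes> inv (psi x) \<in> M \<Longrightarrow> \<exists>t \<in> T. x \<otimes> inv t \<in> M"
  shows "twisted_finite G psi M"
proof -
  obtain R where R: "finite R" "R \<subseteq> H" "\<forall>h \<in> H. \<exists>r \<in> R. \<exists>x \<in> H. h = x \<otimes> r \<otimes> inv (psi x)"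
    using H(3) unfolding twisted_finite_def by blast
  have [simp]: "\<And>x. x \<in> H \<Longrightarrow> x \<in> carrier G" using subgroup.mem_carrier[OF H(1)] .
  have [simp]: "\<And>x. x \<in> M \<Longrightarrow> x \<in> carrier G" using subgroup.mem_carrier[OF M(1)] .
  \<comment> \<open>A representative in \<open>M\<close> of the class of \<open>r\<close>, if this class meets \<open>M\<close>.\<close>
  define a where "a r = (SOME a. a \<in> M \<and> (\<exists>x \<in> H. a = x \<otimes> r \<otimes> inv (psi x)))" for r
  have a: "a r \<in> M \<and> (\<exists>x \<in> H. a r = x \<otimes> r \<otimes> inv (psi x))"
    if "b \<in> M" "x \<in> H" "b = x \<otimes> r \<otimes> inv (psi x)" for r b x
    unfolding a_def by (rule someI[of _ b]) (use that in blast)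
  let ?R = "(\<lambda>(t,r). t \<otimes> a r \<otimes> inv (psi t)) ` (T \<times> R) \<inter> M"
  have "\<exists>r \<in> ?R. \<exists>m \<in> M. b = m \<otimes> r \<otimes> inv (psi m)" if b: "b \<in> M" for b
  proof -
    obtain r x where rx: "r \<in> R" "x \<in> H" "b = x \<otimes> r \<otimes> inv (psi x)" using R(3) b M(3) by blast
    obtain y where y: "a r \<in> M" "y \<in> H" "a r = y \<otimes> r \<otimes> inv (psi y)" using a[OF b rx(2,3)] by blast
    have rC: "r \<in> carrier G" using rx(1) R(2) by auto
    let ?z = "x \<otimes> inv y"
    have z: "?z \<in> H" using rx(2) y(2) by (intro subgroup.m_closed[OF H(1)] subgroup.m_inv_closed[OF H(1)])
    have bz: "b = ?z \<otimes> a r \<otimes> inv (psi ?z)"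
      unfolding y(3) rx(3) using rx(2) y(2) rC by (simp add: m_assoc inv_mult_group)
    obtain t where t: "t \<in> T" "?z \<otimes> inv t \<in> M" using T(3)[OF z y(1)] b bz by auto
    have tC: "t \<in> carrier G" using t(1) T(2) by auto
    let ?m = "?z \<otimes> inv t"
    have b_eq: "b = ?m \<otimes> (t \<otimes> a r \<otimes> inv (psi t)) \<otimes> inv (psi ?m)"
      unfolding bz using tC z y(1,2) rx(2) by (simp add: m_assoc inv_mult_group)
    have "t \<otimes> a r \<otimes> inv (psi t) = inv ?m \<otimes> b \<otimes> psi ?m"
      unfolding b_eq using tC y(1) t(2) by (simp add: m_assoc)
    also have "psi ?m \<in> M" using t(2) M(2) by blast
    then have "inv ?m \<otimes> b \<otimes> psi ?m \<in> M"
      by (intro subgroup.m_closed[OF M(1) subgroup.m_closed[OF M(1) subgroup.m_inv_closed[OF M(1) t(2)] b]])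
    finally have "t \<otimes> a r \<otimes> inv (psi t) \<in> ?R" using t(1) rx(1) by auto
    then show ?thesis using b_eq t(2) by blast
  qed
  then show ?thesis unfolding twisted_finite_def using T(1) R(1) by (intro exI[of _ ?R]) auto
qed

lemma twisted_finite_finite_index:
  assumes "subgroup H G" "psi ` H \<subseteq> H" "twisted_finite G psi H"
    and "subgroup M G" "psi ` M \<subseteq> M" "M \<subseteq> H" "finite_index G M H"
  shows "twisted_finite G psi M"
proof -
  obtain T where "finite T" "T \<subseteq> H" "\<forall>h \<in> H. \<exists>t \<in> T. h \<otimes> inv t \<in> M"
    using assms(7) unfolding finite_index_def by blast
  then show ?thesis using twisted_finite_subgroup[OF assms(1-6), of T] by blast
qed

end

lemma (in group) abelianisation:
  assumes "subgroup H G"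
  obtains Q :: "'a set monoid" and \<pi> where "comm_group Q" "\<pi> \<in> hom (G\<lparr>carrier := H\<rparr>) Q"
    "\<pi> ` H = carrier Q" "\<And>x. x \<in> H \<Longrightarrow> \<pi> x = \<one>\<^bsub>Q\<^esub> \<longleftrightarrow> x \<in> derived G H"
proof -
  let ?H = "G\<lparr>carrier := H\<rparr>" and ?K = "derived G H"
  interpret H: group ?H using assms by (rule subgroup_imp_group)
  have K: "derived ?H H = ?K" using derived_consistent[OF subset_refl assms] .
  interpret K: normal ?K ?H using derived_subgroup_is_normal[OF assms] .
  show thesis
  proof (rule that[of "?H Mod ?K" "\<lambda>x. ?K #>\<^bsub>?H\<^esub> x"])
    show "comm_group (?H Mod ?K)" using H.derived_quot_is_comm_group K by simp
    show "(\<lambda>x. ?K #>\<^bsub>?H\<^esub> x) \<in> hom ?H (?H Mod ?K)" by (rule K.r_coset_hom_Mod)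
    show "(\<lambda>x. ?K #>\<^bsub>?H\<^esub> x) ` H = carrier (?H Mod ?K)" by (simp add: carrier_FactGroup)
    fix x assume x: "x \<in> H"
    show "?K #>\<^bsub>?H\<^esub> x = \<one>\<^bsub>?H Mod ?K\<^esub> \<longleftrightarrow> x \<in> ?K"
      using H.coset_join1[OF _ _ K.subgroup_axioms, of x] H.coset_join2[OF _ K.subgroup_axioms, of x] x K.subset
      by auto
  qed
qed

context group_endomorphism
begin

lemma image_derived: "psi ` H \<subseteq> H \<Longrightarrow> subgroup H G \<Longrightarrow> psi ` derived G H \<subseteq> derived G H"
  using psi.derived_img[of H] mono_derived[of "psi ` H" H] subgroup.subset[of H G] by simp

text \<open>The abelianisation of \<open>H\<close> in elementwise form, together with the fact that \<open>x \<mapsto> x \<psi>(x)\<inverse>\<close>,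
which need not be a homomorphism on \<open>H\<close>, becomes one there.\<close>

lemma twisted_abelianisation:
  assumes "subgroup H G" "psi ` H \<subseteq> H"
  obtains Q :: "'a set monoid" and \<pi> where "comm_group Q" "\<pi> \<in> hom (G\<lparr>carrier := H\<rparr>) Q"
    "\<pi> ` H = carrier Q" "\<And>x. x \<in> H \<Longrightarrow> \<pi> x = \<one>\<^bsub>Q\<^esub> \<longleftrightarrow> x \<in> derived G H"
    "\<And>x. x \<in> H \<Longrightarrow> \<pi> x \<in> carrier Q"
    "\<And>x y. x \<in> H \<Longrightarrow> y \<in> H \<Longrightarrow> \<pi> (x \<otimes> y) = \<pi> x \<otimes>\<^bsub>Q\<^esub> \<pi> y"
    "\<And>x. x \<in> H \<Longrightarrow> \<pi> (inv x) = inv\<^bsub>Q\<^esub> \<pi> x"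
    "\<And>x y. x \<in> H \<Longrightarrow> y \<in> H \<Longrightarrow> \<pi> ((x \<otimes> y) \<otimes> inv (psi (x \<otimes> y)))
      = \<pi> (x \<otimes> inv (psi x)) \<otimes>\<^bsub>Q\<^esub> \<pi> (y \<otimes> inv (psi y))"
    "\<And>x. x \<in> H \<Longrightarrow> \<pi> (inv x \<otimes> inv (psi (inv x))) = inv\<^bsub>Q\<^esub> \<pi> (x \<otimes> inv (psi x))"
proof -
  obtain Q :: "'a set monoid" and \<pi> where Q: "comm_group Q" "\<pi> \<in> hom (G\<lparr>carrier := H\<rparr>) Q"
    "\<pi> ` H = carrier Q" "\<And>x. x \<in> H \<Longrightarrow> \<pi> x = \<one>\<^bsub>Q\<^esub> \<longleftrightarrow> x \<in> derived G H"
    by (rule abelianisation[OF assms(1)]) (rule that; simp)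
  interpret Q: comm_group Q by fact
  have pc: "\<And>x. x \<in> H \<Longrightarrow> \<pi> x \<in> carrier Q" and
    pm: "\<And>x y. x \<in> H \<Longrightarrow> y \<in> H \<Longrightarrow> \<pi> (x \<otimes> y) = \<pi> x \<otimes>\<^bsub>Q\<^esub> \<pi> y"
    using Q(2) by (auto simp: hom_def)
  have Hm: "\<And>x y. x \<in> H \<Longrightarrow> y \<in> H \<Longrightarrow> x \<otimes> y \<in> H" and Hi: "\<And>x. x \<in> H \<Longrightarrow> inv x \<in> H"
    and Hp: "\<And>x. x \<in> H \<Longrightarrow> psi x \<in> H" and HC: "\<And>x. x \<in> H \<Longrightarrow> x \<in> carrier G"
    using subgroup.m_closed[OF assms(1)] subgroup.m_inv_closed[OF assms(1)] assms(2)
      subgroup.mem_carrier[OF assms(1)] by auto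
  have pdm: "\<pi> (x \<otimes> y \<otimes> inv (psi (x \<otimes> y))) = \<pi> (x \<otimes> inv (psi x)) \<otimes>\<^bsub>Q\<^esub> \<pi> (y \<otimes> inv (psi y))"
    if xy: "x \<in> H" "y \<in> H" for x y
  proof -
    have "x \<otimes> y \<otimes> inv (psi (x \<otimes> y)) = x \<otimes> y \<otimes> (inv (psi y) \<otimes> inv (psi x))"
      using xy HC Hp by (simp add: inv_mult_group)
    then show ?thesis
      using xy by (simp add: pm pc Hm Hi Hp Q.m_ac)
  qed
  have pi: "\<pi> (inv x) = inv\<^bsub>Q\<^esub> \<pi> x" if x: "x \<in> H" for x
  proof -
    interpret H: group "G\<lparr>carrier := H\<rparr>" using assms(1) by (rule subgroup_imp_group)
    interpret p: group_hom "G\<lparr>carrier := H\<rparr>" Q \<pi> using Q(2) by unfold_locales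
    show ?thesis using p.hom_inv[of x] m_inv_consistent[OF assms(1) x] x by simp
  qed
  have pdi: "\<pi> (inv x \<otimes> inv (psi (inv x))) = inv\<^bsub>Q\<^esub> \<pi> (x \<otimes> inv (psi x))" if x: "x \<in> H" for x
    using x HC[OF x] by (simp add: pm pc pi Hm Hi Hp Q.inv_mult Q.m_ac)
  show thesis by (rule that[OF Q pc pm pi pdm pdi])
qed

text \<open>The set on the right is the preimage of the fixed points of \<open>\<psi>\<close> on the abelianisation of \<open>H\<close>, that
is, of the kernel of \<open>x \<mapsto> x \<psi>(x)\<inverse>\<close>. The cokernel of this map is finite because there are finitely many classes, and the
kernels of its powers are stationary by the ascending chain condition, so the kernel is finite.\<close>

lemma fixed_mod_derived_finite_index:
  assumes poly: "polycyclic_seq G P" "H \<subseteq> P" and H: "subgroup H G" "psi ` H \<subseteq> H"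
    and tf: "twisted_finite G psi H"
  shows "finite_index G (derived G H) {x \<in> H. x \<otimes> inv (psi x) \<in> derived G H}"
proof -
  let ?H = "G\<lparr>carrier := H\<rparr>" and ?K = "derived G H" and ?\<delta> = "\<lambda>x. x \<otimes> inv (psi x)"
  interpret H: group ?H using H(1) by (rule subgroup_imp_group)
  obtain Q :: "'a set monoid" and \<pi> where Q: "comm_group Q" "\<pi> \<in> hom ?H Q"
    "\<pi> ` H = carrier Q" "\<And>x. x \<in> H \<Longrightarrow> \<pi> x = \<one>\<^bsub>Q\<^esub> \<longleftrightarrow> x \<in> ?K"
    and pc: "\<And>x. x \<in> H \<Longrightarrow> \<pi> x \<in> carrier Q"
    and pm: "\<And>x y. x \<in> H \<Longrightarrow> y \<in> H \<Longrightarrow> \<pi> (x \<otimes> y) = \<pi> x \<otimes>\<^bsub>Q\<^esub> \<pi> y"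
    and pi: "\<And>x. x \<in> H \<Longrightarrow> \<pi> (inv x) = inv\<^bsub>Q\<^esub> \<pi> x"
    and pdm: "\<And>x y. x \<in> H \<Longrightarrow> y \<in> H \<Longrightarrow> \<pi> (?\<delta> (x \<otimes> y)) = \<pi> (?\<delta> x) \<otimes>\<^bsub>Q\<^esub> \<pi> (?\<delta> y)"
    and pdi: "\<And>x. x \<in> H \<Longrightarrow> \<pi> (?\<delta> (inv x)) = inv\<^bsub>Q\<^esub> \<pi> (?\<delta> x)"
    by (rule twisted_abelianisation[OF H]) (rule that; simp)
  interpret Q: comm_group Q by fact
  have Hm: "\<And>x y. x \<in> H \<Longrightarrow> y \<in> H \<Longrightarrow> x \<otimes> y \<in> H" and Hi: "\<And>x. x \<in> H \<Longrightarrow> inv x \<in> H"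
    and Hp: "\<And>x. x \<in> H \<Longrightarrow> psi x \<in> H" and HC: "\<And>x. x \<in> H \<Longrightarrow> x \<in> carrier G"
    using subgroup.m_closed[OF H(1)] subgroup.m_inv_closed[OF H(1)] H(2)
      subgroup.mem_carrier[OF H(1)] by auto
  have p_eq: "x \<otimes> inv y \<in> ?K \<longleftrightarrow> \<pi> x = \<pi> y" if "x \<in> H" "y \<in> H" for x y
  proof -
    have "\<pi> (x \<otimes> inv y) = \<pi> x \<otimes>\<^bsub>Q\<^esub> inv\<^bsub>Q\<^esub> \<pi> y" using that by (simp add: pm pi Hi)
    then show ?thesis using that Q(4)[OF Hm[OF that(1) Hi[OF that(2)]]] pc Q.inv_solve_right'[of "\<one>\<^bsub>Q\<^esub>" "\<pi> x" "\<pi> y"]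
      by auto
  qed
  have K_psi: "psi x \<in> ?K" if "x \<in> ?K" for x using image_derived[OF H(2,1)] that by blast
  have sK: "subgroup ?K G" using derived_is_subgroup subgroup.subset[OF H(1)] by blast
  have KH: "?K \<subseteq> H" using derived_incl[OF subset_refl H(1)] .
  define d where "d a = \<pi> (?\<delta> (SOME x. x \<in> H \<and> \<pi> x = a))" for a
  have d: "d (\<pi> x) = \<pi> (?\<delta> x)" if x: "x \<in> H" for x
  proof -
    define y where "y = (SOME y. y \<in> H \<and> \<pi> y = \<pi> x)"
    have y: "y \<in> H" "\<pi> y = \<pi> x" using someI[of "\<lambda>y. y \<in> H \<and> \<pi> y = \<pi> x" x] x unfolding y_def by auto
    then have k: "y \<otimes> inv x \<in> ?K" using p_eq x by simp
    have "?\<delta> (y \<otimes> inv x) \<in> ?K"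
      by (rule subgroup.m_closed[OF sK k subgroup.m_inv_closed[OF sK K_psi[OF k]]])
    then have "\<pi> (?\<delta> (y \<otimes> inv x)) = \<one>\<^bsub>Q\<^esub>" using Q(4) KH by blast
    then have "\<pi> (?\<delta> y) \<otimes>\<^bsub>Q\<^esub> inv\<^bsub>Q\<^esub> \<pi> (?\<delta> x) = \<one>\<^bsub>Q\<^esub>" using x y by (simp only: pdm pdi Hi)
    then have "\<pi> (?\<delta> y) = \<pi> (?\<delta> x)"
      using Q.inv_solve_right'[of "\<one>\<^bsub>Q\<^esub>" "\<pi> (?\<delta> y)" "\<pi> (?\<delta> x)"] pc x y(1) Hm Hi Hp by auto
    then show ?thesis unfolding d_def y_def .
  qed
  have surj: "\<exists>x \<in> H. a = \<pi> x" if "a \<in> carrier Q" for a using that Q(3) by blast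
  have d_hom: "d \<in> hom Q Q"
  proof (rule homI)
    fix a b assume "a \<in> carrier Q" "b \<in> carrier Q"
    then obtain x y where xy: "x \<in> H" "a = \<pi> x" "y \<in> H" "b = \<pi> y" using surj by blast
    show "d a \<in> carrier Q" unfolding xy(2) d[OF xy(1)] using xy(1) by (intro pc) (auto intro: Hm Hi Hp)
    have "d (a \<otimes>\<^bsub>Q\<^esub> b) = d (\<pi> (x \<otimes> y))" unfolding xy(2,4) by (simp only: pm[OF xy(1,3)])
    also have "\<dots> = d a \<otimes>\<^bsub>Q\<^esub> d b" unfolding xy(2,4) d[OF Hm[OF xy(1,3)]] d[OF xy(1)] d[OF xy(3)] pdm[OF xy(1,3)] ..
    finally show "d (a \<otimes>\<^bsub>Q\<^esub> b) = d a \<otimes>\<^bsub>Q\<^esub> d b" .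
  qed
  interpret dd: group_hom Q Q d using d_hom by unfold_locales
  have dn: "d ^^ n \<in> hom Q Q" for n
  proof (induction n)
    case 0
    show ?case by (simp add: hom_def)
  next
    case (Suc n)
    show ?case using Group.hom_compose[OF Suc d_hom] by (simp add: comp_def)
  qed
  have coker: "finite_index Q (d ` carrier Q) (carrier Q)"
  proof -
    obtain R where R: "finite R" "R \<subseteq> H" "\<forall>h \<in> H. \<exists>r \<in> R. \<exists>x \<in> H. h = x \<otimes> r \<otimes> inv (psi x)"
      using tf unfolding twisted_finite_def by blast
    have "\<exists>t \<in> \<pi> ` R. a \<otimes>\<^bsub>Q\<^esub> inv\<^bsub>Q\<^esub> t \<in> d ` carrier Q" if a: "a \<in> carrier Q" for a
    proof -
      obtain h where h: "h \<in> H" "a = \<pi> h" using surj a by blast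
      obtain r x where r: "r \<in> R" "x \<in> H" "h = x \<otimes> r \<otimes> inv (psi x)" using R(3) h(1) by blast
      have rH: "r \<in> H" using r R by blast
      have "a \<otimes>\<^bsub>Q\<^esub> inv\<^bsub>Q\<^esub> \<pi> r = \<pi> (?\<delta> x)"
        unfolding h(2) r(3) using rH r(2) pc by (simp add: pm pi Hm Hi Hp Q.m_ac Q.m_inv_lcancel)
      also have "\<dots> = d (\<pi> x)" using d[OF r(2)] by simp
      finally show ?thesis using r(1,2) pc by blast
    qed
    then show ?thesis unfolding finite_index_def using R(1,2) Q(3) by (intro exI[of _ "\<pi> ` R"]) blast
  qed
  define V where "V n = {x \<in> H. (d ^^ n) (\<pi> x) = \<one>\<^bsub>Q\<^esub>}" for n
  have "\<exists>n. V (Suc n) = V n"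
  proof (rule ascending_chain_stabilises)
    fix n
    interpret dp: group_hom ?H Q "(d ^^ n) \<circ> \<pi>"
      using Group.hom_compose[OF Q(2) dn[of n]] by unfold_locales
    have "subgroup (kernel ?H Q ((d ^^ n) \<circ> \<pi>)) G" using incl_subgroup[OF H(1) dp.subgroup_kernel] .
    then show "subgroup (V n) G" unfolding V_def kernel_def by simp
    show "V n \<subseteq> H" unfolding V_def by blast
    show "V n \<subseteq> V (Suc n)"
    proof
      fix x assume "x \<in> V n"
      then have "x \<in> H" "(d ^^ n) (\<pi> x) = \<one>\<^bsub>Q\<^esub>" unfolding V_def by blast+
      then show "x \<in> V (Suc n)" unfolding V_def using dd.hom_one by simp
    qed
  next
    fix U assume "subgroup U G" "U \<subseteq> H"
    then show "\<exists>X. finite X \<and> X \<subseteq> U \<and> U = generate G X"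
      using poly(2) by (intro polycyclic_subgroup_finitely_generated[OF poly(1)]) auto
  qed
  then obtain n where n: "V (Suc n) = V n" by blast
  have fin: "finite {a \<in> carrier Q. d a = \<one>\<^bsub>Q\<^esub>}"
  proof (rule Q.finite_kernel_if_finite_index_image[OF d_hom coker])
    fix a assume "a \<in> carrier Q" "(d ^^ Suc n) a = \<one>\<^bsub>Q\<^esub>"
    moreover from this obtain x where x: "x \<in> H" "a = \<pi> x" using surj by blast
    ultimately have "x \<in> V (Suc n)" unfolding V_def by simp
    then have "x \<in> V n" unfolding n .
    then show "(d ^^ n) a = \<one>\<^bsub>Q\<^esub>" unfolding V_def x(2) by simp
  qed
  show ?thesis
  proof (rule finite_indexI_map[of \<pi>])
    have "\<pi> ` {x \<in> H. ?\<delta> x \<in> ?K} \<subseteq> {a \<in> carrier Q. d a = \<one>\<^bsub>Q\<^esub>}"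
    proof
      fix a assume "a \<in> \<pi> ` {x \<in> H. ?\<delta> x \<in> ?K}"
      then obtain x where x: "x \<in> H" "?\<delta> x \<in> ?K" "a = \<pi> x" by blast
      then have "\<pi> (?\<delta> x) = \<one>\<^bsub>Q\<^esub>" using Q(4) KH by blast
      then show "a \<in> {a \<in> carrier Q. d a = \<one>\<^bsub>Q\<^esub>}" using x(1,3) d[OF x(1)] pc by simp
    qed
    then show "finite (\<pi> ` {x \<in> H. ?\<delta> x \<in> ?K})" using fin by (rule finite_subset)
    fix x y assume "x \<in> {x \<in> H. ?\<delta> x \<in> ?K}" "y \<in> {x \<in> H. ?\<delta> x \<in> ?K}" "\<pi> x = \<pi> y"
    then show "x \<otimes> inv y \<in> ?K" using p_eq by blast
  qed
qed

end

context group_endomorphism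
begin

lemma twisted_translate:
  assumes "x \<in> carrier G" "y \<in> carrier G"
  shows "x \<otimes> (y \<otimes> inv (psi y)) \<otimes> inv (psi x) = (x \<otimes> y) \<otimes> inv (psi (x \<otimes> y))"
  using assms by (simp add: m_assoc inv_mult_group)

text \<open>Induction on the derived length of \<open>H\<close>. The group \<open>P\<close> stays fixed meanwhile; its polycyclic series is
the source of finite generation and of separation for all subgroups that occur.\<close>

theorem twisted_orbit_contains_finite_index:
  assumes poly: "polycyclic_seq G P"
    and "subgroup H G" "H \<subseteq> P" "psi ` H \<subseteq> H" "(derived G ^^ n) H = {\<one>}" "twisted_finite G psi H"
  shows "\<exists>L. subgroup L G \<and> L \<subseteq> (\<lambda>x. x \<otimes> inv (psi x)) ` H \<and> L \<subseteq> H \<and> finite_index G L H"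
  using assms(2-)
proof (induction n arbitrary: H)
  case 0
  have "\<one> \<otimes> inv (psi \<one>) = \<one>" by simp
  then have "{\<one>} \<subseteq> (\<lambda>x. x \<otimes> inv (psi x)) ` H" using 0(4) by force
  then show ?case using finite_index_self[OF triv_subgroup] triv_subgroup 0(4) by (intro exI[of _ "{\<one>}"]) auto
next
  case (Suc n)
  note H = Suc.prems(1,3) and HP = Suc.prems(2) and tf = Suc.prems(5)
  let ?K = "derived G H" and ?H = "G\<lparr>carrier := H\<rparr>" and ?\<delta> = "\<lambda>x. x \<otimes> inv (psi x)"
  interpret H: group ?H using H(1) by (rule subgroup_imp_group)
  have Hm: "\<And>x y. x \<in> H \<Longrightarrow> y \<in> H \<Longrightarrow> x \<otimes> y \<in> H" and Hi: "\<And>x. x \<in> H \<Longrightarrow> inv x \<in> H"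
    and Hp: "\<And>x. x \<in> H \<Longrightarrow> psi x \<in> H" and HC: "\<And>x. x \<in> H \<Longrightarrow> x \<in> carrier G"
    using subgroup.m_closed[OF H(1)] subgroup.m_inv_closed[OF H(1)] H(2)
      subgroup.mem_carrier[OF H(1)] by auto
  have sK: "subgroup ?K G" using derived_is_subgroup subgroup.subset[OF H(1)] by blast
  have KH: "?K \<subseteq> H" using derived_incl[OF subset_refl H(1)] .
  interpret K: normal ?K ?H using derived_subgroup_is_normal[OF H(1)] .
  have K_norm: "h \<otimes> k \<otimes> inv h \<in> ?K" if "h \<in> H" "k \<in> ?K" for h k
    using K.inv_op_closed2[of h k] that m_inv_consistent[OF H(1) that(1)] by simp
  have psi_K: "psi ` ?K \<subseteq> ?K" by (rule image_derived[OF H(2,1)])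
  \<comment> \<open>An element \<open>x\<close> that moves some element of \<open>K\<close> into \<open>K\<close> is fixed by \<open>\<psi>\<close> modulo \<open>K\<close>, so up to \<open>K\<close>
there are finitely many of them.\<close>
  have tf_K: "twisted_finite G psi ?K"
  proof -
    obtain T where T: "finite T" "T \<subseteq> {x \<in> H. ?\<delta> x \<in> ?K}"
      "\<forall>h \<in> {x \<in> H. ?\<delta> x \<in> ?K}. \<exists>t \<in> T. h \<otimes> inv t \<in> ?K"
      using fixed_mod_derived_finite_index[OF poly HP H tf] unfolding finite_index_def by blast
    show ?thesis
    proof (rule twisted_finite_subgroup[OF H tf sK psi_K KH T(1)])
      show "T \<subseteq> H" using T(2) by blast
      fix x a assume x: "x \<in> H" and a: "a \<in> ?K" and xa: "x \<otimes> a \<otimes> inv (psi x) \<in> ?K"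
      have "psi x \<otimes> inv a \<otimes> inv (psi x) \<in> ?K"
        by (rule K_norm[OF Hp[OF x] subgroup.m_inv_closed[OF sK a]])
      with xa have "(x \<otimes> a \<otimes> inv (psi x)) \<otimes> (psi x \<otimes> inv a \<otimes> inv (psi x)) \<in> ?K"
        by (rule subgroup.m_closed[OF sK])
      also have "(x \<otimes> a \<otimes> inv (psi x)) \<otimes> (psi x \<otimes> inv a \<otimes> inv (psi x)) = ?\<delta> x"
        using HC[OF x] HC[OF subsetD[OF KH a]] by (simp add: m_assoc)
      finally show "\<exists>t \<in> T. x \<otimes> inv t \<in> ?K" using T(3) x by blast
    qed
  qed
  have "(derived G ^^ n) ?K = {\<one>}" using Suc.prems(4) by (simp add: funpow_swap1)
  then obtain L0 where L0: "subgroup L0 G" "L0 \<subseteq> ?\<delta> ` ?K" "L0 \<subseteq> ?K" "finite_index G L0 ?K"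
    using Suc.IH[OF sK _ psi_K _ tf_K] KH HP by blast
  obtain L where L: "subgroup L G" "L \<subseteq> L0" "finite_index G L ?K"
    and L_inv: "\<And>\<psi>. \<psi> \<in> hom (G\<lparr>carrier := ?K\<rparr>) (G\<lparr>carrier := ?K\<rparr>) \<Longrightarrow> \<psi> ` L \<subseteq> L"
    using polycyclic_fully_invariant_core[OF poly sK subset_trans[OF KH HP] L0(1,3,4)] by blast
  have LK: "L \<subseteq> ?K" using L L0 by blast
  have L_norm: "h \<otimes> l \<otimes> inv h \<in> L" if "h \<in> H" "l \<in> L" for h l
    using L_inv[OF conj_hom[OF sK HC[OF that(1)] K_norm[OF that(1)]]] that(2) by auto
  obtain M0 where M0: "subgroup M0 G" "M0 \<subseteq> P" "finite_index G M0 P" "M0 \<inter> ?K \<subseteq> L"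
    using polycyclic_separates_subgroup[OF poly sK subset_trans[OF KH HP] L(1) LK L(3)] by blast
  have PC: "P \<subseteq> carrier G" using polycyclic_seq_subgroup[OF poly] by (rule subgroup.subset)
  have fi0: "finite_index G (M0 \<inter> H) H" using finite_index_Int_subgroup[OF M0(3,1) H(1) HP PC] .
  obtain M where M: "subgroup M G" "M \<subseteq> M0 \<inter> H" "finite_index G M H"
    and M_inv: "\<And>\<psi>. \<psi> \<in> hom ?H ?H \<Longrightarrow> \<psi> ` M \<subseteq> M"
    using polycyclic_fully_invariant_core[OF poly H(1) HP subgroups_Inter_pair[OF M0(1) H(1)] _ fi0] by blast
  have MH: "M \<subseteq> H" and MKL: "M \<inter> ?K \<subseteq> L" using M(2) M0(4) by blast+
  have "psi \<in> hom ?H ?H" using Hp psi.hom_mult HC by (auto simp: hom_def)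
  then have psi_M: "psi ` M \<subseteq> M" by (rule M_inv)
  have tf_M: "twisted_finite G psi M"
    by (rule twisted_finite_finite_index[OF H tf M(1) psi_M MH M(3)])
  have MC: "\<And>x. x \<in> M \<Longrightarrow> x \<in> carrier G" and Mp: "\<And>x. x \<in> M \<Longrightarrow> psi x \<in> M"
    and M_in_H: "\<And>x. x \<in> M \<Longrightarrow> x \<in> H"
    using subgroup.mem_carrier[OF M(1)] psi_M MH by auto
  note Mm = subgroup.m_closed[OF M(1)] and Mi = subgroup.m_inv_closed[OF M(1)]
  obtain Q :: "'a set monoid" and \<pi> where Q: "comm_group Q" "\<pi> \<in> hom ?H Q"
    "\<pi> ` H = carrier Q" "\<And>x. x \<in> H \<Longrightarrow> \<pi> x = \<one>\<^bsub>Q\<^esub> \<longleftrightarrow> x \<in> ?K"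
    and pc: "\<And>x. x \<in> H \<Longrightarrow> \<pi> x \<in> carrier Q"
    and pm: "\<And>x y. x \<in> H \<Longrightarrow> y \<in> H \<Longrightarrow> \<pi> (x \<otimes> y) = \<pi> x \<otimes>\<^bsub>Q\<^esub> \<pi> y"
    and pi: "\<And>x. x \<in> H \<Longrightarrow> \<pi> (inv x) = inv\<^bsub>Q\<^esub> \<pi> x"
    and pdm: "\<And>x y. x \<in> H \<Longrightarrow> y \<in> H \<Longrightarrow> \<pi> (?\<delta> (x \<otimes> y)) = \<pi> (?\<delta> x) \<otimes>\<^bsub>Q\<^esub> \<pi> (?\<delta> y)"
    and pdi: "\<And>x. x \<in> H \<Longrightarrow> \<pi> (?\<delta> (inv x)) = inv\<^bsub>Q\<^esub> \<pi> (?\<delta> x)"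
    by (rule twisted_abelianisation[OF H]) (rule that; simp)
  interpret Q: comm_group Q by fact
  \<comment> \<open>The elements of \<open>M\<close> that agree with some \<open>x \<psi>(x)\<inverse>\<close>, \<open>x \<in> M\<close>, modulo \<open>K\<close>. Since \<open>M \<inter> K \<subseteq> L\<close>, they
differ from it by an element of \<open>L\<close>.\<close>
  define D where "D = {m \<in> M. \<exists>x \<in> M. \<pi> m = \<pi> (?\<delta> x)}"
  have D: "subgroup D G"
  proof (rule subgroupI)
    show "D \<subseteq> carrier G" using MC unfolding D_def by blast
    have "\<one> \<in> M" using M(1) by (rule subgroup.one_closed)
    moreover have "?\<delta> \<one> = \<one>" by simp
    ultimately have "\<one> \<in> D" unfolding D_def by force
    then show "D \<noteq> {}" by blast
  next
    fix a assume "a \<in> D"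
    then obtain x where x: "a \<in> M" "x \<in> M" "\<pi> a = \<pi> (?\<delta> x)" unfolding D_def by blast
    have "\<pi> (inv a) = \<pi> (?\<delta> (inv x))" using x pi[of a] pdi[of x] M_in_H by simp
    then show "inv a \<in> D" unfolding D_def using Mi x(1,2) by blast
  next
    fix a b assume "a \<in> D" "b \<in> D"
    then obtain x y where x: "a \<in> M" "x \<in> M" "\<pi> a = \<pi> (?\<delta> x)" and y: "b \<in> M" "y \<in> M" "\<pi> b = \<pi> (?\<delta> y)"
      unfolding D_def by blast
    have "\<pi> (a \<otimes> b) = \<pi> (?\<delta> (x \<otimes> y))" using x y pm[of a b] pdm[of x y] M_in_H by simp
    then show "a \<otimes> b \<in> D" unfolding D_def using Mm x(1,2) y(1,2) by blast
  qed
  have "D \<subseteq> ?\<delta> ` H"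
  proof
    fix a assume "a \<in> D"
    then obtain x where x: "a \<in> M" "x \<in> M" "\<pi> a = \<pi> (?\<delta> x)" unfolding D_def by blast
    have dx: "?\<delta> x \<in> M" using x(2) Mp by (intro Mm Mi)
    let ?l = "inv (?\<delta> x) \<otimes> a"
    have lM: "?l \<in> M" by (rule Mm[OF Mi[OF dx] x(1)])
    have "\<pi> ?l = \<pi> (inv (?\<delta> x)) \<otimes>\<^bsub>Q\<^esub> \<pi> a" using dx x(1) Mi M_in_H by (intro pm) blast+
    also have "\<dots> = \<one>\<^bsub>Q\<^esub>" using pi[of "?\<delta> x"] x(3) M_in_H[OF dx] pc[of "?\<delta> x"] by simp
    finally have "?l \<in> ?K" using Q(4)[of ?l] M_in_H[OF lM] by blast
    \<comment> \<open>The factor in \<open>L\<close> is moved to the middle of \<open>x \<psi>(x)\<inverse>\<close> and there absorbed into \<open>x\<close>.\<close>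
    then have "?l \<in> L" using MKL lM by blast
    then have "inv (psi x) \<otimes> ?l \<otimes> inv (inv (psi x)) \<in> L"
      using x(2) M_in_H Hp Hi by (intro L_norm) auto
    then obtain y where y: "y \<in> ?K" "inv (psi x) \<otimes> ?l \<otimes> inv (inv (psi x)) = ?\<delta> y" using L(2) L0(2) by blast
    have yH: "y \<in> H" using y(1) KH by blast
    have "psi x \<otimes> inv (psi x) \<otimes> ?l = ?l"
      using MC[OF x(2)] MC[OF lM] by (simp add: m_assoc)
    have "a = ?\<delta> x \<otimes> ?l" using MC[OF dx] MC[OF x(1)] by simp
    also have "\<dots> = x \<otimes> (inv (psi x) \<otimes> ?l \<otimes> inv (inv (psi x))) \<otimes> inv (psi x)"
      using MC[OF x(2)] MC[OF lM] by (simp add: m_assoc del: psi.hom_inv)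
    also have "\<dots> = ?\<delta> (x \<otimes> y)"
      unfolding y(2) using twisted_translate[OF MC[OF x(2)] HC[OF yH]] .
    finally show "a \<in> ?\<delta> ` H" using Hm[OF M_in_H[OF x(2)] yH] by blast
  qed
  moreover have "D \<subseteq> H" unfolding D_def using MH by blast
  moreover have "finite_index G D M"
  proof -
    obtain R where R: "finite R" "R \<subseteq> M" "\<forall>h \<in> M. \<exists>r \<in> R. \<exists>x \<in> M. h = x \<otimes> r \<otimes> inv (psi x)"
      using tf_M unfolding twisted_finite_def by blast
    have "\<exists>r \<in> R. h \<otimes> inv r \<in> D" if h: "h \<in> M" for h
    proof -
      obtain r x where r: "r \<in> R" "x \<in> M" "h = x \<otimes> r \<otimes> inv (psi x)" using R(3) h by blast
      have rM: "r \<in> M" using r R by blast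
      have "\<pi> (h \<otimes> inv r) = \<pi> (?\<delta> x)"
        unfolding r(3) using M_in_H[OF rM] M_in_H[OF r(2)] pc by (simp add: pm pi Hm Hi Hp Q.m_ac Q.m_inv_lcancel)
      moreover have "h \<otimes> inv r \<in> M" by (rule Mm[OF h Mi[OF rM]])
      ultimately show ?thesis unfolding D_def using r(1,2) by blast
    qed
    then show ?thesis unfolding finite_index_def using R(1,2) by blast
  qed
  then have "finite_index G D H" by (rule finite_index_trans[OF _ M(3) MH H(1)])
  ultimately show ?case using D by blast
qed

end

context group
begin

lemma polycyclic_seq_of_subgroup:
  assumes H: "subgroup H G" and "polycyclic_seq (G\<lparr>carrier := H\<rparr>) K"
  shows "polycyclic_seq G K"
  using assms(2)
proof (induction rule: polycyclic_seq.induct)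
  case unity
  show ?case using polycyclic_seq.unity[of G] by simp
next
  case (extension K U)
  show ?case
  proof (rule polycyclic_seq.extension[OF extension.IH])
    show "K \<lhd> G\<lparr>carrier := U\<rparr>" "cyclic_group (G\<lparr>carrier := U\<rparr> Mod K)"
      using extension.hyps by simp_all
    show "subgroup U G" using incl_subgroup[OF H extension.hyps(3)] .
  qed
qed

text \<open>Apply the preceding theorem to \<open>x \<mapsto> r \<phi>(x) r\<inverse>\<close> for one representative \<open>r\<close> of each class, and let
\<open>N\<close> be a fully invariant subgroup of the intersection of the subgroups so obtained.\<close>

theorem twisted_classes_saturated:
  assumes poly: "polycyclic_seq G H" and fully: "fully_invariant H G"
    and fiH: "finite_index G H (carrier G)"
    and \<phi>: "\<phi> \<in> hom G G" and fin: "finite (reidemeister_classes G \<phi>)"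
  obtains N where "N \<lhd> G" "finite_index G N (carrier G)" "\<phi> ` N \<subseteq> N"
    "\<And>n g. n \<in> N \<Longrightarrow> g \<in> carrier G \<Longrightarrow> (g, n \<otimes> g) \<in> reidemeister_rel G \<phi>"
proof -
  interpret phi: group_hom G G \<phi> using \<phi> by unfold_locales
  have sH: "subgroup H G" by (rule polycyclic_seq_subgroup[OF poly])
  have inv: "\<psi> ` H \<subseteq> H" if "\<psi> \<in> hom G G" for \<psi> using fully that unfolding fully_invariant_def by blast
  have eq: "equiv (carrier G) (reidemeister_rel G \<phi>)" by (rule equiv_reidemeister_rel[OF is_group \<phi>])
  define R where "R = (\<lambda>C. SOME r. r \<in> C) ` reidemeister_classes G \<phi>"
  have finR: "finite R" unfolding R_def using fin by simp
  have repr: "(SOME r. r \<in> C) \<in> C" if "C \<in> reidemeister_classes G \<phi>" for C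
    using in_quotient_imp_non_empty[OF eq that[unfolded reidemeister_classes_def]]
    by (simp add: some_in_eq)
  have RC: "R \<subseteq> carrier G"
    unfolding R_def using repr in_quotient_imp_subset[OF eq] unfolding reidemeister_classes_def by blast
  have R: "\<exists>r \<in> R. (r, g) \<in> reidemeister_rel G \<phi>" if g: "g \<in> carrier G" for g
  proof -
    let ?C = "reidemeister_rel G \<phi> `` {g}"
    have C: "?C \<in> reidemeister_classes G \<phi>" unfolding reidemeister_classes_def using g by (rule quotientI)
    have "(g, SOME r. r \<in> ?C) \<in> reidemeister_rel G \<phi>" using repr[OF C] by simp
    then have "(SOME r. r \<in> ?C, g) \<in> reidemeister_rel G \<phi>" using equivE[OF eq] by (meson symD)
    then show ?thesis unfolding R_def using C by blast
  qed
  obtain n where n: "(derived G ^^ n) H = {\<one>}" using polycyclic_derived_trivial[OF poly] by blast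
  let ?\<psi> = "\<lambda>r x. r \<otimes> \<phi> x \<otimes> inv r"
  have psi_hom: "?\<psi> r \<in> hom G G" if "r \<in> carrier G" for r
    using that by (auto simp: hom_def m_assoc)
  have "\<exists>L. subgroup L G \<and> L \<subseteq> (\<lambda>x. x \<otimes> inv (?\<psi> r x)) ` H \<and> L \<subseteq> H \<and> finite_index G L H"
    if r: "r \<in> R" for r
  proof -
    have rC: "r \<in> carrier G" using r RC by blast
    interpret E: group_endomorphism G "?\<psi> r" using psi_hom[OF rC] by unfold_locales
    have "\<exists>s \<in> (\<lambda>s. s \<otimes> inv r) ` R. \<exists>x \<in> carrier G. h = x \<otimes> s \<otimes> inv (?\<psi> r x)" if h: "h \<in> carrier G" for h
    proof -
      obtain s where s: "s \<in> R" "(s, h \<otimes> r) \<in> reidemeister_rel G \<phi>" using R[of "h \<otimes> r"] h rC by auto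
      then obtain x where x: "x \<in> carrier G" "h \<otimes> r = x \<otimes> s \<otimes> \<phi> (inv x)"
        unfolding reidemeister_rel_def by blast
      have sC: "s \<in> carrier G" using s RC by blast
      have "h = (h \<otimes> r) \<otimes> inv r" using h rC by (simp add: m_assoc)
      also have "\<dots> = x \<otimes> (s \<otimes> inv r) \<otimes> inv (?\<psi> r x)"
        unfolding x(2) using x(1) sC rC by (simp add: m_assoc inv_mult_group)
      finally show ?thesis using s(1) x(1) by blast
    qed
    then have tfG: "twisted_finite G (?\<psi> r) (carrier G)"
      unfolding twisted_finite_def using finR RC rC
      by (intro exI[of _ "(\<lambda>s. s \<otimes> inv r) ` R"]) auto
    have "twisted_finite G (?\<psi> r) H"
      by (rule E.twisted_finite_finite_index[OF subgroup_self _ tfG sH inv[OF psi_hom[OF rC]] subgroup.subset[OF sH] fiH])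
        (use rC in auto)
    then show ?thesis
      by (rule E.twisted_orbit_contains_finite_index[OF poly sH subset_refl inv[OF psi_hom[OF rC]] n])
  qed
  then obtain L where L: "\<And>r. r \<in> R \<Longrightarrow> subgroup (L r) G"
    "\<And>r. r \<in> R \<Longrightarrow> L r \<subseteq> (\<lambda>x. x \<otimes> inv (?\<psi> r x)) ` H" "\<And>r. r \<in> R \<Longrightarrow> finite_index G (L r) H"
    by metis
  let ?N0 = "{h \<in> H. \<forall>r \<in> R. h \<in> L r}"
  have sN0: "subgroup ?N0 G"
  proof (rule subgroupI)
    show "?N0 \<subseteq> carrier G" using subgroup.subset[OF sH] by blast
    have "\<one> \<in> ?N0" using subgroup.one_closed[OF sH] subgroup.one_closed[OF L(1)] by blast
    then show "?N0 \<noteq> {}" by blast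
    show "inv a \<in> ?N0" if "a \<in> ?N0" for a
      using that subgroup.m_inv_closed[OF sH] subgroup.m_inv_closed[OF L(1)] by blast
    show "a \<otimes> b \<in> ?N0" if "a \<in> ?N0" "b \<in> ?N0" for a b
      using that subgroup.m_closed[OF sH] subgroup.m_closed[OF L(1)] by blast
  qed
  have fiN0: "finite_index G ?N0 H" by (rule finite_index_Inter[OF finR sH L(1,3)])
  obtain N where N: "subgroup N G" "N \<subseteq> ?N0" "finite_index G N H"
    and N_inv: "\<And>\<psi>. \<psi> \<in> hom (G\<lparr>carrier := H\<rparr>) (G\<lparr>carrier := H\<rparr>) \<Longrightarrow> \<psi> ` N \<subseteq> N"
    using polycyclic_fully_invariant_core[OF poly sH subset_refl sN0 _ fiN0] by blast
  have N_endo: "\<psi> ` N \<subseteq> N" if "\<psi> \<in> hom G G" for \<psi>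
    using that inv[OF that] subgroup.mem_carrier[OF sH] by (intro N_inv) (auto simp: hom_def)
  have conj: "(\<lambda>x. g \<otimes> x \<otimes> inv g) \<in> hom G G" if "g \<in> carrier G" for g
    using that by (auto simp: hom_def m_assoc)
  have N_conj: "g \<otimes> x \<otimes> inv g \<in> N" if "g \<in> carrier G" "x \<in> N" for g x
    using N_endo[OF conj[OF that(1)]] that(2) by blast
  have NC: "\<And>x. x \<in> N \<Longrightarrow> x \<in> carrier G" using subgroup.mem_carrier[OF N(1)] .
  show thesis
  proof (rule that)
    show "N \<lhd> G" using N(1) N_conj by (simp add: normal_inv_iff)
    show "finite_index G N (carrier G)"
      by (rule finite_index_trans[OF N(3) fiH subgroup.subset[OF sH] subgroup_self])
    show "\<phi> ` N \<subseteq> N" by (rule N_endo[OF \<phi>])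
    fix n g assume n: "n \<in> N" and g: "g \<in> carrier G"
    obtain r where r: "r \<in> R" "(r, g) \<in> reidemeister_rel G \<phi>" using R[OF g] by blast
    then obtain x where x: "x \<in> carrier G" "g = x \<otimes> r \<otimes> \<phi> (inv x)"
      unfolding reidemeister_rel_def by blast
    have rC: "r \<in> carrier G" using r RC by blast
    have "inv x \<otimes> n \<otimes> inv (inv x) \<in> N" using n x(1) by (intro N_conj) auto
    then have "inv x \<otimes> n \<otimes> inv (inv x) \<in> L r" using N(2) r(1) by blast
    then obtain y where y: "y \<in> H" "inv x \<otimes> n \<otimes> inv (inv x) = y \<otimes> inv (?\<psi> r y)" using L(2)[OF r(1)] by blast
    have yC: "y \<in> carrier G" using y(1) subgroup.mem_carrier[OF sH] by blast
    have nx: "n = x \<otimes> (inv x \<otimes> n \<otimes> inv (inv x)) \<otimes> inv x" using x(1) NC[OF n] by (simp add: m_assoc)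
    have "n \<otimes> g = (x \<otimes> y) \<otimes> r \<otimes> \<phi> (inv (x \<otimes> y))"
      unfolding x(2) by (subst nx, subst y(2)) (use x(1) yC rC in \<open>simp add: m_assoc inv_mult_group\<close>)
    then have "(r, n \<otimes> g) \<in> reidemeister_rel G \<phi>"
      using x(1) yC rC NC[OF n] g by (intro reidemeister_relI[of _ _ _ "x \<otimes> y"]) auto
    then show "(g, n \<otimes> g) \<in> reidemeister_rel G \<phi>"
      using r(2) equivE[OF eq] by (meson symD transD)
  qed
qed

end

section \<open>Orthonormal families of functions on a finite set\<close>

definition inner_on :: "'i set \<Rightarrow> ('i \<Rightarrow> complex) \<Rightarrow> ('i \<Rightarrow> complex) \<Rightarrow> complex"
  where "inner_on I f h = (\<Sum>x\<in>I. f x * cnj (h x))"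

definition orthonormal_on :: "'i set \<Rightarrow> 'j set \<Rightarrow> ('j \<Rightarrow> 'i \<Rightarrow> complex) \<Rightarrow> bool"
  where "orthonormal_on I J e \<longleftrightarrow>
    (\<forall>i\<in>J. \<forall>j\<in>J. inner_on I (e i) (e j) = (if i = j then 1 else 0))"

lemma inner_on_cong:
  "(\<And>x. x \<in> I \<Longrightarrow> f x = f' x) \<Longrightarrow> (\<And>x. x \<in> I \<Longrightarrow> h x = h' x) \<Longrightarrow> inner_on I f h = inner_on I f' h'"
  unfolding inner_on_def by (rule sum.cong) auto

lemma inner_on_sum_left:
  "inner_on I (\<lambda>x. \<Sum>j\<in>J. c j * e j x) h = (\<Sum>j\<in>J. c j * inner_on I (e j) h)"
  unfolding inner_on_def
  by (simp add: sum_distrib_right sum_distrib_left mult.assoc) (rule sum.swap)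

lemma inner_on_sum_right:
  "inner_on I h (\<lambda>x. \<Sum>j\<in>J. c j * e j x) = (\<Sum>j\<in>J. cnj (c j) * inner_on I h (e j))"
  unfolding inner_on_def
  by (simp add: sum_distrib_right sum_distrib_left mult.left_commute) (rule sum.swap)

lemma inner_on_diff_left:
  "inner_on I (\<lambda>x. f x - f' x) h = inner_on I f h - inner_on I f' h"
  unfolding inner_on_def by (simp add: sum_subtractf algebra_simps)

lemma inner_on_diff_right:
  "inner_on I h (\<lambda>x. f x - f' x) = inner_on I h f - inner_on I h f'"
  unfolding inner_on_def by (simp add: sum_subtractf algebra_simps)

lemma inner_on_scale_left: "inner_on I (\<lambda>x. c * f x) h = c * inner_on I f h"
  unfolding inner_on_def by (simp add: sum_distrib_left mult.assoc)

lemma inner_on_scale_right: "inner_on I h (\<lambda>x. c * f x) = cnj c * inner_on I h f"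
  unfolding inner_on_def by (simp add: sum_distrib_left mult.left_commute)

lemma cnj_inner_on: "cnj (inner_on I f h) = inner_on I h f"
  unfolding inner_on_def by (simp add: mult.commute)

lemma inner_on_self: "inner_on I f f = complex_of_real (\<Sum>x\<in>I. (cmod (f x))\<^sup>2)"
  unfolding inner_on_def by (simp only: complex_norm_square of_real_sum)

lemma inner_on_self_eq_0:
  assumes "finite I" "inner_on I f f = 0" "x \<in> I"
  shows "f x = 0"
proof -
  have "(\<Sum>x\<in>I. (cmod (f x))\<^sup>2) = 0" using assms(2) unfolding inner_on_self by (simp only: of_real_eq_0_iff)
  then show ?thesis using assms(1,3) by (simp add: sum_nonneg_eq_0_iff)
qed

text \<open>The function \<open>r f\<close> is \<open>f\<close> minus its orthogonal projection to the span of the family.\<close>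

lemma orthonormal_on_residual:
  assumes "finite J" "orthonormal_on I J e"
  defines "r \<equiv> \<lambda>f x. f x - (\<Sum>j\<in>J. inner_on I f (e j) * e j x)"
  shows "k \<in> J \<Longrightarrow> inner_on I (r f) (e k) = 0"
    and "inner_on I (r f) (r f) = inner_on I f f - of_real (\<Sum>j\<in>J. (cmod (inner_on I f (e j)))\<^sup>2)"
proof -
  show 1: "inner_on I (r f) (e k) = 0" if "k \<in> J" for k
  proof -
    have "(\<Sum>j\<in>J. inner_on I f (e j) * inner_on I (e j) (e k)) = (\<Sum>j\<in>J. if j = k then inner_on I f (e j) else 0)"
      using assms(2) that by (intro sum.cong) (auto simp: orthonormal_on_def)
    also have "\<dots> = inner_on I f (e k)" using assms(1) that by simp
    finally show ?thesis unfolding r_def inner_on_diff_left inner_on_sum_left by simp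
  qed
  have "inner_on I g (r f) = inner_on I g f - (\<Sum>j\<in>J. cnj (inner_on I f (e j)) * inner_on I g (e j))" for g
    unfolding r_def inner_on_diff_right inner_on_sum_right ..
  then have "inner_on I (r f) (r f) = inner_on I (r f) f" using 1 by simp
  also have "\<dots> = inner_on I f f - (\<Sum>j\<in>J. inner_on I f (e j) * inner_on I (e j) f)"
    unfolding r_def inner_on_diff_left inner_on_sum_left ..
  also have "(\<Sum>j\<in>J. inner_on I f (e j) * inner_on I (e j) f) = of_real (\<Sum>j\<in>J. (cmod (inner_on I f (e j)))\<^sup>2)"
    by (simp only: of_real_sum complex_norm_square cnj_inner_on)
  finally show "inner_on I (r f) (r f) = inner_on I f f - of_real (\<Sum>j\<in>J. (cmod (inner_on I f (e j)))\<^sup>2)" .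
qed

lemma bessel:
  assumes "finite J" "orthonormal_on I J e"
  shows "(\<Sum>j\<in>J. (cmod (inner_on I f (e j)))\<^sup>2) \<le> (\<Sum>x\<in>I. (cmod (f x))\<^sup>2)"
proof -
  let ?r = "\<lambda>x. f x - (\<Sum>j\<in>J. inner_on I f (e j) * e j x)"
  have "complex_of_real (\<Sum>x\<in>I. (cmod (?r x))\<^sup>2)
    = of_real ((\<Sum>x\<in>I. (cmod (f x))\<^sup>2) - (\<Sum>j\<in>J. (cmod (inner_on I f (e j)))\<^sup>2))"
    using orthonormal_on_residual(2)[OF assms, of f] unfolding inner_on_self by (simp only: of_real_diff)
  then have "(\<Sum>x\<in>I. (cmod (?r x))\<^sup>2) = (\<Sum>x\<in>I. (cmod (f x))\<^sup>2) - (\<Sum>j\<in>J. (cmod (inner_on I f (e j)))\<^sup>2)"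
    by (simp only: of_real_eq_iff)
  moreover have "(\<Sum>x\<in>I. (cmod (?r x))\<^sup>2) \<ge> 0" by (rule sum_nonneg) simp
  ultimately show ?thesis by linarith
qed

lemma parseval:
  assumes "finite J" "orthonormal_on I J e"
    and "\<And>x. x \<in> I \<Longrightarrow> f x = (\<Sum>j\<in>J. inner_on I f (e j) * e j x)"
  shows "(\<Sum>j\<in>J. (cmod (inner_on I f (e j)))\<^sup>2) = (\<Sum>x\<in>I. (cmod (f x))\<^sup>2)"
proof -
  let ?r = "\<lambda>x. f x - (\<Sum>j\<in>J. inner_on I f (e j) * e j x)"
  have "inner_on I ?r ?r = inner_on I (\<lambda>_. 0) (\<lambda>_. 0)" by (rule inner_on_cong) (simp_all add: assms(3)[symmetric])
  then have "inner_on I ?r ?r = 0" by (simp add: inner_on_def)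
  then have "inner_on I f f = of_real (\<Sum>j\<in>J. (cmod (inner_on I f (e j)))\<^sup>2)"
    using orthonormal_on_residual(2)[OF assms(1,2), of f] by simp
  then show ?thesis unfolding inner_on_self by (simp only: of_real_eq_iff)
qed

text \<open>Dimension count without vector spaces: sum \<open>\<bar>\<langle>e\<^sub>j, b\<^sub>k\<rangle>\<bar>\<^sup>2\<close> over all pairs. Parseval's identity evaluates the sum to
the size of the first family, and Bessel's inequality bounds it by the size of the second.\<close>

lemma orthonormal_on_card_le:
  assumes "finite J" "finite K" and e: "orthonormal_on I J e" and b: "orthonormal_on I K b"
    and span: "\<And>j x. j \<in> J \<Longrightarrow> x \<in> I \<Longrightarrow> e j x = (\<Sum>k\<in>K. inner_on I (e j) (b k) * b k x)"
  shows "card J \<le> card K"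
proof -
  have norme: "(\<Sum>x\<in>I. (cmod (e j x))\<^sup>2) = 1" if "j \<in> J" for j
  proof -
    have "complex_of_real (\<Sum>x\<in>I. (cmod (e j x))\<^sup>2) = of_real 1"
      unfolding inner_on_self[symmetric] using that e by (simp add: orthonormal_on_def)
    then show ?thesis by (simp only: of_real_eq_iff)
  qed
  have normb: "(\<Sum>x\<in>I. (cmod (b j x))\<^sup>2) = 1" if "j \<in> K" for j
  proof -
    have "complex_of_real (\<Sum>x\<in>I. (cmod (b j x))\<^sup>2) = of_real 1"
      unfolding inner_on_self[symmetric] using that b by (simp add: orthonormal_on_def)
    then show ?thesis by (simp only: of_real_eq_iff)
  qed
  have "real (card J) = (\<Sum>j\<in>J. \<Sum>k\<in>K. (cmod (inner_on I (e j) (b k)))\<^sup>2)"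
    using parseval[OF assms(2) b span] norme by simp
  also have "\<dots> = (\<Sum>k\<in>K. \<Sum>j\<in>J. (cmod (inner_on I (b k) (e j)))\<^sup>2)"
    by (subst sum.swap) (simp only: cnj_inner_on[of I "b _", symmetric] complex_mod_cnj)
  also have "\<dots> \<le> (\<Sum>k\<in>K. 1)"
    by (rule sum_mono) (metis bessel[OF assms(1) e] normb)
  finally show ?thesis by simp
qed

lemma orthonormal_on_card_le_card:
  assumes "finite I" "finite J" "orthonormal_on I J e"
  shows "card J \<le> card I"
proof (rule orthonormal_on_card_le[OF assms(2,1,3)])
  let ?b = "\<lambda>y x. if x = y then 1 else (0::complex)"
  have inner: "inner_on I f (?b y) = f y" if "y \<in> I" for f y
    using that assms(1) unfolding inner_on_def
    by (simp add: if_distrib[of cnj] if_distrib[of "(*) _"] cong: if_cong)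
  show "orthonormal_on I I ?b" unfolding orthonormal_on_def using inner by auto
  show "e j x = (\<Sum>k\<in>I. inner_on I (e j) (?b k) * ?b k x)" if "j \<in> J" "x \<in> I" for j x
    using that(2) assms(1) by (simp add: inner if_distrib[of "(*) _"] cong: if_cong)
qed

lemma orthonormal_on_extend:
  fixes e :: "nat \<Rightarrow> 'i \<Rightarrow> complex"
  assumes "finite I" "orthonormal_on I {..<k} e"
    and "x \<in> I" "f x \<noteq> (\<Sum>i<k. inner_on I f (e i) * e i x)"
  obtains c where "orthonormal_on I {..<Suc k} (e(k := \<lambda>x. c * (f x - (\<Sum>i<k. inner_on I f (e i) * e i x))))"
proof -
  let ?r = "\<lambda>x. f x - (\<Sum>i<k. inner_on I f (e i) * e i x)"
  define N where "N = (\<Sum>x\<in>I. (cmod (?r x))\<^sup>2)"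
  have "N \<noteq> 0"
    using inner_on_self_eq_0[OF assms(1) _ assms(3), of ?r] assms(4) unfolding inner_on_self N_def[symmetric] by auto
  moreover have "N \<ge> 0" unfolding N_def by (rule sum_nonneg) simp
  ultimately have N: "N > 0" by simp
  define c where "c = complex_of_real (1 / sqrt N)"
  have cc: "c * (cnj c * of_real N) = 1"
  proof -
    have "c * (cnj c * of_real N) = complex_of_real (1 / sqrt N * (1 / sqrt N * N))"
      unfolding c_def by (simp only: complex_cnj_complex_of_real of_real_mult)
    also have "1 / sqrt N * (1 / sqrt N * N) = 1" using N by (simp add: field_simps)
    finally show ?thesis by simp
  qed
  have rr: "inner_on I ?r ?r = of_real N" unfolding inner_on_self N_def ..
  have re: "inner_on I ?r (e i) = 0" if "i < k" for i
    using orthonormal_on_residual(1)[OF finite_lessThan assms(2), of i f] that by simp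
  then have er: "inner_on I (e i) ?r = 0" if "i < k" for i
    using that cnj_inner_on[of I ?r "e i"] by simp
  have "orthonormal_on I {..<Suc k} (e(k := \<lambda>x. c * ?r x))"
    unfolding orthonormal_on_def
  proof (intro ballI)
    fix i j assume "i \<in> {..<Suc k}" "j \<in> {..<Suc k}"
    then consider "i < k" "j < k" | "i < k" "j = k" | "i = k" "j < k" | "i = k" "j = k" by force
    then show "inner_on I ((e(k := \<lambda>x. c * ?r x)) i) ((e(k := \<lambda>x. c * ?r x)) j) = (if i = j then 1 else 0)"
    proof cases
      case 1
      then show ?thesis using assms(2) by (simp add: orthonormal_on_def)
    next
      case 2
      then show ?thesis using er by (simp add: inner_on_scale_right)
    next
      case 3
      then show ?thesis using re by (simp add: inner_on_scale_left)
    next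
      case 4
      then show ?thesis using cc rr by (simp add: inner_on_scale_left inner_on_scale_right)
    qed
  qed
  then show thesis by (rule that)
qed

lemma orthonormal_on_complete:
  fixes e :: "nat \<Rightarrow> 'i \<Rightarrow> complex"
  assumes "finite I" "orthonormal_on I {..<k} e" "card I \<le> k" "x \<in> I"
  shows "f x = (\<Sum>i<k. inner_on I f (e i) * e i x)"
proof (rule ccontr)
  assume "f x \<noteq> (\<Sum>i<k. inner_on I f (e i) * e i x)"
  then obtain e' :: "nat \<Rightarrow> 'i \<Rightarrow> complex" where "orthonormal_on I {..<Suc k} e'"
    using orthonormal_on_extend[OF assms(1,2,4)] by metis
  then have "card {..<Suc k} \<le> card I" by (rule orthonormal_on_card_le_card[OF assms(1) finite_lessThan])
  then show False using assms(3) by simp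
qed

text \<open>An orthonormal family in \<open>Z\<close> of the largest possible size spans \<open>Z\<close>, because a nonzero residual
could be normalised and added to it.\<close>

lemma orthonormal_basis:
  fixes Z :: "('i \<Rightarrow> complex) set"
  assumes fin: "finite I"
    and add: "\<And>f h. f \<in> Z \<Longrightarrow> h \<in> Z \<Longrightarrow> (\<lambda>x. f x + h x) \<in> Z"
    and scale: "\<And>c f. f \<in> Z \<Longrightarrow> (\<lambda>x. c * f x) \<in> Z"
  shows "\<exists>(k::nat) e. orthonormal_on I {..<k} e \<and> (\<forall>i<k. e i \<in> Z) \<and>
    (\<forall>f\<in>Z. \<forall>x\<in>I. f x = (\<Sum>i<k. inner_on I f (e i) * e i x))"
proof -
  define P where "P k \<longleftrightarrow> (\<exists>e. orthonormal_on I {..<k} e \<and> (\<forall>i<k. e i \<in> Z))" for k :: nat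
  have "P 0" unfolding P_def orthonormal_on_def by simp
  have bound: "k \<le> card I" if "P k" for k
    using that orthonormal_on_card_le_card[OF fin finite_lessThan] unfolding P_def by fastforce
  define k where "k = (GREATEST k. P k)"
  have "P k" unfolding k_def by (rule GreatestI_nat[of P 0 "card I"]) (use \<open>P 0\<close> bound in blast)+
  then obtain e where e: "orthonormal_on I {..<k} e" "\<And>i. i < k \<Longrightarrow> e i \<in> Z" unfolding P_def by blast
  have span: "f x = (\<Sum>i<k. inner_on I f (e i) * e i x)" if f: "f \<in> Z" and x: "x \<in> I" for f x
  proof (rule ccontr)
    assume ne: "f x \<noteq> (\<Sum>i<k. inner_on I f (e i) * e i x)"
    obtain c where c: "orthonormal_on I {..<Suc k} (e(k := \<lambda>x. c * (f x - (\<Sum>i<k. inner_on I f (e i) * e i x))))"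
      by (rule orthonormal_on_extend[OF fin e(1) x ne]) (rule that)
    have part: "(\<lambda>x. f x - (\<Sum>i<m. a i * e i x)) \<in> Z" if "m \<le> k" for m and a :: "nat \<Rightarrow> complex"
      using that
    proof (induction m)
      case 0
      then show ?case using f by simp
    next
      case (Suc m)
      have "(\<lambda>x. (f x - (\<Sum>i<m. a i * e i x)) + (- a m) * e m x) \<in> Z"
        using Suc e(2)[of m] by (intro add scale) auto
      then show ?case by (simp add: algebra_simps)
    qed
    have "(\<lambda>x. c * (f x - (\<Sum>i<k. inner_on I f (e i) * e i x))) \<in> Z"
      by (rule scale[OF part[OF order_refl]])
    then have "P (Suc k)" unfolding P_def using c e(2)
      by (intro exI[of _ "e(k := \<lambda>x. c * (f x - (\<Sum>i<k. inner_on I f (e i) * e i x)))"]) (auto simp: less_Suc_eq)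
    then have "Suc k \<le> k" unfolding k_def using bound by (rule Greatest_le_nat)
    then show False by simp
  qed
  show ?thesis using e span by blast
qed

text \<open>Indicator functions of the parts of a partition, normalised to length one. They form an
orthonormal basis of the functions that are constant on the parts.\<close>

definition part_indicator :: "'i set \<Rightarrow> 'i \<Rightarrow> complex"
  where "part_indicator \<kappa> x = (if x \<in> \<kappa> then complex_of_real (1 / sqrt (card \<kappa>)) else 0)"

context
  fixes I :: "'i set" and R :: "'i set set"
  assumes fin: "finite I" and sub: "\<And>\<kappa>. \<kappa> \<in> R \<Longrightarrow> \<kappa> \<subseteq> I" and ne: "\<And>\<kappa>. \<kappa> \<in> R \<Longrightarrow> \<kappa> \<noteq> {}"
    and disj: "\<And>\<kappa> \<kappa>' x. \<kappa> \<in> R \<Longrightarrow> \<kappa>' \<in> R \<Longrightarrow> x \<in> \<kappa> \<Longrightarrow> x \<in> \<kappa>' \<Longrightarrow> \<kappa> = \<kappa>'"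
begin

lemma inner_on_part_indicator:
  assumes \<kappa>: "\<kappa> \<in> R"
  shows "inner_on I f (part_indicator \<kappa>) = (\<Sum>g\<in>\<kappa>. f g) * complex_of_real (1 / sqrt (card \<kappa>))"
proof -
  have "inner_on I f (part_indicator \<kappa>) = (\<Sum>g\<in>I. if g \<in> \<kappa> then f g * complex_of_real (1 / sqrt (card \<kappa>)) else 0)"
    unfolding inner_on_def part_indicator_def by (intro sum.cong) auto
  also have "\<dots> = (\<Sum>g\<in>I \<inter> \<kappa>. f g * complex_of_real (1 / sqrt (card \<kappa>)))"
    by (rule sum.inter_restrict[OF fin, symmetric])
  also have "I \<inter> \<kappa> = \<kappa>" using sub[OF \<kappa>] by blast
  finally show ?thesis by (simp only: sum_distrib_right)
qed

lemma part_weight: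
  assumes \<kappa>: "\<kappa> \<in> R"
  shows "of_nat (card \<kappa>) * complex_of_real (1 / sqrt (card \<kappa>)) * complex_of_real (1 / sqrt (card \<kappa>)) = 1"
proof -
  have "of_nat (card \<kappa>) * complex_of_real (1 / sqrt (card \<kappa>)) * complex_of_real (1 / sqrt (card \<kappa>))
    = complex_of_real (real (card \<kappa>) * (1 / sqrt (card \<kappa>)) * (1 / sqrt (card \<kappa>)))"
    by (simp only: of_real_mult of_real_of_nat_eq)
  also have "real (card \<kappa>) * (1 / sqrt (card \<kappa>)) * (1 / sqrt (card \<kappa>)) = 1"
    using ne[OF \<kappa>] finite_subset[OF sub[OF \<kappa>] fin] by (simp add: field_simps)
  finally show ?thesis by (simp only: of_real_1)
qed

lemma part_indicators_orthonormal: "orthonormal_on I R part_indicator"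
  unfolding orthonormal_on_def
proof (intro ballI)
  fix \<kappa> \<kappa>' assume \<kappa>: "\<kappa> \<in> R" "\<kappa>' \<in> R"
  show "inner_on I (part_indicator \<kappa>) (part_indicator \<kappa>') = (if \<kappa> = \<kappa>' then 1 else 0)"
  proof (cases "\<kappa> = \<kappa>'")
    case True
    have "(\<Sum>g\<in>\<kappa>. part_indicator \<kappa> g) = (\<Sum>g\<in>\<kappa>. complex_of_real (1 / sqrt (card \<kappa>)))"
      by (rule sum.cong[OF refl]) (simp add: part_indicator_def)
    then have "inner_on I (part_indicator \<kappa>) (part_indicator \<kappa>) = 1"
      unfolding inner_on_part_indicator[OF \<kappa>(1)] using part_weight[OF \<kappa>(1)] by (simp only: sum_constant)
    then show ?thesis using True by simp
  next
    case False
    have "part_indicator \<kappa> g = 0" if "g \<in> \<kappa>'" for g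
    proof -
      have "g \<notin> \<kappa>" using disj[OF \<kappa> _ that] False by blast
      then show ?thesis by (simp add: part_indicator_def)
    qed
    then show ?thesis unfolding inner_on_part_indicator[OF \<kappa>(2)] using False by simp
  qed
qed

lemma part_indicator_expansion:
  assumes finR: "finite R" and K: "K \<in> R" "x \<in> K" and f: "\<And>g. g \<in> K \<Longrightarrow> f g = f x"
  shows "f x = (\<Sum>\<kappa>\<in>R. inner_on I f (part_indicator \<kappa>) * part_indicator \<kappa> x)"
proof -
  let ?w = "complex_of_real (1 / sqrt (card K))"
  have "(\<Sum>\<kappa>\<in>R. inner_on I f (part_indicator \<kappa>) * part_indicator \<kappa> x)
      = (\<Sum>\<kappa>\<in>R. if \<kappa> = K then inner_on I f (part_indicator K) * part_indicator K x else 0)"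
  proof (rule sum.cong[OF refl])
    fix \<kappa> assume "\<kappa> \<in> R"
    then have "\<kappa> \<noteq> K \<Longrightarrow> x \<notin> \<kappa>" using disj[OF _ K(1) _ K(2)] by blast
    then show "inner_on I f (part_indicator \<kappa>) * part_indicator \<kappa> x
        = (if \<kappa> = K then inner_on I f (part_indicator K) * part_indicator K x else 0)"
      by (cases "\<kappa> = K") (simp_all add: part_indicator_def)
  qed
  also have "\<dots> = inner_on I f (part_indicator K) * part_indicator K x" using finR K(1) by simp
  also have "\<dots> = (\<Sum>g\<in>K. f g) * ?w * ?w"
    unfolding inner_on_part_indicator[OF K(1)] using K(2) by (simp only: part_indicator_def if_True)
  also have "(\<Sum>g\<in>K. f g) = of_nat (card K) * f x" using f by simp
  also have "of_nat (card K) * f x * ?w * ?w = f x * (of_nat (card K) * ?w * ?w)" by (simp only: mult_ac)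
  finally show ?thesis unfolding part_weight[OF K(1)] by simp
qed

end

section \<open>Complex matrices\<close>

lemma index_mult_mat_sum:
  assumes "A \<in> carrier_mat m k" "B \<in> carrier_mat k n" "i < m" "j < n"
  shows "(A * B) $$ (i, j) = (\<Sum>p<k. A $$ (i, p) * B $$ (p, j))"
  using assms by (simp add: scalar_prod_def atLeast0LessThan)

lemma index_mult_mat_vec_sum:
  assumes "A \<in> carrier_mat m k" "v \<in> carrier_vec k" "i < m"
  shows "(A *\<^sub>v v) $ i = (\<Sum>p<k. A $$ (i, p) * v $ p)"
  using assms by (simp add: scalar_prod_def atLeast0LessThan)

lemma mat_adjoint_carrier [simp]: "A \<in> carrier_mat m n \<Longrightarrow> mat_adjoint A \<in> carrier_mat n m"
  by (auto intro!: carrier_matI)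

lemma index_mat_adjoint_cnj:
  fixes A :: "complex mat"
  assumes "A \<in> carrier_mat m n" "i < n" "j < m"
  shows "mat_adjoint A $$ (i, j) = cnj (A $$ (j, i))"
  using assms index_mat_adjoint[of i A j] by simp

lemma mat_adjoint_mult_gen:
  fixes A B :: "complex mat"
  assumes "A \<in> carrier_mat m k" "B \<in> carrier_mat k n"
  shows "mat_adjoint (A * B) = mat_adjoint B * mat_adjoint A"
proof (rule eq_matI)
  have AB: "A * B \<in> carrier_mat m n" using assms by simp
  fix i j assume "i < dim_row (mat_adjoint B * mat_adjoint A)" "j < dim_col (mat_adjoint B * mat_adjoint A)"
  then have ij: "i < n" "j < m" using assms by auto
  show "mat_adjoint (A * B) $$ (i, j) = (mat_adjoint B * mat_adjoint A) $$ (i, j)"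
    unfolding index_mat_adjoint_cnj[OF AB ij]
      index_mult_mat_sum[OF mat_adjoint_carrier[OF assms(2)] mat_adjoint_carrier[OF assms(1)] ij]
      index_mult_mat_sum[OF assms ij(2,1)]
    using ij by (simp add: index_mat_adjoint_cnj[OF assms(1)] index_mat_adjoint_cnj[OF assms(2)] mult.commute)
qed (use assms in auto)

lemma mat_adjoint_adjoint: "mat_adjoint (mat_adjoint A) = (A :: complex mat)"
  by (intro eq_matI) (auto simp: index_mat_adjoint)

lemma subspace_vec_iff:
  "subspace class_ring W (module_vec TYPE(complex) n) \<longleftrightarrow>
    W \<subseteq> carrier_vec n \<and> 0\<^sub>v n \<in> W \<and> (\<forall>v\<in>W. \<forall>w\<in>W. v + w \<in> W) \<and> (\<forall>c. \<forall>v\<in>W. c \<cdot>\<^sub>v v \<in> W)"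
proof -
  interpret V: vec_space "TYPE(complex)" n .
  have iff: "subspace class_ring W V.V \<longleftrightarrow> submodule class_ring W V.V"
    using VectorSpace.subspace_def V.vectorspace_axioms by blast
  show ?thesis unfolding iff submodule_def
    using V.module_axioms by (simp add: module_vec_simps) blast
qed

section \<open>Schur's lemma and the orthogonality relations\<close>

lemma unitary_group_simps:
  "U \<in> carrier (unitary_group n) \<longleftrightarrow>
    U \<in> carrier_mat n n \<and> U * mat_adjoint U = 1\<^sub>m n \<and> mat_adjoint U * U = 1\<^sub>m n"
  "x \<otimes>\<^bsub>unitary_group n\<^esub> y = x * y" "\<one>\<^bsub>unitary_group n\<^esub> = 1\<^sub>m n"
  by (auto simp: unitary_group_def)

lemma unitary_groupI:
  assumes "U \<in> carrier_mat n n" "mat_adjoint U * U = 1\<^sub>m n"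
  shows "U \<in> carrier (unitary_group n)"
  using assms mat_mult_left_right_inverse[OF mat_adjoint_carrier[OF assms(1)] assms(1,2)]
  by (simp add: unitary_group_simps)

context group
begin

context
  fixes n \<rho> assumes rep: "unitary_rep G n \<rho>"
begin

lemma rep_unitary: "g \<in> carrier G \<Longrightarrow> \<rho> g \<in> carrier (unitary_group n)"
  using rep by (auto simp: unitary_rep_def hom_def)

lemma rep_carrier: "g \<in> carrier G \<Longrightarrow> \<rho> g \<in> carrier_mat n n"
  using rep_unitary by (simp add: unitary_group_simps)

lemma rep_mult: "g \<in> carrier G \<Longrightarrow> h \<in> carrier G \<Longrightarrow> \<rho> (g \<otimes> h) = \<rho> g * \<rho> h"
  using rep by (simp add: unitary_rep_def hom_def unitary_group_simps)

lemma rep_one: "\<rho> \<one> = 1\<^sub>m n"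
  using hom_one[OF rep[unfolded unitary_rep_def] is_group group_unitary_group]
  by (simp add: unitary_group_simps)

lemma rep_inv: "g \<in> carrier G \<Longrightarrow> \<rho> (inv g) = mat_adjoint (\<rho> g)"
proof -
  assume g: "g \<in> carrier G"
  have c: "\<rho> g \<in> carrier_mat n n" "\<rho> (inv g) \<in> carrier_mat n n" "mat_adjoint (\<rho> g) \<in> carrier_mat n n"
    using rep_carrier g by auto
  have "\<rho> (inv g) = \<rho> (inv g) * (\<rho> g * mat_adjoint (\<rho> g))"
    using rep_unitary[OF g] c by (simp add: unitary_group_simps)
  also have "\<dots> = \<rho> (inv g) * \<rho> g * mat_adjoint (\<rho> g)"
    using c by (simp add: assoc_mult_mat[of _ n n _ n _ n])
  also have "\<rho> (inv g) * \<rho> g = 1\<^sub>m n" using rep_mult[of "inv g" g] g rep_one by simp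
  finally show ?thesis using c by simp
qed

lemma index_rep_mult:
  assumes "g \<in> carrier G" "h \<in> carrier G" "i < n" "j < n"
  shows "\<rho> (g \<otimes> h) $$ (i, j) = (\<Sum>p<n. \<rho> g $$ (i, p) * \<rho> h $$ (p, j))"
  using rep_mult[OF assms(1,2)] index_mult_mat_sum[OF rep_carrier rep_carrier, OF assms] by simp

lemma index_rep_inv:
  assumes "g \<in> carrier G" "i < n" "j < n"
  shows "\<rho> (inv g) $$ (i, j) = cnj (\<rho> g $$ (j, i))"
  unfolding rep_inv[OF assms(1)] by (rule index_mat_adjoint_cnj[OF rep_carrier[OF assms(1)] assms(2,3)])

end

lemma unitary_rep_comp_hom:
  assumes "\<phi> \<in> hom H G" "unitary_rep G n \<rho>"
  shows "unitary_rep H n (\<rho> \<circ> \<phi>)"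
  using Group.hom_compose[OF assms(1), of \<rho> "unitary_group n"] assms(2) by (simp add: unitary_rep_def)

text \<open>An eigenspace of \<open>B\<close> is a nonzero invariant subspace, hence everything.\<close>

lemma schur_scalar:
  assumes irr: "irreducible_unitary_rep G n \<rho>" and B: "B \<in> carrier_mat n n"
    and comm: "\<And>g. g \<in> carrier G \<Longrightarrow> B * \<rho> g = \<rho> g * B"
  obtains c where "B = c \<cdot>\<^sub>m 1\<^sub>m n"
proof -
  have rep: "unitary_rep G n \<rho>" and n: "0 < n"
    and inv: "\<And>W. subspace class_ring W (module_vec TYPE(complex) n) \<Longrightarrow>
      \<forall>g \<in> carrier G. \<forall>v \<in> W. \<rho> g *\<^sub>v v \<in> W \<Longrightarrow> W = {0\<^sub>v n} \<or> W = carrier_vec n"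
    using irr unfolding irreducible_unitary_rep_def by blast+
  obtain c where "eigenvalue B c" using spectrum_non_empty[OF B n] unfolding spectrum_def by blast
  then obtain v where v: "v \<in> carrier_vec n" "v \<noteq> 0\<^sub>v n" "B *\<^sub>v v = c \<cdot>\<^sub>v v"
    using B unfolding eigenvalue_def eigenvector_def by auto
  define W where "W = {v \<in> carrier_vec n. B *\<^sub>v v = c \<cdot>\<^sub>v v}"
  have "W = {0\<^sub>v n} \<or> W = carrier_vec n"
  proof (rule inv)
    show "subspace class_ring W (module_vec TYPE(complex) n)"
      unfolding subspace_vec_iff W_def
    proof (intro conjI ballI allI)
      show "0\<^sub>v n \<in> {v \<in> carrier_vec n. B *\<^sub>v v = c \<cdot>\<^sub>v v}" using B by auto
    next
      fix v w assume "v \<in> {v \<in> carrier_vec n. B *\<^sub>v v = c \<cdot>\<^sub>v v}" "w \<in> {v \<in> carrier_vec n. B *\<^sub>v v = c \<cdot>\<^sub>v v}"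
      then show "v + w \<in> {v \<in> carrier_vec n. B *\<^sub>v v = c \<cdot>\<^sub>v v}"
        using B by (auto simp: mult_add_distrib_mat_vec[of _ n n] smult_add_distrib_vec[of _ n])
    next
      fix a v assume "v \<in> {v \<in> carrier_vec n. B *\<^sub>v v = c \<cdot>\<^sub>v v}"
      then show "a \<cdot>\<^sub>v v \<in> {v \<in> carrier_vec n. B *\<^sub>v v = c \<cdot>\<^sub>v v}"
        using B by (auto simp: mult_mat_vec[of _ n n] smult_smult_assoc mult.commute)
    qed auto
    show "\<forall>g \<in> carrier G. \<forall>v \<in> W. \<rho> g *\<^sub>v v \<in> W"
    proof (intro ballI)
      fix g v assume g: "g \<in> carrier G" and v: "v \<in> W"
      have rc: "\<rho> g \<in> carrier_mat n n" by (rule rep_carrier[OF rep g])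
      have vc: "v \<in> carrier_vec n" "B *\<^sub>v v = c \<cdot>\<^sub>v v" using v unfolding W_def by auto
      have "B *\<^sub>v (\<rho> g *\<^sub>v v) = (B * \<rho> g) *\<^sub>v v" using assoc_mult_mat_vec[OF B rc vc(1)] by simp
      also have "\<dots> = \<rho> g *\<^sub>v (B *\<^sub>v v)" unfolding comm[OF g] by (rule assoc_mult_mat_vec[OF rc B vc(1)])
      also have "\<dots> = c \<cdot>\<^sub>v (\<rho> g *\<^sub>v v)" unfolding vc(2) by (rule mult_mat_vec[OF rc vc(1)])
      finally show "\<rho> g *\<^sub>v v \<in> W" unfolding W_def using rc vc by auto
    qed
  qed
  moreover have "v \<in> W" unfolding W_def using v by simp
  ultimately have W: "W = carrier_vec n" using v(2) by auto
  have "B = c \<cdot>\<^sub>m 1\<^sub>m n"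
  proof (rule eq_matI)
    fix i j assume "i < dim_row (c \<cdot>\<^sub>m 1\<^sub>m n)" "j < dim_col (c \<cdot>\<^sub>m 1\<^sub>m n)"
    then have ij: "i < n" "j < n" by auto
    have "unit_vec n j \<in> W" unfolding W by simp
    then have "B *\<^sub>v unit_vec n j = c \<cdot>\<^sub>v unit_vec n j" unfolding W_def by simp
    then have "(B *\<^sub>v unit_vec n j) $ i = (c \<cdot>\<^sub>v unit_vec n j) $ i" by simp
    then show "B $$ (i, j) = (c \<cdot>\<^sub>m 1\<^sub>m n) $$ (i, j)"
      using B ij by simp
  qed (use B in auto)
  then show thesis by (rule that)
qed

lemma intertwiner_adjoint:
  assumes \<rho>: "unitary_rep G n \<rho>" and \<sigma>: "unitary_rep G m \<sigma>" and A: "A \<in> carrier_mat m n"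
    and tw: "\<And>g. g \<in> carrier G \<Longrightarrow> A * \<rho> g = \<sigma> g * A" and g: "g \<in> carrier G"
  shows "mat_adjoint A * \<sigma> g = \<rho> g * mat_adjoint A"
proof -
  have ig: "inv g \<in> carrier G" using g by simp
  have "mat_adjoint (A * \<rho> (inv g)) = mat_adjoint (\<sigma> (inv g) * A)" using tw[OF ig] by simp
  then have "mat_adjoint (\<rho> (inv g)) * mat_adjoint A = mat_adjoint A * mat_adjoint (\<sigma> (inv g))"
    using mat_adjoint_mult_gen[OF A rep_carrier[OF \<rho> ig]] mat_adjoint_mult_gen[OF rep_carrier[OF \<sigma> ig] A] by simp
  then show ?thesis using rep_inv[OF \<rho> g] rep_inv[OF \<sigma> g] by (simp add: mat_adjoint_adjoint)
qed

end

lemma adjoint_mult_diag: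
  fixes A :: "complex mat"
  assumes "A \<in> carrier_mat m n" "j < n"
  shows "(mat_adjoint A * A) $$ (j, j) = of_real (\<Sum>i<m. (cmod (A $$ (i, j)))\<^sup>2)"
  unfolding index_mult_mat_sum[OF mat_adjoint_carrier[OF assms(1)] assms(1,2,2)]
  using assms by (simp add: index_mat_adjoint_cnj[OF assms(1)] complex_norm_square mult.commute del: of_real_power)

lemma adjoint_mult_scalar_pos:
  fixes A :: "complex mat"
  assumes A: "A \<in> carrier_mat m n" "A \<noteq> 0\<^sub>m m n" and c: "mat_adjoint A * A = c \<cdot>\<^sub>m 1\<^sub>m n"
  obtains r where "r > 0" "c = complex_of_real r" "(\<Sum>j<n. \<Sum>i<m. (cmod (A $$ (i, j)))\<^sup>2) = real n * r"
proof -
  have c_eq: "c = of_real (\<Sum>i<m. (cmod (A $$ (i, j)))\<^sup>2)" if "j < n" for j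
    using adjoint_mult_diag[OF A(1) that] that by (simp add: c)
  obtain i0 j0 where ij: "i0 < m" "j0 < n" "A $$ (i0, j0) \<noteq> 0"
  proof -
    have "\<exists>i j. i < m \<and> j < n \<and> A $$ (i, j) \<noteq> 0"
    proof (rule ccontr)
      assume "\<not> ?thesis"
      then have "A = 0\<^sub>m m n" using A(1) by (intro eq_matI) auto
      then show False using A(2) by simp
    qed
    then show thesis using that by blast
  qed
  define r where "r = (\<Sum>i<m. (cmod (A $$ (i, j0)))\<^sup>2)"
  have "0 < (cmod (A $$ (i0, j0)))\<^sup>2" using ij by simp
  also have "\<dots> \<le> r" unfolding r_def
    by (rule member_le_sum[of i0 _ "\<lambda>i. (cmod (A $$ (i, j0)))\<^sup>2"]) (use ij in auto)
  finally have r: "r > 0" .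
  have cr: "c = of_real r" unfolding r_def using c_eq[OF ij(2)] .
  have "(\<Sum>i<m. (cmod (A $$ (i, j)))\<^sup>2) = r" if "j < n" for j
    using c_eq[OF that] cr by (simp only: of_real_eq_iff)
  then have "(\<Sum>j<n. \<Sum>i<m. (cmod (A $$ (i, j)))\<^sup>2) = real n * r" by simp
  then show thesis using that[OF r cr] by blast
qed

lemma mat_adjoint_smult: "mat_adjoint (c \<cdot>\<^sub>m A) = cnj c \<cdot>\<^sub>m mat_adjoint (A :: complex mat)"
  by (intro eq_matI) (auto simp: index_mat_adjoint)

lemma unitary_normalisation:
  fixes A :: "complex mat"
  assumes A: "A \<in> carrier_mat n n" and r: "r > 0" "mat_adjoint A * A = complex_of_real r \<cdot>\<^sub>m 1\<^sub>m n"
  shows "complex_of_real (1 / sqrt r) \<cdot>\<^sub>m A \<in> carrier (unitary_group n)"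
proof (rule unitary_groupI)
  let ?s = "complex_of_real (1 / sqrt r)"
  have "mat_adjoint (?s \<cdot>\<^sub>m A) * (?s \<cdot>\<^sub>m A) = ?s \<cdot>\<^sub>m (?s \<cdot>\<^sub>m (mat_adjoint A * A))"
    using mult_smult_distrib[OF smult_carrier_mat[OF mat_adjoint_carrier[OF A]] A]
      mult_smult_assoc_mat[OF mat_adjoint_carrier[OF A] A]
    by (simp add: mat_adjoint_smult)
  also have "\<dots> = (?s * ?s * of_real r) \<cdot>\<^sub>m 1\<^sub>m n"
  proof -
    have "a \<cdot>\<^sub>m (b \<cdot>\<^sub>m M) = (a * b) \<cdot>\<^sub>m M" for a b and M :: "complex mat" by (intro eq_matI) auto
    then show ?thesis unfolding r(2) by (simp only: mult.assoc)
  qed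
  also have "?s * ?s * of_real r = complex_of_real (1 / sqrt r * (1 / sqrt r) * r)"
    by (simp only: of_real_mult)
  also have "1 / sqrt r * (1 / sqrt r) * r = 1" using r(1) by (simp add: field_simps)
  finally show "mat_adjoint (?s \<cdot>\<^sub>m A) * (?s \<cdot>\<^sub>m A) = 1\<^sub>m n" by auto
qed (use A in simp)

context group
begin

text \<open>The matrix \<open>A\<^sup>* A\<close> commutes with \<open>\<rho>\<close>, so it is a scalar, and its diagonal entries are
squared norms of columns. The last equation reads off its trace.\<close>

lemma intertwiner_adjoint_mult_scalar:
  assumes irr: "irreducible_unitary_rep G n \<rho>" and \<sigma>: "unitary_rep G m \<sigma>"
    and A: "A \<in> carrier_mat m n" "A \<noteq> 0\<^sub>m m n"
    and tw: "\<And>g. g \<in> carrier G \<Longrightarrow> A * \<rho> g = \<sigma> g * A"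
  obtains r where "r > 0" "mat_adjoint A * A = complex_of_real r \<cdot>\<^sub>m 1\<^sub>m n"
    "(\<Sum>j<n. \<Sum>i<m. (cmod (A $$ (i, j)))\<^sup>2) = real n * r"
proof -
  have \<rho>: "unitary_rep G n \<rho>" using irr unfolding irreducible_unitary_rep_def by blast
  have A': "mat_adjoint A \<in> carrier_mat n m" using A(1) by simp
  have "mat_adjoint A * A * \<rho> g = \<rho> g * (mat_adjoint A * A)" if g: "g \<in> carrier G" for g
  proof -
    have c: "\<rho> g \<in> carrier_mat n n" "\<sigma> g \<in> carrier_mat m m"
      using rep_carrier[OF \<rho> g] rep_carrier[OF \<sigma> g] by auto
    have "mat_adjoint A * A * \<rho> g = mat_adjoint A * (\<sigma> g * A)"
      using assoc_mult_mat[OF A' A(1) c(1)] tw[OF g] by simp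
    also have "\<dots> = \<rho> g * mat_adjoint A * A"
      using assoc_mult_mat[OF A' c(2) A(1)] intertwiner_adjoint[OF \<rho> \<sigma> A(1) tw g] by simp
    also have "\<dots> = \<rho> g * (mat_adjoint A * A)" by (rule assoc_mult_mat[OF c(1) A' A(1)])
    finally show ?thesis .
  qed
  moreover have "mat_adjoint A * A \<in> carrier_mat n n" by (rule mult_carrier_mat[OF A' A(1)])
  ultimately obtain c where c: "mat_adjoint A * A = c \<cdot>\<^sub>m 1\<^sub>m n" using schur_scalar[OF irr] by metis
  obtain r where "r > 0" "c = complex_of_real r" "(\<Sum>j<n. \<Sum>i<m. (cmod (A $$ (i, j)))\<^sup>2) = real n * r"
    by (rule adjoint_mult_scalar_pos[OF A c])
  then show thesis using that c by blast
qed

text \<open>The form with a possibly reducible \<open>\<sigma>\<close> of the same dimension is the one that applies to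
\<open>\<sigma> = \<rho> \<circ> \<phi>\<close>. By the preceding lemma a multiple of \<open>A\<close> is unitary.\<close>

lemma equiv_if_intertwiner:
  assumes irr: "irreducible_unitary_rep G n \<rho>" and \<sigma>: "unitary_rep G n \<sigma>"
    and A: "A \<in> carrier_mat n n" "A \<noteq> 0\<^sub>m n n"
    and tw: "\<And>g. g \<in> carrier G \<Longrightarrow> A * \<rho> g = \<sigma> g * A"
  shows "(\<rho>, \<sigma>) \<in> unitary_equiv G"
proof -
  have \<rho>: "unitary_rep G n \<rho>" using irr unfolding irreducible_unitary_rep_def by blast
  obtain r where r: "r > 0" "mat_adjoint A * A = complex_of_real r \<cdot>\<^sub>m 1\<^sub>m n"
    by (rule intertwiner_adjoint_mult_scalar[OF irr \<sigma> A tw])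
  let ?s = "complex_of_real (1 / sqrt r)"
  show ?thesis
  proof (rule unitary_equivI[OF \<rho> \<sigma> unitary_normalisation[OF A(1) r]])
    fix g assume g: "g \<in> carrier G"
    show "?s \<cdot>\<^sub>m A * \<rho> g = \<sigma> g * (?s \<cdot>\<^sub>m A)"
      using mult_smult_distrib[OF rep_carrier[OF \<sigma> g] A(1), of ?s]
        mult_smult_assoc_mat[OF A(1) rep_carrier[OF \<rho> g], of ?s] tw[OF g] by simp
  qed
qed

text \<open>Both \<open>A\<^sup>* A\<close> and \<open>A A\<^sup>*\<close> are scalars. Associativity of \<open>A A\<^sup>* A\<close> shows that the scalars are
equal, and then equality of the two traces gives equal dimensions.\<close>

lemma intertwiner_dim_eq:
  assumes irr: "irreducible_unitary_rep G n \<rho>" and irr': "irreducible_unitary_rep G m \<sigma>"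
    and A: "A \<in> carrier_mat m n" "A \<noteq> 0\<^sub>m m n"
    and tw: "\<And>g. g \<in> carrier G \<Longrightarrow> A * \<rho> g = \<sigma> g * A"
  shows "m = n"
proof -
  have \<rho>: "unitary_rep G n \<rho>" and \<sigma>: "unitary_rep G m \<sigma>" using irr irr' unfolding irreducible_unitary_rep_def by blast+
  have A': "mat_adjoint A \<in> carrier_mat n m" using A(1) by simp
  have A'0: "mat_adjoint A \<noteq> 0\<^sub>m n m"
  proof
    assume "mat_adjoint A = 0\<^sub>m n m"
    then have "mat_adjoint (mat_adjoint A) = 0\<^sub>m m n" by (intro eq_matI) (auto simp: index_mat_adjoint)
    then show False using A(2) by (simp add: mat_adjoint_adjoint)
  qed
  obtain r where r: "r > 0" "mat_adjoint A * A = complex_of_real r \<cdot>\<^sub>m 1\<^sub>m n"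
    "(\<Sum>j<n. \<Sum>i<m. (cmod (A $$ (i, j)))\<^sup>2) = real n * r"
    by (rule intertwiner_adjoint_mult_scalar[OF irr \<sigma> A tw])
  obtain s where s: "s > 0" "mat_adjoint (mat_adjoint A) * mat_adjoint A = complex_of_real s \<cdot>\<^sub>m 1\<^sub>m m"
    "(\<Sum>j<m. \<Sum>i<n. (cmod (mat_adjoint A $$ (i, j)))\<^sup>2) = real m * s"
    by (rule intertwiner_adjoint_mult_scalar[OF irr' \<rho> A' A'0 intertwiner_adjoint[OF \<rho> \<sigma> A(1) tw]])
  have "of_real s \<cdot>\<^sub>m A = A * mat_adjoint A * A"
    using s(2) A(1) mult_smult_assoc_mat[of "1\<^sub>m m" m m A n "of_real s"] by (simp add: mat_adjoint_adjoint)
  also have "\<dots> = A * (mat_adjoint A * A)" by (rule assoc_mult_mat[OF A(1) A' A(1)])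
  also have "\<dots> = of_real r \<cdot>\<^sub>m A"
    using r(2) A(1) mult_smult_distrib[of A m n "1\<^sub>m n" n "of_real r"] by simp
  finally have eq: "of_real s \<cdot>\<^sub>m A = of_real r \<cdot>\<^sub>m A" .
  have "s = r"
  proof (rule ccontr)
    assume "s \<noteq> r"
    have "A $$ (i, j) = 0" if "i < m" "j < n" for i j
    proof -
      have "(of_real s \<cdot>\<^sub>m A) $$ (i, j) = (of_real r \<cdot>\<^sub>m A) $$ (i, j)" using eq by simp
      then show ?thesis using that A(1) \<open>s \<noteq> r\<close> by auto
    qed
    then have "A = 0\<^sub>m m n" using A(1) by (intro eq_matI) auto
    then show False using A(2) by simp
  qed
  have "(\<Sum>j<m. \<Sum>i<n. (cmod (mat_adjoint A $$ (i, j)))\<^sup>2) = (\<Sum>j<m. \<Sum>i<n. (cmod (A $$ (j, i)))\<^sup>2)"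
    using index_mat_adjoint_cnj[OF A(1)] by simp
  also have "\<dots> = (\<Sum>j<n. \<Sum>i<m. (cmod (A $$ (i, j)))\<^sup>2)" by (rule sum.swap)
  finally have "real m * s = real n * r" using s(3) r(3) by simp
  then show ?thesis using \<open>s = r\<close> r(1) by simp
qed

subsection \<open>Averaging over a finite group\<close>

lemma sum_translate_left:
  assumes "h \<in> carrier G"
  shows "(\<Sum>g\<in>carrier G. f (h \<otimes> g)) = (\<Sum>g\<in>carrier G. f g)"
proof (rule sum.reindex_bij_witness[of _ "\<lambda>g. inv h \<otimes> g" "\<lambda>g. h \<otimes> g"])
qed (use assms in auto)

lemma sum_translate_right:
  assumes "h \<in> carrier G"
  shows "(\<Sum>g\<in>carrier G. f (g \<otimes> h)) = (\<Sum>g\<in>carrier G. f g)"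
proof (rule sum.reindex_bij_witness[of _ "\<lambda>g. g \<otimes> inv h" "\<lambda>g. g \<otimes> h"])
qed (use assms in \<open>auto simp: m_assoc\<close>)

text \<open>This is \<open>\<Sum>g. \<rho>(g) E \<sigma>(g)\<^sup>*\<close>, the unnormalised average over the group of the matrix unit \<open>E\<close> in
position \<open>(i, k)\<close>. Its entries are inner products of matrix coefficients.\<close>

definition coefficient_sum :: "nat \<Rightarrow> nat \<Rightarrow> ('a \<Rightarrow> complex mat) \<Rightarrow> ('a \<Rightarrow> complex mat) \<Rightarrow> nat \<Rightarrow> nat \<Rightarrow> complex mat"
  where "coefficient_sum n m \<rho> \<sigma> i k =
    mat n m (\<lambda>(j, l). \<Sum>g\<in>carrier G. \<rho> g $$ (j, i) * cnj (\<sigma> g $$ (l, k)))"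

lemma coefficient_sum_carrier [simp]: "coefficient_sum n m \<rho> \<sigma> i k \<in> carrier_mat n m"
  by (simp add: coefficient_sum_def)

lemma coefficient_sum_intertwines:
  assumes \<rho>: "unitary_rep G n \<rho>" and \<sigma>: "unitary_rep G m \<sigma>" and ik: "i < n" "k < m" and h: "h \<in> carrier G"
  shows "coefficient_sum n m \<rho> \<sigma> i k * \<sigma> h = \<rho> h * coefficient_sum n m \<rho> \<sigma> i k"
proof (rule eq_matI)
  let ?C = "coefficient_sum n m \<rho> \<sigma> i k"
  have cC: "?C \<in> carrier_mat n m" by simp
  fix j l assume "j < dim_row (\<rho> h * ?C)" "l < dim_col (\<rho> h * ?C)"
  then have jl: "j < n" "l < m" using rep_carrier[OF \<rho> h] by (auto simp: coefficient_sum_def)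
  have "(?C * \<sigma> h) $$ (j, l) = (\<Sum>p<m. \<Sum>g\<in>carrier G. \<rho> g $$ (j, i) * cnj (\<sigma> g $$ (p, k)) * \<sigma> h $$ (p, l))"
    unfolding index_mult_mat_sum[OF cC rep_carrier[OF \<sigma> h] jl]
    using jl by (simp add: coefficient_sum_def sum_distrib_right)
  also have "\<dots> = (\<Sum>g\<in>carrier G. \<rho> g $$ (j, i) * cnj (\<Sum>p<m. \<sigma> (inv h) $$ (l, p) * \<sigma> g $$ (p, k)))"
    using jl by (subst sum.swap) (simp add: sum_distrib_left index_rep_inv[OF \<sigma> h] mult_ac)
  also have "\<dots> = (\<Sum>g\<in>carrier G. \<rho> g $$ (j, i) * cnj (\<sigma> (inv h \<otimes> g) $$ (l, k)))"
    using h jl ik by (intro sum.cong refl) (simp add: index_rep_mult[OF \<sigma>])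
  also have "\<dots> = (\<Sum>g\<in>carrier G. \<rho> (h \<otimes> g) $$ (j, i) * cnj (\<sigma> (inv h \<otimes> (h \<otimes> g)) $$ (l, k)))"
    by (rule sum_translate_left[OF h, symmetric])
  also have "\<dots> = (\<Sum>g\<in>carrier G. \<Sum>p<n. \<rho> h $$ (j, p) * \<rho> g $$ (p, i) * cnj (\<sigma> g $$ (l, k)))"
    using h jl ik by (intro sum.cong refl) (simp add: index_rep_mult[OF \<rho>] sum_distrib_right)
  also have "\<dots> = (\<Sum>p<n. \<rho> h $$ (j, p) * (\<Sum>g\<in>carrier G. \<rho> g $$ (p, i) * cnj (\<sigma> g $$ (l, k))))"
    by (subst sum.swap) (simp add: sum_distrib_left mult.assoc)
  also have "\<dots> = (\<rho> h * ?C) $$ (j, l)"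
    unfolding index_mult_mat_sum[OF rep_carrier[OF \<rho> h] cC jl]
    using jl by (simp add: coefficient_sum_def)
  finally show "(?C * \<sigma> h) $$ (j, l) = (\<rho> h * ?C) $$ (j, l)" .
qed (use rep_carrier[OF \<rho> h] rep_carrier[OF \<sigma> h] in \<open>auto simp: coefficient_sum_def\<close>)

lemma schur_orthogonality_inequivalent:
  assumes irr: "irreducible_unitary_rep G n \<rho>" and irr': "irreducible_unitary_rep G m \<sigma>"
    and ineq: "(\<sigma>, \<rho>) \<notin> unitary_equiv G" and "i < n" "j < n" "k < m" "l < m"
  shows "(\<Sum>g\<in>carrier G. \<rho> g $$ (j, i) * cnj (\<sigma> g $$ (l, k))) = 0"
proof -
  let ?C = "coefficient_sum n m \<rho> \<sigma> i k"
  have \<rho>: "unitary_rep G n \<rho>" and \<sigma>: "unitary_rep G m \<sigma>" using irr irr' unfolding irreducible_unitary_rep_def by blast+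
  note tw = coefficient_sum_intertwines[OF \<rho> \<sigma> assms(4,6)]
  have "?C = 0\<^sub>m n m"
  proof (rule ccontr)
    assume ne: "?C \<noteq> 0\<^sub>m n m"
    have [simp]: "n = m" by (rule intertwiner_dim_eq[OF irr' irr coefficient_sum_carrier ne tw])
    show False using equiv_if_intertwiner[OF irr', of \<rho> ?C] \<rho> ne tw ineq by simp
  qed
  then have "?C $$ (j, l) = 0" using assms(5,7) by simp
  then show ?thesis using assms(5,7) by (simp add: coefficient_sum_def)
qed

text \<open>The scalar by which \<open>coefficient_sum\<close> acts is found from its trace.\<close>

lemma schur_orthogonality_same:
  assumes fin: "finite (carrier G)" and irr: "irreducible_unitary_rep G n \<rho>" and "i < n" "j < n" "k < n" "l < n"
  shows "(\<Sum>g\<in>carrier G. \<rho> g $$ (j, i) * cnj (\<rho> g $$ (l, k)))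
    = (if i = k \<and> j = l then of_nat (card (carrier G)) / of_nat n else 0)"
proof -
  let ?C = "coefficient_sum n n \<rho> \<rho> i k"
  have \<rho>: "unitary_rep G n \<rho>" and n: "n > 0" using irr unfolding irreducible_unitary_rep_def by blast+
  obtain c where c: "?C = c \<cdot>\<^sub>m 1\<^sub>m n"
    by (rule schur_scalar[OF irr coefficient_sum_carrier coefficient_sum_intertwines[OF \<rho> \<rho> assms(3,5)]])
  have C: "(\<Sum>g\<in>carrier G. \<rho> g $$ (j, i) * cnj (\<rho> g $$ (l, k))) = (if j = l then c else 0)"
    if "j < n" "l < n" for j l
  proof -
    have "?C $$ (j, l) = (if j = l then c else 0)" unfolding c using that by simp
    then show ?thesis using that by (simp add: coefficient_sum_def)
  qed
  have "of_nat n * c = (\<Sum>j<n. \<Sum>g\<in>carrier G. \<rho> g $$ (j, i) * cnj (\<rho> g $$ (j, k)))"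
    using C by simp
  also have "\<dots> = (\<Sum>g\<in>carrier G. \<Sum>j<n. mat_adjoint (\<rho> g) $$ (k, j) * \<rho> g $$ (j, i))"
    by (subst sum.swap) (use assms in \<open>simp add: index_mat_adjoint_cnj[OF rep_carrier[OF \<rho>]] mult.commute\<close>)
  also have "\<dots> = (\<Sum>g\<in>carrier G. if i = k then 1 else 0)"
  proof (rule sum.cong[OF refl])
    fix g assume g: "g \<in> carrier G"
    have rc: "\<rho> g \<in> carrier_mat n n" by (rule rep_carrier[OF \<rho> g])
    have "(mat_adjoint (\<rho> g) * \<rho> g) $$ (k, i) = (1\<^sub>m n) $$ (k, i)"
      using rep_unitary[OF \<rho> g] by (simp add: unitary_group_simps)
    then show "(\<Sum>j<n. mat_adjoint (\<rho> g) $$ (k, j) * \<rho> g $$ (j, i)) = (if i = k then 1 else 0)"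
      unfolding index_mult_mat_sum[OF mat_adjoint_carrier[OF rc] rc assms(5,3)] using assms(3,5) by auto
  qed
  finally have "c = (if i = k then of_nat (card (carrier G)) / of_nat n else 0)"
    using n by (auto simp: field_simps split: if_splits)
  then show ?thesis using C[OF assms(4,6)] by simp
qed

end

section \<open>Completeness of the matrix coefficients\<close>

lemma orthonormal_on_coefficient:
  assumes "finite J" "orthonormal_on I J e" "i \<in> J" "\<And>x. x \<in> I \<Longrightarrow> f x = (\<Sum>j\<in>J. c j * e j x)"
  shows "inner_on I f (e i) = c i"
proof -
  have "inner_on I f (e i) = inner_on I (\<lambda>x. \<Sum>j\<in>J. c j * e j x) (e i)"
    by (rule inner_on_cong) (simp_all add: assms(4))
  also have "\<dots> = (\<Sum>j\<in>J. if j = i then c j else 0)"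
    unfolding inner_on_sum_left using assms(2,3) by (intro sum.cong) (auto simp: orthonormal_on_def)
  finally show ?thesis using assms(1,3) by simp
qed

lemma inner_on_combinations:
  fixes e :: "nat \<Rightarrow> 'i \<Rightarrow> complex"
  assumes "orthonormal_on I {..<k} e"
  shows "inner_on I (\<lambda>x. \<Sum>p<k. a p * e p x) (\<lambda>x. \<Sum>q<k. b q * e q x) = (\<Sum>p<k. a p * cnj (b p))"
proof -
  have "inner_on I (e p) (\<lambda>x. \<Sum>q<k. b q * e q x) = cnj (b p)" if "p < k" for p
  proof -
    have "inner_on I (\<lambda>x. \<Sum>q<k. b q * e q x) (e p) = b p"
      by (rule orthonormal_on_coefficient[OF finite_lessThan assms]) (use that in auto)
    then show ?thesis using cnj_inner_on[of I "\<lambda>x. \<Sum>q<k. b q * e q x" "e p"] by simp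
  qed
  then show ?thesis unfolding inner_on_sum_left by simp
qed

lemma combination_mem:
  fixes e :: "nat \<Rightarrow> 'i \<Rightarrow> complex"
  assumes "(\<lambda>_. 0) \<in> Z" "\<And>f h. f \<in> Z \<Longrightarrow> h \<in> Z \<Longrightarrow> (\<lambda>x. f x + h x) \<in> Z"
    "\<And>c f. f \<in> Z \<Longrightarrow> (\<lambda>x. c * f x) \<in> Z" "\<And>m. m < l \<Longrightarrow> e m \<in> Z"
  shows "(\<lambda>x. \<Sum>m<l. a m * e m x) \<in> Z"
  using assms(4)
proof (induction l)
  case (Suc l)
  have "(\<lambda>x. (\<Sum>m<l. a m * e m x) + a l * e l x) \<in> Z" using Suc by (intro assms(2,3)) auto
  then show ?case by simp
qed (use assms(1) in simp)

context group
begin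

text \<open>The orthogonal complement of all matrix coefficients of irreducible unitary representations. To
prove that it is zero, a minimal nonzero right-invariant subspace of it is turned into an
irreducible representation, and the elements of the subspace are combinations of its coefficients.\<close>

definition coefficient_orthogonal :: "('a \<Rightarrow> complex) set"
  where "coefficient_orthogonal = {f. \<forall>n \<tau> p q. irreducible_unitary_rep G n \<tau> \<longrightarrow> p < n \<longrightarrow> q < n \<longrightarrow>
    inner_on (carrier G) f (\<lambda>g. \<tau> g $$ (p, q)) = 0}"

lemma coefficient_orthogonal_add:
  "f \<in> coefficient_orthogonal \<Longrightarrow> h \<in> coefficient_orthogonal \<Longrightarrow> (\<lambda>x. f x + h x) \<in> coefficient_orthogonal"
  unfolding coefficient_orthogonal_def inner_on_def by (simp add: distrib_right sum.distrib)

lemma coefficient_orthogonal_scale: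
  "f \<in> coefficient_orthogonal \<Longrightarrow> (\<lambda>x. c * f x) \<in> coefficient_orthogonal"
  unfolding coefficient_orthogonal_def by (simp add: inner_on_scale_left)

lemma coefficient_orthogonal_zero: "(\<lambda>_. 0) \<in> coefficient_orthogonal"
  unfolding coefficient_orthogonal_def inner_on_def by simp

lemma coefficient_orthogonal_translate:
  assumes f: "f \<in> coefficient_orthogonal" and h: "h \<in> carrier G"
  shows "(\<lambda>g. f (g \<otimes> h)) \<in> coefficient_orthogonal"
  unfolding coefficient_orthogonal_def
proof (clarify)
  fix n \<tau> p q assume \<tau>: "irreducible_unitary_rep G n \<tau>" and pq: "p < n" "q < n"
  have rep: "unitary_rep G n \<tau>" using \<tau> unfolding irreducible_unitary_rep_def by blast
  have "inner_on (carrier G) (\<lambda>g. f (g \<otimes> h)) (\<lambda>g. \<tau> g $$ (p, q))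
      = (\<Sum>g\<in>carrier G. f (g \<otimes> h) * cnj (\<tau> (g \<otimes> h \<otimes> inv h) $$ (p, q)))"
    unfolding inner_on_def using h by (intro sum.cong) (auto simp: m_assoc)
  also have "\<dots> = (\<Sum>g\<in>carrier G. f g * cnj (\<tau> (g \<otimes> inv h) $$ (p, q)))"
    by (rule sum_translate_right[OF h])
  also have "\<dots> = inner_on (carrier G) f (\<lambda>g. \<Sum>r<n. \<tau> (inv h) $$ (r, q) * \<tau> g $$ (p, r))"
    unfolding inner_on_def using h pq by (intro sum.cong) (auto simp: index_rep_mult[OF rep] mult.commute)
  also have "\<dots> = (\<Sum>r<n. cnj (\<tau> (inv h) $$ (r, q)) * inner_on (carrier G) f (\<lambda>g. \<tau> g $$ (p, r)))"
    by (rule inner_on_sum_right)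
  also have "\<dots> = 0" using f \<tau> pq unfolding coefficient_orthogonal_def by (intro sum.neutral) auto
  finally show "inner_on (carrier G) (\<lambda>g. f (g \<otimes> h)) (\<lambda>g. \<tau> g $$ (p, q)) = 0" .
qed

text \<open>Orthonormal bases of subspaces of the complement that are invariant under right translation;
\<open>family_rep\<close> is the matrix of right translation in such a basis.\<close>

definition invariant_family :: "nat \<Rightarrow> (nat \<Rightarrow> 'a \<Rightarrow> complex) \<Rightarrow> bool"
  where "invariant_family k e \<longleftrightarrow> orthonormal_on (carrier G) {..<k} e \<and>
    (\<forall>i<k. e i \<in> coefficient_orthogonal) \<and>
    (\<forall>x\<in>carrier G. \<forall>j<k. \<exists>c. \<forall>g\<in>carrier G. e j (g \<otimes> x) = (\<Sum>i<k. c i * e i g))"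

definition family_rep :: "nat \<Rightarrow> (nat \<Rightarrow> 'a \<Rightarrow> complex) \<Rightarrow> 'a \<Rightarrow> complex mat"
  where "family_rep k e x = mat k k (\<lambda>(i, j). inner_on (carrier G) (\<lambda>g. e j (g \<otimes> x)) (e i))"

lemma family_rep_carrier [simp]: "family_rep k e x \<in> carrier_mat k k"
  by (simp add: family_rep_def)

lemma family_rep_expansion:
  assumes "invariant_family k e" "x \<in> carrier G" "j < k" "g \<in> carrier G"
  shows "e j (g \<otimes> x) = (\<Sum>i<k. family_rep k e x $$ (i, j) * e i g)"
proof -
  have on: "orthonormal_on (carrier G) {..<k} e" using assms(1) unfolding invariant_family_def by blast
  obtain c where c: "\<And>g. g \<in> carrier G \<Longrightarrow> e j (g \<otimes> x) = (\<Sum>i<k. c i * e i g)"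
    using assms(1-3) unfolding invariant_family_def by blast
  have "inner_on (carrier G) (\<lambda>g. e j (g \<otimes> x)) (e i) = c i" if "i < k" for i
    by (rule orthonormal_on_coefficient[OF finite_lessThan on _ c]) (use that in auto)
  then show ?thesis using c[OF assms(4)] assms(3) by (simp add: family_rep_def)
qed

lemma family_rep_unitary_rep:
  assumes e: "invariant_family k e"
  shows "unitary_rep G k (family_rep k e)"
proof -
  let ?\<tau> = "family_rep k e"
  have on: "orthonormal_on (carrier G) {..<k} e" using e unfolding invariant_family_def by blast
  have mult: "?\<tau> (x \<otimes> y) = ?\<tau> x * ?\<tau> y" if xy: "x \<in> carrier G" "y \<in> carrier G" for x y
  proof (rule eq_matI)
    fix i j assume "i < dim_row (?\<tau> x * ?\<tau> y)" "j < dim_col (?\<tau> x * ?\<tau> y)"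
    then have ij: "i < k" "j < k" by (auto simp: family_rep_def)
    have "e j (g \<otimes> (x \<otimes> y)) = (\<Sum>i<k. (\<Sum>p<k. ?\<tau> x $$ (i, p) * ?\<tau> y $$ (p, j)) * e i g)"
      if g: "g \<in> carrier G" for g
    proof -
      have "e j (g \<otimes> (x \<otimes> y)) = e j ((g \<otimes> x) \<otimes> y)" using g xy by (simp add: m_assoc)
      also have "\<dots> = (\<Sum>p<k. ?\<tau> y $$ (p, j) * e p (g \<otimes> x))"
        using family_rep_expansion[OF e xy(2) ij(2), of "g \<otimes> x"] g xy by simp
      also have "\<dots> = (\<Sum>p<k. \<Sum>i<k. ?\<tau> x $$ (i, p) * ?\<tau> y $$ (p, j) * e i g)"
        using family_rep_expansion[OF e xy(1) _ g] by (intro sum.cong) (auto simp: sum_distrib_left mult_ac)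
      also have "\<dots> = (\<Sum>i<k. (\<Sum>p<k. ?\<tau> x $$ (i, p) * ?\<tau> y $$ (p, j)) * e i g)"
        by (subst sum.swap) (simp add: sum_distrib_right)
      finally show ?thesis .
    qed
    then have "inner_on (carrier G) (\<lambda>g. e j (g \<otimes> (x \<otimes> y))) (e i) = (\<Sum>p<k. ?\<tau> x $$ (i, p) * ?\<tau> y $$ (p, j))"
      by (intro orthonormal_on_coefficient[OF finite_lessThan on]) (use ij in auto)
    then show "?\<tau> (x \<otimes> y) $$ (i, j) = (?\<tau> x * ?\<tau> y) $$ (i, j)"
      using ij index_mult_mat_sum[of "?\<tau> x" k k "?\<tau> y" k i j] by (simp add: family_rep_def[of k e "x \<otimes> y"])
  qed (auto simp: family_rep_def)
  have "?\<tau> x \<in> carrier (unitary_group k)" if x: "x \<in> carrier G" for x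
  proof (rule unitary_groupI)
    show "mat_adjoint (?\<tau> x) * ?\<tau> x = 1\<^sub>m k"
    proof (rule eq_matI)
      fix i j assume "i < dim_row (1\<^sub>m k)" "j < dim_col (1\<^sub>m k)"
      then have ij: "i < k" "j < k" by auto
      have tc: "?\<tau> x \<in> carrier_mat k k" by simp
      have "(mat_adjoint (?\<tau> x) * ?\<tau> x) $$ (i, j) = (\<Sum>p<k. ?\<tau> x $$ (p, j) * cnj (?\<tau> x $$ (p, i)))"
        unfolding index_mult_mat_sum[OF mat_adjoint_carrier[OF tc] tc ij]
        using ij by (intro sum.cong) (auto simp: index_mat_adjoint_cnj[OF tc] mult.commute)
      also have "\<dots> = inner_on (carrier G) (\<lambda>g. \<Sum>p<k. ?\<tau> x $$ (p, j) * e p g) (\<lambda>g. \<Sum>p<k. ?\<tau> x $$ (p, i) * e p g)"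
        by (rule inner_on_combinations[OF on, symmetric])
      also have "\<dots> = inner_on (carrier G) (\<lambda>g. e j (g \<otimes> x)) (\<lambda>g. e i (g \<otimes> x))"
        by (rule inner_on_cong) (simp_all add: family_rep_expansion[OF e x ij(1)] family_rep_expansion[OF e x ij(2)])
      also have "\<dots> = inner_on (carrier G) (e j) (e i)"
        unfolding inner_on_def by (rule sum_translate_right[OF x])
      also have "\<dots> = 1\<^sub>m k $$ (i, j)" using on ij unfolding orthonormal_on_def by auto
      finally show "(mat_adjoint (?\<tau> x) * ?\<tau> x) $$ (i, j) = 1\<^sub>m k $$ (i, j)" .
    qed (auto simp: family_rep_def)
  qed simp
  then show ?thesis unfolding unitary_rep_def hom_def using mult by (auto simp: unitary_group_simps(2))
qed

text \<open>An invariant subspace \<open>W\<close> of \<open>\<complex>\<^sup>k\<close> corresponds to an invariant subspace of the span of the family.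
By minimality an orthonormal basis of \<open>W\<close> has at least \<open>k\<close> members, so \<open>W\<close> is everything.\<close>

lemma minimal_family_irreducible:
  assumes e: "invariant_family k e" "0 < k"
    and min: "\<And>l e'. invariant_family l e' \<Longrightarrow> 0 < l \<Longrightarrow> k \<le> l"
  shows "irreducible_unitary_rep G k (family_rep k e)"
  unfolding irreducible_unitary_rep_def
proof (intro conjI allI impI)
  let ?\<tau> = "family_rep k e"
  show "unitary_rep G k ?\<tau>" by (rule family_rep_unitary_rep[OF e(1)])
  show "0 < k" by fact
  have on: "orthonormal_on (carrier G) {..<k} e" and eZ: "\<And>i. i < k \<Longrightarrow> e i \<in> coefficient_orthogonal"
    using e unfolding invariant_family_def by blast+
  fix W assume "subspace class_ring W (module_vec TYPE(complex) k) \<and> (\<forall>g\<in>carrier G. \<forall>v\<in>W. ?\<tau> g *\<^sub>v v \<in> W)"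
  then have W: "W \<subseteq> carrier_vec k" "0\<^sub>v k \<in> W" "\<And>v w. v \<in> W \<Longrightarrow> w \<in> W \<Longrightarrow> v + w \<in> W"
      "\<And>c v. v \<in> W \<Longrightarrow> c \<cdot>\<^sub>v v \<in> W" and W_inv: "\<And>g v. g \<in> carrier G \<Longrightarrow> v \<in> W \<Longrightarrow> ?\<tau> g *\<^sub>v v \<in> W"
    unfolding subspace_vec_iff by blast+
  show "W = {0\<^sub>v k} \<or> W = carrier_vec k"
  proof (cases "W = {0\<^sub>v k}")
    case False
    then obtain w where w: "w \<in> W" "w \<noteq> 0\<^sub>v k" using W(2) by blast
    \<comment> \<open>\<open>W\<close> as a space of functions on \<open>{..<k}\<close>, so that the results on orthonormal families apply.\<close>
    define Z where "Z = {f. vec k f \<in> W}"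
    have vec_nth: "vec k (\<lambda>i. v $ i) = v" if "v \<in> carrier_vec k" for v :: "complex vec" using that by auto
    have Z_add: "(\<lambda>x. f x + h x) \<in> Z" if "f \<in> Z" "h \<in> Z" for f h
    proof -
      have "vec k f + vec k h = vec k (\<lambda>x. f x + h x)" by auto
      then show ?thesis using W(3)[of "vec k f" "vec k h"] that unfolding Z_def by simp
    qed
    have Z_scale: "(\<lambda>x. c * f x) \<in> Z" if "f \<in> Z" for c f
    proof -
      have "c \<cdot>\<^sub>v vec k f = vec k (\<lambda>x. c * f x)" by auto
      then show ?thesis using W(4)[of "vec k f" c] that unfolding Z_def by simp
    qed
    have Z_zero: "(\<lambda>_. 0) \<in> Z"
    proof -
      have "vec k (\<lambda>_. 0) = (0\<^sub>v k :: complex vec)" by auto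
      then show ?thesis using W(2) unfolding Z_def by simp
    qed
    obtain l :: nat and v where v: "orthonormal_on {..<k} {..<l} v" "\<And>i. i < l \<Longrightarrow> v i \<in> Z"
      "\<And>f x. f \<in> Z \<Longrightarrow> x \<in> {..<k} \<Longrightarrow> f x = (\<Sum>i<l. inner_on {..<k} f (v i) * v i x)"
    proof -
      have "\<exists>(l::nat) v. orthonormal_on {..<k} {..<l} v \<and> (\<forall>i<l. v i \<in> Z) \<and>
          (\<forall>f\<in>Z. \<forall>x\<in>{..<k}. f x = (\<Sum>i<l. inner_on {..<k} f (v i) * v i x))"
        by (intro orthonormal_basis finite_lessThan Z_add Z_scale)
      then show thesis using that by blast
    qed
    have "l > 0"
    proof (rule ccontr)
      assume "\<not> l > 0"
      have "(\<lambda>i. w $ i) \<in> Z" unfolding Z_def using w(1) W(1) vec_nth[of w] by auto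
      then have "w $ i = 0" if "i < k" for i using v(3)[of "\<lambda>i. w $ i" i] that \<open>\<not> l > 0\<close> by simp
      then have "w = 0\<^sub>v k" using w(1) W(1) by (intro eq_vecI) auto
      then show False using w(2) by simp
    qed
    define e' where "e' j = (\<lambda>g. \<Sum>i<k. v j i * e i g)" for j
    have "invariant_family l e'"
      unfolding invariant_family_def
    proof (intro conjI allI impI ballI)
      show "orthonormal_on (carrier G) {..<l} e'"
        unfolding orthonormal_on_def e'_def inner_on_combinations[OF on]
        using v(1) unfolding orthonormal_on_def inner_on_def by simp
    next
      fix j assume "j < l"
      show "e' j \<in> coefficient_orthogonal" unfolding e'_def
        by (rule combination_mem[OF coefficient_orthogonal_zero coefficient_orthogonal_add
              coefficient_orthogonal_scale eZ])
    next
      fix x j assume x: "x \<in> carrier G" and j: "j < l"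
      define u where "u p = (?\<tau> x *\<^sub>v vec k (v j)) $ p" for p
      have uW: "?\<tau> x *\<^sub>v vec k (v j) \<in> W" using W_inv[OF x] v(2)[OF j] unfolding Z_def by simp
      then have "u \<in> Z" unfolding Z_def u_def using W(1) vec_nth[of "?\<tau> x *\<^sub>v vec k (v j)"] by auto
      then have u_span: "u p = (\<Sum>m<l. inner_on {..<k} u (v m) * v m p)" if "p < k" for p
        using v(3)[of u p] that by simp
      have u_sum: "u p = (\<Sum>i<k. ?\<tau> x $$ (p, i) * v j i)" if "p < k" for p
        unfolding u_def using index_mult_mat_vec_sum[of "?\<tau> x" k k "vec k (v j)" p] that by simp
      have "e' j (g \<otimes> x) = (\<Sum>m<l. inner_on {..<k} u (v m) * e' m g)" if g: "g \<in> carrier G" for g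
      proof -
        have "e' j (g \<otimes> x) = (\<Sum>i<k. \<Sum>p<k. ?\<tau> x $$ (p, i) * v j i * e p g)"
          unfolding e'_def using family_rep_expansion[OF e(1) x _ g]
          by (intro sum.cong) (auto simp: sum_distrib_left mult_ac)
        also have "\<dots> = (\<Sum>p<k. u p * e p g)"
          by (subst sum.swap) (simp add: u_sum sum_distrib_right)
        also have "\<dots> = (\<Sum>p<k. \<Sum>m<l. inner_on {..<k} u (v m) * (v m p * e p g))"
        proof (rule sum.cong[OF refl])
          fix p assume "p \<in> {..<k}"
          then have "u p * e p g = (\<Sum>m<l. inner_on {..<k} u (v m) * v m p) * e p g" using u_span by simp
          then show "u p * e p g = (\<Sum>m<l. inner_on {..<k} u (v m) * (v m p * e p g))"
            by (simp only: sum_distrib_right mult.assoc)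
        qed
        also have "\<dots> = (\<Sum>m<l. inner_on {..<k} u (v m) * e' m g)"
          unfolding e'_def by (subst sum.swap) (simp add: sum_distrib_left)
        finally show ?thesis .
      qed
      then show "\<exists>c. \<forall>g\<in>carrier G. e' j (g \<otimes> x) = (\<Sum>i<l. c i * e' i g)"
        by (intro exI[of _ "\<lambda>m. inner_on {..<k} u (v m)"]) simp
    qed
    then have kl: "k \<le> l" using min \<open>l > 0\<close> by blast
    have "y \<in> W" if y: "y \<in> carrier_vec k" for y
    proof -
      let ?a = "\<lambda>m. inner_on {..<k} (\<lambda>i. y $ i) (v m)"
      have "y $ i = (\<Sum>m<l. ?a m * v m i)" if "i < k" for i
        using orthonormal_on_complete[OF finite_lessThan v(1), of i "\<lambda>i. y $ i"] kl that by simp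
      then have "y = vec k (\<lambda>i. \<Sum>m<l. ?a m * v m i)" using y by (intro eq_vecI) auto
      moreover have "(\<lambda>i. \<Sum>m<l. ?a m * v m i) \<in> Z"
        by (rule combination_mem[OF Z_zero Z_add Z_scale v(2)])
      ultimately show ?thesis unfolding Z_def by simp
    qed
    then show ?thesis using W(1) by blast
  qed simp
qed

theorem coefficients_complete:
  assumes fin: "finite (carrier G)" and f: "f \<in> coefficient_orthogonal" and x: "x \<in> carrier G"
  shows "f x = 0"
proof (rule ccontr)
  assume nz: "f x \<noteq> 0"
  obtain k0 :: nat and e0 where e0: "orthonormal_on (carrier G) {..<k0} e0"
    "\<And>i. i < k0 \<Longrightarrow> e0 i \<in> coefficient_orthogonal"
    "\<And>f x. f \<in> coefficient_orthogonal \<Longrightarrow> x \<in> carrier G \<Longrightarrow> f x = (\<Sum>i<k0. inner_on (carrier G) f (e0 i) * e0 i x)"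
  proof -
    have "\<exists>(k::nat) e. orthonormal_on (carrier G) {..<k} e \<and> (\<forall>i<k. e i \<in> coefficient_orthogonal) \<and>
        (\<forall>f\<in>coefficient_orthogonal. \<forall>x\<in>carrier G. f x = (\<Sum>i<k. inner_on (carrier G) f (e i) * e i x))"
      by (intro orthonormal_basis fin coefficient_orthogonal_add coefficient_orthogonal_scale)
    then show thesis using that by blast
  qed
  have "invariant_family k0 e0"
    unfolding invariant_family_def
  proof (intro conjI allI impI ballI)
    fix x j assume "x \<in> carrier G" "j < k0"
    then have "(\<lambda>g. e0 j (g \<otimes> x)) \<in> coefficient_orthogonal" using e0(2) by (intro coefficient_orthogonal_translate)
    then show "\<exists>c. \<forall>g\<in>carrier G. e0 j (g \<otimes> x) = (\<Sum>i<k0. c i * e0 i g)"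
      by (intro exI[of _ "\<lambda>i. inner_on (carrier G) (\<lambda>g. e0 j (g \<otimes> x)) (e0 i)"] ballI) (rule e0(3))
  qed (use e0 in auto)
  moreover have "k0 > 0" using e0(3)[OF f x] nz by (cases k0) auto
  ultimately have ex: "\<exists>k. 0 < k \<and> (\<exists>e. invariant_family k e)" by blast
  define k where "k = (LEAST k. 0 < k \<and> (\<exists>e. invariant_family k e))"
  have "0 < k \<and> (\<exists>e. invariant_family k e)" unfolding k_def using ex by (rule LeastI_ex)
  then obtain e where k: "0 < k" and e: "invariant_family k e" by blast
  have min: "k \<le> l" if "invariant_family l e'" "0 < l" for l e'
    unfolding k_def using that by (intro Least_le) blast
  let ?\<tau> = "family_rep k e"
  have irr: "irreducible_unitary_rep G k ?\<tau>" by (rule minimal_family_irreducible[OF e k min])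
  have "e 0 \<in> coefficient_orthogonal" using e k unfolding invariant_family_def by blast
  then have orth: "inner_on (carrier G) (e 0) (\<lambda>g. ?\<tau> g $$ (i, 0)) = 0" if "i < k" for i
    using irr that k unfolding coefficient_orthogonal_def by blast
  \<comment> \<open>Evaluating translates at the identity writes \<open>e 0\<close> as a combination of coefficients to which
it is orthogonal.\<close>
  have "inner_on (carrier G) (e 0) (e 0) = inner_on (carrier G) (e 0) (\<lambda>g. \<Sum>i<k. e i \<one> * ?\<tau> g $$ (i, 0))"
  proof (rule inner_on_cong[OF refl])
    fix g assume g: "g \<in> carrier G"
    show "e 0 g = (\<Sum>i<k. e i \<one> * ?\<tau> g $$ (i, 0))"
      using family_rep_expansion[OF e g k one_closed] g by (simp add: mult.commute)
  qed
  also have "\<dots> = 0" unfolding inner_on_sum_right using orth by simp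
  finally show False using e k unfolding invariant_family_def orthonormal_on_def by auto
qed

end

section \<open>The twisted Burnside-Frobenius theorem for finite groups\<close>

definition mat_trace :: "complex mat \<Rightarrow> complex"
  where "mat_trace M = (\<Sum>p<dim_row M. M $$ (p, p))"

lemma mat_trace_mult:
  assumes "A \<in> carrier_mat n n" "B \<in> carrier_mat n n"
  shows "mat_trace (A * B) = (\<Sum>pq\<in>{..<n}\<times>{..<n}. A $$ pq * B $$ (snd pq, fst pq))"
proof -
  have "mat_trace (A * B) = (\<Sum>p<n. \<Sum>q<n. A $$ (p, q) * B $$ (q, p))"
    using assms unfolding mat_trace_def
    by (intro sum.cong) (auto simp: index_mult_mat_sum[OF assms] simp del: index_mult_mat(1))
  then show ?thesis by (simp add: sum.cartesian_product case_prod_beta)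
qed

lemma mat_trace_comm:
  assumes "A \<in> carrier_mat n n" "B \<in> carrier_mat n n"
  shows "mat_trace (A * B) = mat_trace (B * A)"
  unfolding mat_trace_mult[OF assms] mat_trace_mult[OF assms(2,1)]
  by (rule sum.reindex_bij_witness[of _ prod.swap prod.swap]) auto

lemma mat_trace_smult: "mat_trace (c \<cdot>\<^sub>m A) = c * mat_trace A" if "A \<in> carrier_mat n n"
  using that unfolding mat_trace_def by (simp add: sum_distrib_left)

lemma unitary_frobenius:
  assumes "U \<in> carrier (unitary_group n)"
  shows "(\<Sum>pq\<in>{..<n}\<times>{..<n}. U $$ pq * cnj (U $$ pq)) = of_nat n"
proof -
  have U: "U \<in> carrier_mat n n" "mat_adjoint U * U = 1\<^sub>m n" using assms by (auto simp: unitary_group_simps)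
  have "mat_trace (U * mat_adjoint U) = mat_trace (mat_adjoint U * U)"
    by (rule mat_trace_comm[OF U(1) mat_adjoint_carrier[OF U(1)]])
  also have "\<dots> = of_nat n" unfolding U(2) mat_trace_def by simp
  finally show ?thesis
    unfolding mat_trace_mult[OF U(1) mat_adjoint_carrier[OF U(1)]]
    by (subst sum.cong[OF refl]) (auto simp: index_mat_adjoint_cnj[OF U(1)])
qed

context group
begin

lemma unitary_equiv_comp_hom:
  assumes "\<phi> \<in> hom H G" "(\<rho>, \<sigma>) \<in> unitary_equiv G"
  shows "(\<rho> \<circ> \<phi>, \<sigma> \<circ> \<phi>) \<in> unitary_equiv H"
proof -
  obtain n U where U: "unitary_rep G n \<rho>" "unitary_rep G n \<sigma>" "U \<in> carrier (unitary_group n)"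
    "\<forall>g \<in> carrier G. U * \<rho> g = \<sigma> g * U"
    using assms(2) unfolding unitary_equiv_def by blast
  have "\<phi> h \<in> carrier G" if "h \<in> carrier H" for h using assms(1) that by (auto simp: hom_def)
  then show ?thesis
    using U(4) by (intro unitary_equivI[OF unitary_rep_comp_hom[OF assms(1) U(1)] unitary_rep_comp_hom[OF assms(1) U(2)] U(3)]) simp
qed

lemma unitary_equiv_obtain:
  assumes "(\<rho>, \<sigma>) \<in> unitary_equiv G" "unitary_rep G n \<rho>"
  obtains U where "U \<in> carrier (unitary_group n)" "unitary_rep G n \<sigma>"
    "\<And>g. g \<in> carrier G \<Longrightarrow> U * \<rho> g = \<sigma> g * U"
proof -
  obtain m U where U: "unitary_rep G m \<rho>" "unitary_rep G m \<sigma>" "U \<in> carrier (unitary_group m)"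
    "\<forall>g \<in> carrier G. U * \<rho> g = \<sigma> g * U"
    using assms(1) unfolding unitary_equiv_def by blast
  have "\<rho> \<one> \<in> carrier_mat n n" "\<rho> \<one> \<in> carrier_mat m m"
    using rep_carrier[OF assms(2) one_closed] rep_carrier[OF U(1) one_closed] by auto
  then have "m = n" by auto
  then show thesis using that[of U] U by auto
qed

text \<open>Whether \<open>\<rho>\<close> and \<open>\<rho> \<circ> \<phi>\<close> are equivalent depends only on the class of \<open>\<rho>\<close>.\<close>

lemma f_point_member:
  assumes \<phi>: "\<phi> \<in> hom G G" and c: "c \<in> f_points_ff G \<phi>" and \<rho>: "\<rho> \<in> c"
  shows "(\<rho>, \<rho> \<circ> \<phi>) \<in> unitary_equiv G"
proof -
  note eqv = equivE[OF equiv_unitary_equiv[OF is_group]]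
  obtain \<sigma> where "c \<in> unitary_dual_ff G" and \<sigma>: "\<sigma> \<in> c" "(\<sigma>, \<sigma> \<circ> \<phi>) \<in> unitary_equiv G"
    using c unfolding f_points_ff_def by blast
  then obtain \<tau> where "c = unitary_equiv G `` {\<tau>}" unfolding unitary_dual_ff_def quotient_def by blast
  then have 1: "(\<rho>, \<sigma>) \<in> unitary_equiv G" using \<rho> \<sigma>(1) eqv by (meson Image_singleton_iff symD transD)
  have "(\<sigma> \<circ> \<phi>, \<rho> \<circ> \<phi>) \<in> unitary_equiv G" using unitary_equiv_comp_hom[OF \<phi> 1] eqv by (meson symD)
  then show ?thesis using 1 \<sigma>(2) eqv by (meson transD)
qed

lemma f_points_ff_iff:
  assumes \<phi>: "\<phi> \<in> hom G G"
  shows "c \<in> f_points_ff G \<phi> \<longleftrightarrow> (\<exists>n \<rho>. irreducible_unitary_rep G n \<rho> \<and> factors_through_finite_group G n \<rho> \<and>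
    (\<rho>, \<rho> \<circ> \<phi>) \<in> unitary_equiv G \<and> c = unitary_equiv G `` {\<rho>})"
proof
  assume c: "c \<in> f_points_ff G \<phi>"
  then obtain n \<rho> where \<rho>: "irreducible_unitary_rep G n \<rho>" "factors_through_finite_group G n \<rho>" "c = unitary_equiv G `` {\<rho>}"
    unfolding f_points_ff_def unitary_dual_ff_def quotient_def by blast
  have "\<rho> \<in> c" unfolding \<rho>(3)
    using \<rho>(1) equiv_class_self[OF equiv_unitary_equiv[OF is_group], of \<rho>] unfolding irreducible_unitary_rep_def by blast
  then have "(\<rho>, \<rho> \<circ> \<phi>) \<in> unitary_equiv G" by (rule f_point_member[OF \<phi> c])
  then show "\<exists>n \<rho>. irreducible_unitary_rep G n \<rho> \<and> factors_through_finite_group G n \<rho> \<and>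
    (\<rho>, \<rho> \<circ> \<phi>) \<in> unitary_equiv G \<and> c = unitary_equiv G `` {\<rho>}" using \<rho> by blast
next
  note eqv = equiv_unitary_equiv[OF is_group]
  assume "\<exists>n \<rho>. irreducible_unitary_rep G n \<rho> \<and> factors_through_finite_group G n \<rho> \<and>
    (\<rho>, \<rho> \<circ> \<phi>) \<in> unitary_equiv G \<and> c = unitary_equiv G `` {\<rho>}"
  then obtain n \<rho> where \<rho>: "irreducible_unitary_rep G n \<rho>" "factors_through_finite_group G n \<rho>"
    "(\<rho>, \<rho> \<circ> \<phi>) \<in> unitary_equiv G" "c = unitary_equiv G `` {\<rho>}" by blast
  have "c \<in> unitary_dual_ff G" unfolding unitary_dual_ff_def \<rho>(4) using \<rho>(1,2) by (intro quotientI) blast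
  moreover have "\<rho> \<in> c" unfolding \<rho>(4)
    using \<rho>(1) equiv_class_self[OF eqv, of \<rho>] unfolding irreducible_unitary_rep_def by blast
  ultimately show "c \<in> f_points_ff G \<phi>" unfolding f_points_ff_def using \<rho>(3) by blast
qed

text \<open>A finite group of any type is transported to the natural numbers along a numbering of its
elements.\<close>

lemma factors_through_finite_groupI:
  assumes Q: "group Q" "finite (carrier Q)" and \<pi>: "\<pi> \<in> hom G Q" and \<sigma>: "unitary_rep Q n \<sigma>"
    and eq: "\<And>g. g \<in> carrier G \<Longrightarrow> \<rho> g = \<sigma> (\<pi> g)"
  shows "factors_through_finite_group G n \<rho>"
proof -
  interpret Q: group Q by fact
  obtain h where h: "bij_betw h (carrier Q) {0..<card (carrier Q)}" using ex_bij_betw_finite_nat[OF Q(2)] by blast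
  define k where "k = inv_into (carrier Q) h"
  have k: "k (h x) = x" if "x \<in> carrier Q" for x
    unfolding k_def using h that by (simp add: bij_betw_def inv_into_f_f)
  define R :: "nat monoid" where "R = \<lparr>carrier = UNIV, mult = (\<lambda>a b. h (k a \<otimes>\<^bsub>Q\<^esub> k b)), one = h \<one>\<^bsub>Q\<^esub>\<rparr>"
  let ?F = "R\<lparr>carrier := h ` carrier Q, one := h \<one>\<^bsub>Q\<^esub>\<rparr>"
  have "h \<in> hom Q R" by (auto simp: hom_def R_def k)
  then have F: "group ?F" by (rule Q.hom_imp_img_group)
  have "h \<in> hom Q ?F" by (auto simp: hom_def R_def k)
  then have \<pi>': "h \<circ> \<pi> \<in> hom G ?F" by (rule Group.hom_compose[OF \<pi>])
  have "k \<in> hom ?F Q" by (auto simp: hom_def R_def k)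
  then have \<sigma>': "unitary_rep ?F n (\<sigma> \<circ> k)" using \<sigma> by (rule Q.unitary_rep_comp_hom)
  have "\<forall>g \<in> carrier G. \<rho> g = (\<sigma> \<circ> k) ((h \<circ> \<pi>) g)"
    using eq k \<pi> by (auto simp: hom_def Pi_iff)
  moreover have "finite (carrier ?F)" using Q(2) by simp
  ultimately show ?thesis unfolding factors_through_finite_group_def using F \<pi>' \<sigma>' by blast
qed

text \<open>Intertwining moves \<open>\<rho>(x)\<close> across \<open>A\<close> as \<open>\<rho>(\<phi> x)\<close>, which then cancels cyclically under the trace.\<close>

lemma mat_trace_twisted_invariant:
  assumes \<phi>: "\<phi> \<in> hom G G" and \<rho>: "unitary_rep G n \<rho>" and A: "A \<in> carrier_mat n n"
    and tw: "\<And>g. g \<in> carrier G \<Longrightarrow> A * \<rho> g = \<rho> (\<phi> g) * A"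
    and x: "x \<in> carrier G" and g: "g \<in> carrier G"
  shows "mat_trace (A * \<rho> (x \<otimes> g \<otimes> \<phi> (inv x))) = mat_trace (A * \<rho> g)"
proof -
  interpret phi: group_hom G G \<phi> using \<phi> by unfold_locales
  let ?y = "\<phi> (inv x)"
  have y: "?y \<in> carrier G" "\<phi> x \<in> carrier G" using x by auto
  have c: "\<rho> x \<in> carrier_mat n n" "\<rho> g \<in> carrier_mat n n" "\<rho> ?y \<in> carrier_mat n n" "\<rho> (\<phi> x) \<in> carrier_mat n n"
    using rep_carrier[OF \<rho>] x g y by auto
  note assoc = assoc_mult_mat[of _ n n _ n _ n]
  have "A * \<rho> (x \<otimes> g \<otimes> ?y) = (A * \<rho> x) * \<rho> g * \<rho> ?y"
    using x g y A c by (simp add: rep_mult[OF \<rho>] assoc)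
  also have "\<dots> = \<rho> (\<phi> x) * (A * \<rho> g * \<rho> ?y)"
    unfolding tw[OF x] using A c by (simp add: assoc)
  finally have "mat_trace (A * \<rho> (x \<otimes> g \<otimes> ?y)) = mat_trace (A * \<rho> g * \<rho> ?y * \<rho> (\<phi> x))"
    using mat_trace_comm[of "\<rho> (\<phi> x)" n "A * \<rho> g * \<rho> ?y"] A c by simp
  also have "A * \<rho> g * \<rho> ?y * \<rho> (\<phi> x) = A * \<rho> g * (\<rho> ?y * \<rho> (\<phi> x))"
    using A c by (simp add: assoc)
  also have "\<rho> ?y * \<rho> (\<phi> x) = 1\<^sub>m n"
    using rep_mult[OF \<rho> y] x rep_one[OF \<rho>] by simp
  finally show ?thesis using A c by simp
qed

text \<open>The sums run over pairs of indices, so that the trace is a single linear combination of matrix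
coefficients.\<close>

lemma inner_on_mat_trace:
  assumes \<rho>: "unitary_rep G n \<rho>" and A: "A \<in> carrier_mat n n"
    and \<sigma>: "unitary_rep G m \<sigma>" and B: "B \<in> carrier_mat m m"
  shows "inner_on (carrier G) (\<lambda>g. mat_trace (A * \<rho> g)) (\<lambda>g. mat_trace (B * \<sigma> g)) =
    (\<Sum>pq\<in>{..<n}\<times>{..<n}. A $$ pq * (\<Sum>kl\<in>{..<m}\<times>{..<m}. cnj (B $$ kl) *
      inner_on (carrier G) (\<lambda>g. \<rho> g $$ (snd pq, fst pq)) (\<lambda>g. \<sigma> g $$ (snd kl, fst kl))))"
proof -
  have "inner_on (carrier G) (\<lambda>g. mat_trace (A * \<rho> g)) (\<lambda>g. mat_trace (B * \<sigma> g)) =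
    inner_on (carrier G) (\<lambda>g. \<Sum>pq\<in>{..<n}\<times>{..<n}. A $$ pq * \<rho> g $$ (snd pq, fst pq))
      (\<lambda>g. \<Sum>kl\<in>{..<m}\<times>{..<m}. B $$ kl * \<sigma> g $$ (snd kl, fst kl))"
    by (rule inner_on_cong) (rule mat_trace_mult[OF A rep_carrier[OF \<rho>]] mat_trace_mult[OF B rep_carrier[OF \<sigma>]]; assumption)+
  then show ?thesis unfolding inner_on_sum_left inner_on_sum_right .
qed

lemma inner_on_mat_trace_inequivalent:
  assumes irr: "irreducible_unitary_rep G n \<rho>" and irr': "irreducible_unitary_rep G m \<sigma>"
    and ineq: "(\<sigma>, \<rho>) \<notin> unitary_equiv G" and A: "A \<in> carrier_mat n n" and B: "B \<in> carrier_mat m m"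
  shows "inner_on (carrier G) (\<lambda>g. mat_trace (A * \<rho> g)) (\<lambda>g. mat_trace (B * \<sigma> g)) = 0"
proof -
  have \<rho>: "unitary_rep G n \<rho>" and \<sigma>: "unitary_rep G m \<sigma>" using irr irr' unfolding irreducible_unitary_rep_def by blast+
  have "inner_on (carrier G) (\<lambda>g. \<rho> g $$ (snd pq, fst pq)) (\<lambda>g. \<sigma> g $$ (snd kl, fst kl)) = 0"
    if "pq \<in> {..<n}\<times>{..<n}" "kl \<in> {..<m}\<times>{..<m}" for pq kl
    unfolding inner_on_def using that by (intro schur_orthogonality_inequivalent[OF irr irr' ineq]) auto
  then show ?thesis unfolding inner_on_mat_trace[OF \<rho> A \<sigma> B] by simp
qed

lemma inner_on_mat_trace_self:
  assumes fin: "finite (carrier G)" and irr: "irreducible_unitary_rep G n \<rho>" and U: "U \<in> carrier (unitary_group n)"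
  shows "inner_on (carrier G) (\<lambda>g. mat_trace (U * \<rho> g)) (\<lambda>g. mat_trace (U * \<rho> g)) = of_nat (card (carrier G))"
proof -
  have \<rho>: "unitary_rep G n \<rho>" and n: "n > 0" using irr unfolding irreducible_unitary_rep_def by blast+
  have Uc: "U \<in> carrier_mat n n" using U by (simp add: unitary_group_simps)
  let ?N = "of_nat (card (carrier G)) / of_nat n :: complex"
  have inner: "inner_on (carrier G) (\<lambda>g. \<rho> g $$ (snd pq, fst pq)) (\<lambda>g. \<rho> g $$ (snd kl, fst kl)) = (if kl = pq then ?N else 0)"
    if "pq \<in> {..<n}\<times>{..<n}" "kl \<in> {..<n}\<times>{..<n}" for pq kl
    unfolding inner_on_def
    by (subst schur_orthogonality_same[OF fin irr]) (use that in \<open>auto simp: prod_eq_iff\<close>)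
  have "inner_on (carrier G) (\<lambda>g. mat_trace (U * \<rho> g)) (\<lambda>g. mat_trace (U * \<rho> g)) =
    (\<Sum>pq\<in>{..<n}\<times>{..<n}. U $$ pq * (\<Sum>kl\<in>{..<n}\<times>{..<n}. if kl = pq then cnj (U $$ kl) * ?N else 0))"
    unfolding inner_on_mat_trace[OF \<rho> Uc \<rho> Uc] using inner
    by (intro sum.cong arg_cong2[where f = "(*)"] refl) auto
  also have "\<dots> = (\<Sum>pq\<in>{..<n}\<times>{..<n}. U $$ pq * cnj (U $$ pq)) * ?N"
    unfolding sum_distrib_right by (intro sum.cong) (auto simp: mult.assoc)
  also have "\<dots> = of_nat (card (carrier G))" unfolding unitary_frobenius[OF U] using n by simp
  finally show ?thesis .
qed

text \<open>Since \<open>f\<close> is invariant under the twisted action, its inner product with a coefficient does not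
change when the coefficient is averaged over this action. The average is a function
\<open>g \<mapsto> tr (C \<tau>(g))\<close> in which \<open>C\<close> is a \<open>coefficient_sum\<close>, hence an intertwiner.\<close>

lemma twisted_invariant_coefficient:
  assumes fin: "finite (carrier G)" and \<phi>: "\<phi> \<in> hom G G" and \<tau>: "unitary_rep G n \<tau>" and ij: "i < n" "j < n"
    and f: "\<And>x g. x \<in> carrier G \<Longrightarrow> g \<in> carrier G \<Longrightarrow> f (x \<otimes> g \<otimes> \<phi> (inv x)) = f g"
    and orth: "\<And>A. A \<in> carrier_mat n n \<Longrightarrow> (\<And>g. g \<in> carrier G \<Longrightarrow> A * \<tau> g = \<tau> (\<phi> g) * A) \<Longrightarrow>
      inner_on (carrier G) f (\<lambda>g. mat_trace (A * \<tau> g)) = 0"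
  shows "inner_on (carrier G) f (\<lambda>g. \<tau> g $$ (i, j)) = 0"
proof -
  interpret phi: group_hom G G \<phi> using \<phi> by unfold_locales
  have \<tau>\<phi>: "unitary_rep G n (\<tau> \<circ> \<phi>)" by (rule unitary_rep_comp_hom[OF \<phi> \<tau>])
  let ?C = "coefficient_sum n n (\<tau> \<circ> \<phi>) \<tau> j i"
  have C: "?C * \<tau> g = \<tau> (\<phi> g) * ?C" if "g \<in> carrier G" for g
    using coefficient_sum_intertwines[OF \<tau>\<phi> \<tau> ij(2,1) that] by simp
  have avg: "(\<Sum>x\<in>carrier G. \<tau> (inv x \<otimes> g \<otimes> \<phi> x) $$ (i, j)) = mat_trace (?C * \<tau> g)"
    if g: "g \<in> carrier G" for g
  proof -
    have "\<tau> (inv x \<otimes> g \<otimes> \<phi> x) $$ (i, j) =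
      (\<Sum>qp\<in>{..<n}\<times>{..<n}. (\<tau> \<circ> \<phi>) x $$ (fst qp, j) * cnj (\<tau> x $$ (snd qp, i)) * \<tau> g $$ (snd qp, fst qp))"
      if x: "x \<in> carrier G" for x
    proof -
      have "\<tau> (inv x \<otimes> g \<otimes> \<phi> x) $$ (i, j) =
        (\<Sum>q<n. (\<Sum>p<n. \<tau> (inv x) $$ (i, p) * \<tau> g $$ (p, q)) * \<tau> (\<phi> x) $$ (q, j))"
        using x g ij by (simp add: index_rep_mult[OF \<tau>])
      also have "\<dots> = (\<Sum>q<n. \<Sum>p<n. (\<tau> \<circ> \<phi>) x $$ (q, j) * cnj (\<tau> x $$ (p, i)) * \<tau> g $$ (p, q))"
        unfolding sum_distrib_right
        using x ij by (intro sum.cong refl) (simp add: index_rep_inv[OF \<tau>] mult_ac)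
      also have "\<dots> = (\<Sum>qp\<in>{..<n}\<times>{..<n}. (\<tau> \<circ> \<phi>) x $$ (fst qp, j) * cnj (\<tau> x $$ (snd qp, i)) * \<tau> g $$ (snd qp, fst qp))"
        by (simp add: sum.cartesian_product case_prod_beta)
      finally show ?thesis .
    qed
    then have "(\<Sum>x\<in>carrier G. \<tau> (inv x \<otimes> g \<otimes> \<phi> x) $$ (i, j)) =
      (\<Sum>x\<in>carrier G. \<Sum>qp\<in>{..<n}\<times>{..<n}. (\<tau> \<circ> \<phi>) x $$ (fst qp, j) * cnj (\<tau> x $$ (snd qp, i)) * \<tau> g $$ (snd qp, fst qp))"
      by (rule sum.cong[OF refl])
    also have "\<dots> = (\<Sum>qp\<in>{..<n}\<times>{..<n}. ?C $$ qp * \<tau> g $$ (snd qp, fst qp))"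
      by (subst sum.swap) (auto simp: coefficient_sum_def sum_distrib_right intro!: sum.cong)
    also have "\<dots> = mat_trace (?C * \<tau> g)"
      by (rule mat_trace_mult[OF coefficient_sum_carrier rep_carrier[OF \<tau> g], symmetric])
    finally show ?thesis .
  qed
  have shift: "(\<Sum>g\<in>carrier G. f g * cnj (\<tau> (inv x \<otimes> g \<otimes> \<phi> x) $$ (i, j))) = inner_on (carrier G) f (\<lambda>g. \<tau> g $$ (i, j))"
    if x: "x \<in> carrier G" for x
    unfolding inner_on_def
  proof (rule sum.reindex_bij_witness[of _ "\<lambda>g. x \<otimes> g \<otimes> \<phi> (inv x)" "\<lambda>g. inv x \<otimes> g \<otimes> \<phi> x"])
    fix g assume g: "g \<in> carrier G"
    show "x \<otimes> (inv x \<otimes> g \<otimes> \<phi> x) \<otimes> \<phi> (inv x) = g" "inv x \<otimes> (x \<otimes> g \<otimes> \<phi> (inv x)) \<otimes> \<phi> x = g"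
      "inv x \<otimes> g \<otimes> \<phi> x \<in> carrier G" "x \<otimes> g \<otimes> \<phi> (inv x) \<in> carrier G"
      using x g by (simp_all add: m_assoc)
    show "f (inv x \<otimes> g \<otimes> \<phi> x) * cnj (\<tau> (inv x \<otimes> g \<otimes> \<phi> x) $$ (i, j)) = f g * cnj (\<tau> (inv x \<otimes> g \<otimes> \<phi> x) $$ (i, j))"
      using f[of "inv x" g] x g by simp
  qed
  have "of_nat (card (carrier G)) * inner_on (carrier G) f (\<lambda>g. \<tau> g $$ (i, j)) =
    (\<Sum>x\<in>carrier G. \<Sum>g\<in>carrier G. f g * cnj (\<tau> (inv x \<otimes> g \<otimes> \<phi> x) $$ (i, j)))"
    using shift by simp
  also have "\<dots> = inner_on (carrier G) f (\<lambda>g. mat_trace (?C * \<tau> g))"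
    unfolding inner_on_def by (subst sum.swap) (simp add: avg[symmetric] sum_distrib_left)
  also have "\<dots> = 0" by (rule orth[OF coefficient_sum_carrier C])
  finally show ?thesis using fin one_closed by auto
qed

text \<open>The space of functions \<open>g \<mapsto> tr (A \<tau>(g))\<close>, with \<open>A\<close> intertwining \<open>\<tau>\<close> and \<open>\<tau> \<circ> \<phi>\<close>, depends only on
the class of \<open>\<tau>\<close>, and it is at most one-dimensional: after transport to \<open>\<rho>\<close> the matrix \<open>A\<close> becomes
\<open>B\<close>, and \<open>U\<^sup>* B\<close> commutes with \<open>\<rho>\<close>.\<close>

lemma intertwiner_transport:
  assumes \<phi>: "\<phi> \<in> hom G G" and irr: "irreducible_unitary_rep G n \<rho>" and \<tau>: "unitary_rep G n \<tau>"
    and V: "V \<in> carrier (unitary_group n)" "\<And>g. g \<in> carrier G \<Longrightarrow> V * \<rho> g = \<tau> g * V"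
    and U: "U \<in> carrier (unitary_group n)" "\<And>g. g \<in> carrier G \<Longrightarrow> U * \<rho> g = \<rho> (\<phi> g) * U"
    and A: "A \<in> carrier_mat n n" "\<And>g. g \<in> carrier G \<Longrightarrow> A * \<tau> g = \<tau> (\<phi> g) * A"
  obtains c where "\<And>g. g \<in> carrier G \<Longrightarrow> mat_trace (A * \<tau> g) = c * mat_trace (U * \<rho> g)"
proof -
  interpret phi: group_hom G G \<phi> using \<phi> by unfold_locales
  have \<rho>: "unitary_rep G n \<rho>" using irr unfolding irreducible_unitary_rep_def by blast
  note assoc = assoc_mult_mat[of _ n n _ n _ n]
  have Vc: "V \<in> carrier_mat n n" "mat_adjoint V \<in> carrier_mat n n" "V * mat_adjoint V = 1\<^sub>m n"
    using V(1) by (auto simp: unitary_group_simps)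
  have Uc: "U \<in> carrier_mat n n" "mat_adjoint U \<in> carrier_mat n n" "U * mat_adjoint U = 1\<^sub>m n"
    using U(1) by (auto simp: unitary_group_simps)
  have rc: "\<And>g. g \<in> carrier G \<Longrightarrow> \<rho> g \<in> carrier_mat n n" "\<And>g. g \<in> carrier G \<Longrightarrow> \<tau> g \<in> carrier_mat n n"
    using rep_carrier[OF \<rho>] rep_carrier[OF \<tau>] by auto
  have mc: "\<And>X Y. X \<in> carrier_mat n n \<Longrightarrow> Y \<in> carrier_mat n n \<Longrightarrow> X * Y \<in> carrier_mat n n" by simp
  define B where "B = mat_adjoint V * (A * V)"
  have Bc: "B \<in> carrier_mat n n" unfolding B_def by (intro mc Vc A(1))
  have B: "B * \<rho> g = \<rho> (\<phi> g) * B" if g: "g \<in> carrier G" for g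
  proof -
    have pg: "\<phi> g \<in> carrier G" using g by simp
    have "B * \<rho> g = mat_adjoint V * (A * (V * \<rho> g))"
      unfolding B_def using Vc A(1) rc(1)[OF g] by (simp add: assoc mc)
    also have "\<dots> = mat_adjoint V * ((A * \<tau> g) * V)"
      unfolding V(2)[OF g] using Vc A(1) rc(2)[OF g] by (simp add: assoc mc)
    also have "\<dots> = (mat_adjoint V * \<tau> (\<phi> g)) * (A * V)"
      unfolding A(2)[OF g] using Vc A(1) rc(2)[OF pg] by (simp add: assoc mc)
    also have "\<dots> = \<rho> (\<phi> g) * B"
    proof -
      have "mat_adjoint V * \<tau> (\<phi> g) = \<rho> (\<phi> g) * mat_adjoint V"
        by (rule intertwiner_adjoint[OF \<rho> \<tau> Vc(1) _ pg]) (rule V(2))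
      then show ?thesis unfolding B_def using Vc A(1) rc(1)[OF pg] by (simp add: assoc mc)
    qed
    finally show ?thesis .
  qed
  have \<rho>\<phi>: "unitary_rep G n (\<rho> \<circ> \<phi>)" by (rule unitary_rep_comp_hom[OF \<phi> \<rho>])
  have UB: "(mat_adjoint U * B) * \<rho> g = \<rho> g * (mat_adjoint U * B)" if g: "g \<in> carrier G" for g
  proof -
    have pg: "\<phi> g \<in> carrier G" using g by simp
    have "(mat_adjoint U * B) * \<rho> g = (mat_adjoint U * \<rho> (\<phi> g)) * B"
      using Uc Bc rc(1)[OF g] rc(1)[OF pg] B[OF g] by (simp add: assoc mc)
    also have "mat_adjoint U * \<rho> (\<phi> g) = \<rho> g * mat_adjoint U"
      using intertwiner_adjoint[OF \<rho> \<rho>\<phi> Uc(1), of g] U(2) g by simp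
    finally show ?thesis using Uc Bc rc(1)[OF g] by (simp add: assoc mc)
  qed
  obtain c where c: "mat_adjoint U * B = c \<cdot>\<^sub>m 1\<^sub>m n"
    by (rule schur_scalar[OF irr mc[OF Uc(2) Bc] UB])
  have "B = U * mat_adjoint U * B" unfolding Uc(3) using Bc by simp
  also have "\<dots> = U * (c \<cdot>\<^sub>m 1\<^sub>m n)" unfolding assoc_mult_mat[OF Uc(1,2) Bc] c ..
  also have "\<dots> = c \<cdot>\<^sub>m U" using Uc mult_smult_distrib[OF Uc(1) one_carrier_mat, of c] by simp
  finally have BU: "B = c \<cdot>\<^sub>m U" .
  show thesis
  proof (rule that)
    fix g assume g: "g \<in> carrier G"
    have "A * \<tau> g = (A * (\<tau> g * V)) * mat_adjoint V"
      using Vc A(1) rc(2)[OF g] by (simp add: assoc mc)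
    also have "\<dots> = (A * V * \<rho> g) * mat_adjoint V"
      unfolding V(2)[OF g, symmetric] using Vc A(1) rc(1)[OF g] by (simp add: assoc mc)
    finally have "mat_trace (A * \<tau> g) = mat_trace (mat_adjoint V * (A * V * \<rho> g))"
      using mat_trace_comm[OF mc[OF mc[OF A(1) Vc(1)] rc(1)[OF g]] Vc(2)] by simp
    also have "mat_adjoint V * (A * V * \<rho> g) = B * \<rho> g"
      unfolding B_def using Vc A(1) rc(1)[OF g] by (simp add: assoc mc)
    also have "\<dots> = c \<cdot>\<^sub>m (U * \<rho> g)"
      unfolding BU by (rule mult_smult_assoc_mat[OF Uc(1) rc(1)[OF g]])
    finally show "mat_trace (A * \<tau> g) = c * mat_trace (U * \<rho> g)"
      using mat_trace_smult[OF mc[OF Uc(1) rc(1)[OF g]]] by simp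
  qed
qed

text \<open>The functions \<open>F c\<close>, one for each f-point \<open>c\<close>, and the normalised indicators of the Reidemeister
classes are two orthonormal bases of the same space. The first family lies in the span of the
second because its members are constant on classes, which also bounds the number of f-points.
Conversely, the part of an indicator orthogonal to all \<open>F c\<close> is orthogonal to all matrix
coefficients, hence zero.\<close>

theorem TBFT_ff_finite:
  assumes fin: "finite (carrier G)" and \<phi>: "\<phi> \<in> hom G G"
  shows "TBFT_ff G \<phi>"
proof -
  note eqv = equiv_unitary_equiv[OF is_group]
  note eqR = equiv_reidemeister_rel[OF is_group \<phi>]
  interpret phi: group_hom G G \<phi> using \<phi> by unfold_locales
  let ?R = "reidemeister_classes G \<phi>" and ?P = "f_points_ff G \<phi>" and ?I = "carrier G"
  have finR: "finite ?R" unfolding reidemeister_classes_def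
    using fin equiv_type[OF eqR] by (rule finite_quotient)
  have sub: "\<kappa> \<subseteq> ?I" "\<kappa> \<noteq> {}" if "\<kappa> \<in> ?R" for \<kappa>
    using that in_quotient_imp_subset[OF eqR] in_quotient_imp_non_empty[OF eqR]
    unfolding reidemeister_classes_def by blast+
  have disj: "\<kappa> = \<kappa>'" if "\<kappa> \<in> ?R" "\<kappa>' \<in> ?R" "g \<in> \<kappa>" "g \<in> \<kappa>'" for \<kappa> \<kappa>' g
    using that quotient_disj[OF eqR] unfolding reidemeister_classes_def by blast
  let ?b = "part_indicator :: 'a set \<Rightarrow> 'a \<Rightarrow> complex"
  have b_on: "orthonormal_on ?I ?R ?b" by (rule part_indicators_orthonormal[OF fin sub disj])
  have const_span: "f x = (\<Sum>\<kappa>\<in>?R. inner_on ?I f (?b \<kappa>) * ?b \<kappa> x)"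
    if f: "\<And>y g. y \<in> ?I \<Longrightarrow> g \<in> ?I \<Longrightarrow> f (y \<otimes> g \<otimes> \<phi> (inv y)) = f g" and x: "x \<in> ?I" for f x
  proof (rule part_indicator_expansion[OF fin sub disj finR])
    show "reidemeister_rel G \<phi> `` {x} \<in> ?R" unfolding reidemeister_classes_def using x by (rule quotientI)
    show "x \<in> reidemeister_rel G \<phi> `` {x}" by (rule equiv_class_self[OF eqR x])
    show "f g = f x" if "g \<in> reidemeister_rel G \<phi> `` {x}" for g
      using that f x unfolding reidemeister_rel_def by blast
  qed
  have "\<exists>n \<rho> U. irreducible_unitary_rep G n \<rho> \<and> c = unitary_equiv G `` {\<rho>} \<and>
      U \<in> carrier (unitary_group n) \<and> (\<forall>g\<in>?I. U * \<rho> g = \<rho> (\<phi> g) * U)" if c: "c \<in> ?P" for c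
  proof -
    obtain n \<rho> where \<rho>: "irreducible_unitary_rep G n \<rho>" "(\<rho>, \<rho> \<circ> \<phi>) \<in> unitary_equiv G" "c = unitary_equiv G `` {\<rho>}"
      using c unfolding f_points_ff_iff[OF \<phi>] by blast
    have rep: "unitary_rep G n \<rho>" using \<rho>(1) unfolding irreducible_unitary_rep_def by blast
    obtain U where U: "U \<in> carrier (unitary_group n)" "\<And>g. g \<in> ?I \<Longrightarrow> U * \<rho> g = (\<rho> \<circ> \<phi>) g * U"
      by (rule unitary_equiv_obtain[OF \<rho>(2) rep]) (rule that; simp)
    have "\<forall>g\<in>?I. U * \<rho> g = \<rho> (\<phi> g) * U" using U(2) by simp
    then show ?thesis using \<rho>(1,3) U(1) by blast
  qed
  then have "\<forall>c\<in>?P. \<exists>n \<rho> U. irreducible_unitary_rep G n \<rho> \<and> c = unitary_equiv G `` {\<rho>} \<and>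
      U \<in> carrier (unitary_group n) \<and> (\<forall>g\<in>?I. U * \<rho> g = \<rho> (\<phi> g) * U)" by blast
  then obtain n \<rho> U where "\<forall>c\<in>?P. irreducible_unitary_rep G (n c) (\<rho> c) \<and> c = unitary_equiv G `` {\<rho> c} \<and>
      U c \<in> carrier (unitary_group (n c)) \<and> (\<forall>g\<in>?I. U c * \<rho> c g = \<rho> c (\<phi> g) * U c)"
    unfolding bchoice_iff by blast
  then have irr: "\<And>c. c \<in> ?P \<Longrightarrow> irreducible_unitary_rep G (n c) (\<rho> c)"
    and cl: "\<And>c. c \<in> ?P \<Longrightarrow> c = unitary_equiv G `` {\<rho> c}"
    and U: "\<And>c. c \<in> ?P \<Longrightarrow> U c \<in> carrier (unitary_group (n c))"
    and tw: "\<And>c g. c \<in> ?P \<Longrightarrow> g \<in> ?I \<Longrightarrow> U c * \<rho> c g = \<rho> c (\<phi> g) * U c"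
    by blast+
  have rep: "unitary_rep G (n c) (\<rho> c)" if "c \<in> ?P" for c using irr[OF that] unfolding irreducible_unitary_rep_def by blast
  have Uc: "U c \<in> carrier_mat (n c) (n c)" if "c \<in> ?P" for c using U[OF that] by (simp add: unitary_group_simps)
  let ?s = "complex_of_real (1 / sqrt (card ?I))"
  define F where "F c g = ?s * mat_trace (U c * \<rho> c g)" for c g
  have F_inv: "F c (x \<otimes> g \<otimes> \<phi> (inv x)) = F c g" if "c \<in> ?P" "x \<in> ?I" "g \<in> ?I" for c x g
    unfolding F_def using mat_trace_twisted_invariant[OF \<phi> rep[OF that(1)] Uc[OF that(1)] tw[OF that(1)] that(2,3)] by simp
  have ss: "?s * (?s * of_nat (card ?I)) = 1"
  proof -
    have "?s * (?s * of_nat (card ?I)) = complex_of_real (1 / sqrt (card ?I) * (1 / sqrt (card ?I) * real (card ?I)))"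
      by (simp only: of_real_mult of_real_of_nat_eq)
    also have "1 / sqrt (card ?I) * (1 / sqrt (card ?I) * real (card ?I)) = 1"
      using fin one_closed by (simp add: field_simps card_gt_0_iff) blast
    finally show ?thesis by simp
  qed
  have F_on: "orthonormal_on ?I J F" if J: "J \<subseteq> ?P" for J
    unfolding orthonormal_on_def
  proof (intro ballI)
    fix c d assume cd: "c \<in> J" "d \<in> J"
    have c: "c \<in> ?P" "d \<in> ?P" using cd J by auto
    show "inner_on ?I (F c) (F d) = (if c = d then 1 else 0)"
    proof (cases "c = d")
      case True
      have "inner_on ?I (F c) (F c) = ?s * (cnj ?s * of_nat (card ?I))"
        unfolding F_def inner_on_scale_left inner_on_scale_right inner_on_mat_trace_self[OF fin irr[OF c(1)] U[OF c(1)]] ..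
      also have "cnj ?s = ?s" by (rule complex_cnj_complex_of_real)
      finally show ?thesis using True ss by simp
    next
      case False
      have "(\<rho> d, \<rho> c) \<notin> unitary_equiv G"
      proof
        assume "(\<rho> d, \<rho> c) \<in> unitary_equiv G"
        then have "unitary_equiv G `` {\<rho> d} = unitary_equiv G `` {\<rho> c}" by (rule equiv_class_eq[OF eqv])
        then show False using False cl[OF c(1)] cl[OF c(2)] by simp
      qed
      then have "inner_on ?I (F c) (F d) = ?s * (cnj ?s * 0)"
        unfolding F_def inner_on_scale_left inner_on_scale_right
        using inner_on_mat_trace_inequivalent[OF irr[OF c(1)] irr[OF c(2)] _ Uc[OF c(1)] Uc[OF c(2)]] by simp
      then show ?thesis using False by simp
    qed
  qed
  have "card J \<le> card ?R" if J: "J \<subseteq> ?P" "finite J" for J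
  proof (rule orthonormal_on_card_le[OF J(2) finR F_on[OF J(1)] b_on])
    fix c x assume "c \<in> J" "x \<in> ?I"
    then show "F c x = (\<Sum>\<kappa>\<in>?R. inner_on ?I (F c) (?b \<kappa>) * ?b \<kappa> x)"
      using J(1) F_inv by (intro const_span) auto
  qed
  then have finP: "finite ?P" and le: "card ?P \<le> card ?R"
    using finite_if_finite_subsets_card_bdd[of ?P "card ?R"] by auto
  have "card ?R \<le> card ?P"
  proof (rule orthonormal_on_card_le[OF finR finP b_on F_on[OF subset_refl]])
    fix \<kappa> x assume \<kappa>: "\<kappa> \<in> ?R" and x: "x \<in> ?I"
    define r where "r g = ?b \<kappa> g - (\<Sum>c\<in>?P. inner_on ?I (?b \<kappa>) (F c) * F c g)" for g
    have b_inv: "?b \<kappa> (y \<otimes> g \<otimes> \<phi> (inv y)) = ?b \<kappa> g" if "y \<in> ?I" "g \<in> ?I" for y g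
    proof -
      have "(g, y \<otimes> g \<otimes> \<phi> (inv y)) \<in> reidemeister_rel G \<phi>"
        using that by (intro reidemeister_relI[of _ _ _ y]) auto
      then have "g \<in> \<kappa> \<longleftrightarrow> y \<otimes> g \<otimes> \<phi> (inv y) \<in> \<kappa>"
        using \<kappa> in_quotient_imp_closed[OF eqR] equivE[OF eqR] unfolding reidemeister_classes_def by (meson symD)
      then show ?thesis unfolding part_indicator_def by simp
    qed
    have r_inv: "r (y \<otimes> g \<otimes> \<phi> (inv y)) = r g" if "y \<in> ?I" "g \<in> ?I" for y g
      unfolding r_def using b_inv[OF that] F_inv[OF _ that] by simp
    have rF: "inner_on ?I r (F c) = 0" if "c \<in> ?P" for c
      unfolding r_def using orthonormal_on_residual(1)[OF finP F_on[OF subset_refl] that] .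
    have "r \<in> coefficient_orthogonal"
      unfolding coefficient_orthogonal_def
    proof clarify
      fix m \<tau> i j assume \<tau>: "irreducible_unitary_rep G m \<tau>" and ij: "i < m" "j < m"
      have rep\<tau>: "unitary_rep G m \<tau>" using \<tau> unfolding irreducible_unitary_rep_def by blast
      show "inner_on ?I r (\<lambda>g. \<tau> g $$ (i, j)) = 0"
      proof (rule twisted_invariant_coefficient[OF fin \<phi> rep\<tau> ij r_inv])
        fix A assume A: "A \<in> carrier_mat m m" "\<And>g. g \<in> ?I \<Longrightarrow> A * \<tau> g = \<tau> (\<phi> g) * A"
        show "inner_on ?I r (\<lambda>g. mat_trace (A * \<tau> g)) = 0"
        proof (cases "A = 0\<^sub>m m m")
          case True
          have "inner_on ?I r (\<lambda>g. mat_trace (A * \<tau> g)) = inner_on ?I r (\<lambda>g. 0)"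
            using left_mult_zero_mat[OF rep_carrier[OF rep\<tau>]] by (intro inner_on_cong) (auto simp: True mat_trace_def)
          then show ?thesis by (simp add: inner_on_def)
        next
          case False
          have eq\<phi>: "(\<tau>, \<tau> \<circ> \<phi>) \<in> unitary_equiv G"
            by (rule equiv_if_intertwiner[OF \<tau> unitary_rep_comp_hom[OF \<phi> rep\<tau>] A(1) False]) (simp add: A(2))
          have "factors_through_finite_group G m \<tau>"
            by (rule factors_through_finite_groupI[OF is_group fin, of "\<lambda>g. g" m \<tau>]) (auto simp: hom_def rep\<tau>)
          then have c: "unitary_equiv G `` {\<tau>} \<in> ?P" using f_points_ff_iff[OF \<phi>] \<tau> eq\<phi> by blast
          let ?c = "unitary_equiv G `` {\<tau>}"
          have "\<tau> \<in> ?c" using equiv_class_self[OF eqv, of \<tau>] rep\<tau> by blast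
          then have \<rho>\<tau>: "(\<rho> ?c, \<tau>) \<in> unitary_equiv G" using cl[OF c] by blast
          obtain V where V: "V \<in> carrier (unitary_group (n ?c))" "unitary_rep G (n ?c) \<tau>"
            "\<And>g. g \<in> ?I \<Longrightarrow> V * \<rho> ?c g = \<tau> g * V"
            by (rule unitary_equiv_obtain[OF \<rho>\<tau> rep[OF c]]) (rule that; simp)
          have [simp]: "n ?c = m"
            using rep_carrier[OF V(2) one_closed] rep_carrier[OF rep\<tau> one_closed] by auto
          obtain a where a: "\<And>g. g \<in> ?I \<Longrightarrow> mat_trace (A * \<tau> g) = a * mat_trace (U ?c * \<rho> ?c g)"
            using intertwiner_transport[OF \<phi> irr[OF c] V(2) V(1) V(3) U[OF c] tw[OF c], of A] A by auto
          have s0: "?s \<noteq> 0" using ss by auto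
          have "inner_on ?I r (\<lambda>g. mat_trace (A * \<tau> g)) = inner_on ?I r (\<lambda>g. (a / ?s) * F ?c g)"
            using s0 by (intro inner_on_cong) (auto simp: a F_def)
          also have "\<dots> = 0" unfolding inner_on_scale_right rF[OF c] by simp
          finally show ?thesis .
        qed
      qed
    qed
    then have "r x = 0" using coefficients_complete[OF fin _ x] by blast
    then show "?b \<kappa> x = (\<Sum>c\<in>?P. inner_on ?I (?b \<kappa>) (F c) * F c x)" unfolding r_def by simp
  qed
  with le finP finR show ?thesis unfolding TBFT_ff_def reidemeister_number_def by simp
qed

end

section \<open>Passage to finite quotients\<close>

text \<open>A finite quotient \<open>Q\<close> of \<open>G\<close> on which \<open>\<phi>\<close> induces an endomorphism.\<close>

locale equivariant_quotient = G: group G + Q: group Q for G (structure) and Q (structure) +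
  fixes \<pi> \<phi> \<phi>Q
  assumes \<pi>: "\<pi> \<in> hom G Q" and surj: "\<pi> ` carrier G = carrier Q" and fin: "finite (carrier Q)"
    and \<phi>: "\<phi> \<in> hom G G" and \<phi>Q: "\<phi>Q \<in> hom Q Q"
    and commute: "g \<in> carrier G \<Longrightarrow> \<phi>Q (\<pi> g) = \<pi> (\<phi> g)"
begin

sublocale \<pi>: group_hom G Q \<pi>
  using \<pi> by unfold_locales

sublocale \<phi>: group_hom G G \<phi>
  using \<phi> by unfold_locales

lemma image_reidemeister_class:
  assumes g: "g \<in> carrier G"
  shows "\<pi> ` (reidemeister_rel G \<phi> `` {g}) = reidemeister_rel Q \<phi>Q `` {\<pi> g}"
proof -
  have img: "\<pi> (x \<otimes>\<^bsub>G\<^esub> g \<otimes>\<^bsub>G\<^esub> \<phi> (inv\<^bsub>G\<^esub> x)) = \<pi> x \<otimes>\<^bsub>Q\<^esub> \<pi> g \<otimes>\<^bsub>Q\<^esub> \<phi>Q (inv\<^bsub>Q\<^esub> \<pi> x)"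
    if x: "x \<in> carrier G" for x
    using commute[of "inv\<^bsub>G\<^esub> x"] x g by simp
  have "reidemeister_rel Q \<phi>Q `` {\<pi> g} = {\<pi> x \<otimes>\<^bsub>Q\<^esub> \<pi> g \<otimes>\<^bsub>Q\<^esub> \<phi>Q (inv\<^bsub>Q\<^esub> \<pi> x) | x. x \<in> carrier G}"
  proof -
    have cl: "\<pi> x \<otimes>\<^bsub>Q\<^esub> \<pi> g \<otimes>\<^bsub>Q\<^esub> \<phi>Q (inv\<^bsub>Q\<^esub> \<pi> x) \<in> carrier Q" if "x \<in> carrier G" for x
      using img[OF that, symmetric] that g by simp
    have "\<pi> g \<in> carrier Q" using g by simp
    then have "reidemeister_rel Q \<phi>Q `` {\<pi> g} = {h. h \<in> carrier Q \<and> (\<exists>y \<in> \<pi> ` carrier G. h = y \<otimes>\<^bsub>Q\<^esub> \<pi> g \<otimes>\<^bsub>Q\<^esub> \<phi>Q (inv\<^bsub>Q\<^esub> y))}"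
      unfolding surj reidemeister_rel_def by blast
    then show ?thesis using cl by blast
  qed
  also have "\<dots> = {\<pi> (x \<otimes>\<^bsub>G\<^esub> g \<otimes>\<^bsub>G\<^esub> \<phi> (inv\<^bsub>G\<^esub> x)) | x. x \<in> carrier G}"
    by (rule Collect_cong) (metis img)
  also have "\<dots> = \<pi> ` (reidemeister_rel G \<phi> `` {g})"
  proof -
    have "reidemeister_rel G \<phi> `` {g} = {x \<otimes>\<^bsub>G\<^esub> g \<otimes>\<^bsub>G\<^esub> \<phi> (inv\<^bsub>G\<^esub> x) | x. x \<in> carrier G}"
    proof -
      have "x \<otimes>\<^bsub>G\<^esub> g \<otimes>\<^bsub>G\<^esub> \<phi> (inv\<^bsub>G\<^esub> x) \<in> carrier G" if "x \<in> carrier G" for x using that g by simp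
      then show ?thesis unfolding reidemeister_rel_def using g by blast
    qed
    then show ?thesis by (simp add: Setcompr_eq_image image_image)
  qed
  finally show ?thesis ..
qed

lemma reidemeister_classes_quotient:
  "reidemeister_classes Q \<phi>Q = (`) \<pi> ` reidemeister_classes G \<phi>"
proof -
  have "reidemeister_classes Q \<phi>Q = (\<lambda>g. reidemeister_rel Q \<phi>Q `` {\<pi> g}) ` carrier G"
    unfolding reidemeister_classes_def quotient_def surj[symmetric] by auto
  also have "\<dots> = (\<lambda>g. \<pi> ` (reidemeister_rel G \<phi> `` {g})) ` carrier G"
    by (rule image_cong[OF refl]) (simp add: image_reidemeister_class)
  also have "\<dots> = (`) \<pi> ` reidemeister_classes G \<phi>"
    unfolding reidemeister_classes_def quotient_def by auto
  finally show ?thesis .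
qed

lemma card_reidemeister_quotient_le:
  "finite (reidemeister_classes G \<phi>) \<Longrightarrow> card (reidemeister_classes Q \<phi>Q) \<le> card (reidemeister_classes G \<phi>)"
  unfolding reidemeister_classes_quotient by (rule card_image_le)

text \<open>Reidemeister classes that are unions of fibres of \<open>\<pi>\<close> have distinct images.\<close>

lemma card_reidemeister_quotient_eq:
  assumes sat: "\<And>g h. g \<in> carrier G \<Longrightarrow> h \<in> carrier G \<Longrightarrow> \<pi> g = \<pi> h \<Longrightarrow> (g, h) \<in> reidemeister_rel G \<phi>"
  shows "card (reidemeister_classes Q \<phi>Q) = card (reidemeister_classes G \<phi>)"
proof -
  note eq = equiv_reidemeister_rel[OF G.is_group \<phi>]
  have "inj_on ((`) \<pi>) (reidemeister_classes G \<phi>)"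
  proof (rule inj_onI)
    fix A B assume A: "A \<in> reidemeister_classes G \<phi>" and B: "B \<in> reidemeister_classes G \<phi>" and AB: "\<pi> ` A = \<pi> ` B"
    note q = A[unfolded reidemeister_classes_def] B[unfolded reidemeister_classes_def]
    obtain g where g: "g \<in> A" using in_quotient_imp_non_empty[OF eq q(1)] by blast
    then have "\<pi> g \<in> \<pi> ` B" using AB by blast
    then obtain h where h: "h \<in> B" "\<pi> g = \<pi> h" by blast
    have "(g, h) \<in> reidemeister_rel G \<phi>"
      using g h in_quotient_imp_subset[OF eq q(1)] in_quotient_imp_subset[OF eq q(2)] by (intro sat) auto
    then show "A = B" using quotient_eq_iff[OF eq q g h(1)] by blast
  qed
  then show ?thesis unfolding reidemeister_classes_quotient by (rule card_image)
qed

text \<open>Here and below the representation of \<open>G\<close> is only required to agree with the pullback on the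
carrier. Thus a given representation of \<open>G\<close> with suitable kernel and a composition with \<open>\<pi>\<close>
are treated alike.\<close>

lemma unitary_equiv_pullback:
  assumes \<rho>: "unitary_rep Q n \<rho>" and \<sigma>: "unitary_rep Q m \<sigma>"
    and \<rho>': "unitary_rep G n \<rho>'" "\<And>g. g \<in> carrier G \<Longrightarrow> \<rho>' g = \<rho> (\<pi> g)"
    and \<sigma>': "unitary_rep G m \<sigma>'" "\<And>g. g \<in> carrier G \<Longrightarrow> \<sigma>' g = \<sigma> (\<pi> g)"
  shows "(\<rho>', \<sigma>') \<in> unitary_equiv G \<longleftrightarrow> (\<rho>, \<sigma>) \<in> unitary_equiv Q"
proof
  assume "(\<rho>', \<sigma>') \<in> unitary_equiv G"
  then obtain U where U: "U \<in> carrier (unitary_group n)" "unitary_rep G n \<sigma>'"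
    "\<And>g. g \<in> carrier G \<Longrightarrow> U * \<rho>' g = \<sigma>' g * U"
    by (rule G.unitary_equiv_obtain[OF _ \<rho>'(1)]) (rule that; simp)
  have "n = m"
    using G.rep_carrier[OF U(2) G.one_closed] G.rep_carrier[OF \<sigma>'(1) G.one_closed] by auto
  show "(\<rho>, \<sigma>) \<in> unitary_equiv Q"
  proof (rule unitary_equivI[OF \<rho> _ U(1)])
    show "unitary_rep Q n \<sigma>" using \<sigma> \<open>n = m\<close> by simp
    fix q assume "q \<in> carrier Q"
    then obtain g where "g \<in> carrier G" "q = \<pi> g" using surj by blast
    then show "U * \<rho> q = \<sigma> q * U" using U(3)[of g] \<rho>'(2) \<sigma>'(2) by simp
  qed
next
  assume "(\<rho>, \<sigma>) \<in> unitary_equiv Q"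
  then obtain U where U: "U \<in> carrier (unitary_group n)" "unitary_rep Q n \<sigma>"
    "\<And>g. g \<in> carrier Q \<Longrightarrow> U * \<rho> g = \<sigma> g * U"
    by (rule Q.unitary_equiv_obtain[OF _ \<rho>]) (rule that; simp)
  have "n = m"
    using Q.rep_carrier[OF U(2) Q.one_closed] Q.rep_carrier[OF \<sigma> Q.one_closed] by auto
  show "(\<rho>', \<sigma>') \<in> unitary_equiv G"
  proof (rule unitary_equivI[OF \<rho>'(1) _ U(1)])
    show "unitary_rep G n \<sigma>'" using \<sigma>'(1) \<open>n = m\<close> by simp
    fix g assume "g \<in> carrier G"
    then show "U * \<rho>' g = \<sigma>' g * U" using U(3)[of "\<pi> g"] \<rho>'(2) \<sigma>'(2) by simp
  qed
qed

lemma irreducible_pullback: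
  assumes \<rho>: "unitary_rep Q n \<rho>"
    and \<rho>': "unitary_rep G n \<rho>'" "\<And>g. g \<in> carrier G \<Longrightarrow> \<rho>' g = \<rho> (\<pi> g)"
  shows "irreducible_unitary_rep G n \<rho>' \<longleftrightarrow> irreducible_unitary_rep Q n \<rho>"
proof -
  have "(\<forall>g\<in>carrier G. \<forall>v\<in>W. \<rho>' g *\<^sub>v v \<in> W) \<longleftrightarrow> (\<forall>q\<in>carrier Q. \<forall>v\<in>W. \<rho> q *\<^sub>v v \<in> W)" for W
    unfolding surj[symmetric] using \<rho>'(2) by simp
  then show ?thesis unfolding irreducible_unitary_rep_def using \<rho> \<rho>'(1) by simp
qed

lemma f_point_pullback:
  assumes \<rho>: "unitary_rep Q n \<rho>"
    and \<rho>': "unitary_rep G n \<rho>'" "\<And>g. g \<in> carrier G \<Longrightarrow> \<rho>' g = \<rho> (\<pi> g)"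
    and irr: "irreducible_unitary_rep G n \<rho>'"
  shows "unitary_equiv G `` {\<rho>'} \<in> f_points_ff G \<phi> \<longleftrightarrow> unitary_equiv Q `` {\<rho>} \<in> f_points_ff Q \<phi>Q" (is "?G \<longleftrightarrow> ?Q")
    and "unitary_equiv Q `` {\<rho>} \<in> f_points_ff Q \<phi>Q \<longleftrightarrow> (\<rho>', \<rho>' \<circ> \<phi>) \<in> unitary_equiv G" (is "_ \<longleftrightarrow> ?E")
proof -
  have irrQ: "irreducible_unitary_rep Q n \<rho>" using irr irreducible_pullback[OF \<rho> \<rho>'] by blast
  have E: "(\<rho>', \<rho>' \<circ> \<phi>) \<in> unitary_equiv G \<longleftrightarrow> (\<rho>, \<rho> \<circ> \<phi>Q) \<in> unitary_equiv Q"
  proof (rule unitary_equiv_pullback[OF \<rho> Q.unitary_rep_comp_hom[OF \<phi>Q \<rho>] \<rho>' G.unitary_rep_comp_hom[OF \<phi> \<rho>'(1)]])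
    fix g assume "g \<in> carrier G"
    then show "(\<rho>' \<circ> \<phi>) g = (\<rho> \<circ> \<phi>Q) (\<pi> g)" using \<rho>'(2)[of "\<phi> g"] commute[of g] by simp
  qed
  have ffG: "factors_through_finite_group G n \<rho>'"
    by (rule G.factors_through_finite_groupI[OF Q.is_group fin \<pi> \<rho> \<rho>'(2)])
  have ffQ: "factors_through_finite_group Q n \<rho>"
    by (rule Q.factors_through_finite_groupI[OF Q.is_group fin, of "\<lambda>q. q" n \<rho>]) (auto simp: hom_def \<rho>)
  have self: "(\<rho>, \<rho> \<circ> \<phi>Q) \<in> unitary_equiv Q" if q: ?Q
    by (rule Q.f_point_member[OF \<phi>Q q])
      (use \<rho> equiv_class_self[OF equiv_unitary_equiv[OF Q.is_group], of \<rho>] in blast)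
  have selfG: "(\<rho>', \<rho>' \<circ> \<phi>) \<in> unitary_equiv G" if g: ?G
    by (rule G.f_point_member[OF \<phi> g])
      (use \<rho>'(1) equiv_class_self[OF equiv_unitary_equiv[OF G.is_group], of \<rho>'] in blast)
  have GE: ?G if ?E using that irr ffG G.f_points_ff_iff[OF \<phi>] by blast
  have QE: ?Q if "(\<rho>, \<rho> \<circ> \<phi>Q) \<in> unitary_equiv Q" using that irrQ ffQ Q.f_points_ff_iff[OF \<phi>Q] by blast
  show "?Q \<longleftrightarrow> ?E" using self QE E by blast
  then show "?G \<longleftrightarrow> ?Q" using selfG GE by blast
qed

end

context group
begin

lemma equivariant_quotient_Mod:
  assumes N: "N \<lhd> G" "finite_index G N (carrier G)" and \<phi>: "\<phi> \<in> hom G G" "\<phi> ` N \<subseteq> N"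
  obtains \<phi>Q where "equivariant_quotient G (G Mod N) (\<lambda>x. N #> x) \<phi> \<phi>Q"
proof -
  interpret N: normal N G by fact
  interpret phi: group_hom G G \<phi> using \<phi>(1) by unfold_locales
  have hom: "(\<lambda>x. N #> x) \<in> hom G (G Mod N)" by (rule N.r_coset_hom_Mod)
  have eq: "N #> x = N #> y \<longleftrightarrow> x \<otimes> inv y \<in> N" if "x \<in> carrier G" "y \<in> carrier G" for x y
  proof
    assume "N #> x = N #> y"
    then have "x \<in> N #> y" using rcos_self[OF that(1) N.subgroup_axioms] by simp
    then show "x \<otimes> inv y \<in> N" by (rule N.rcos_module_imp[OF is_group that(2)])
  next
    assume "x \<otimes> inv y \<in> N"
    then have "x \<in> N #> y" by (rule N.rcos_module_rev[OF is_group that(2,1)])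
    then show "N #> x = N #> y" using repr_independence[OF _ that(2) N.subgroup_axioms] by simp
  qed
  have comp: "(\<lambda>x. N #> \<phi> x) \<in> hom G (G Mod N)"
    using Group.hom_compose[OF \<phi>(1) hom] by (simp add: comp_def)
  obtain \<phi>Q where \<phi>Q: "\<phi>Q \<in> hom (G Mod N) (G Mod N)" "\<And>x. x \<in> carrier G \<Longrightarrow> \<phi>Q (N #> x) = N #> \<phi> x"
  proof (rule FactGroup_universal[OF comp N(1)])
    fix x y assume xy: "x \<in> carrier G" "y \<in> carrier G" "N #> x = N #> y"
    then have "\<phi> (x \<otimes> inv y) \<in> N" using eq \<phi>(2) by blast
    then show "N #> \<phi> x = N #> \<phi> y" using eq[of "\<phi> x" "\<phi> y"] xy(1,2) by simp
  next
    fix g assume "g \<in> hom (G Mod N) (G Mod N)" "\<And>x. x \<in> carrier G \<Longrightarrow> g (N #> x) = N #> \<phi> x"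
    then show thesis by (rule that)
  qed
  have "equivariant_quotient G (G Mod N) (\<lambda>x. N #> x) \<phi> \<phi>Q"
  proof (intro equivariant_quotient.intro equivariant_quotient_axioms.intro is_group N.factorgroup_is_group hom \<phi>(1) \<phi>Q)
    show "(\<lambda>x. N #> x) ` carrier G = carrier (G Mod N)" by (simp add: carrier_FactGroup)
    show "finite (carrier (G Mod N))"
      using finite_rcosets_if_finite_index[OF N.subgroup_axioms N(2)] by (simp add: FactGroup_def)
  qed
  then show thesis by (rule that)
qed

lemma rep_kernel:
  assumes \<rho>: "unitary_rep G n \<rho>" and ff: "factors_through_finite_group G n \<rho>"
  shows "{g \<in> carrier G. \<rho> g = 1\<^sub>m n} \<lhd> G"
    and "finite_index G {g \<in> carrier G. \<rho> g = 1\<^sub>m n} (carrier G)"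
    and "\<And>x y. x \<in> carrier G \<Longrightarrow> y \<in> carrier G \<Longrightarrow> \<rho> (x \<otimes> inv y) = 1\<^sub>m n \<longleftrightarrow> \<rho> x = \<rho> y"
proof -
  interpret U: group "unitary_group n" by (rule group_unitary_group)
  interpret r: group_hom G "unitary_group n" \<rho> using \<rho> unfolding unitary_rep_def by unfold_locales
  show "{g \<in> carrier G. \<rho> g = 1\<^sub>m n} \<lhd> G"
    using r.normal_kernel unfolding kernel_def by (simp add: unitary_group_simps)
  show eq: "\<rho> (x \<otimes> inv y) = 1\<^sub>m n \<longleftrightarrow> \<rho> x = \<rho> y" if xy: "x \<in> carrier G" "y \<in> carrier G" for x y
  proof -
    have c: "\<rho> x \<in> carrier (unitary_group n)" "\<rho> y \<in> carrier (unitary_group n)" using xy by simp_all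
    have "\<rho> (x \<otimes> inv y) = \<rho> x \<otimes>\<^bsub>unitary_group n\<^esub> inv\<^bsub>unitary_group n\<^esub> \<rho> y" using xy by simp
    moreover have "\<dots> = \<one>\<^bsub>unitary_group n\<^esub> \<longleftrightarrow> \<rho> x = \<rho> y"
      using U.inv_solve_right'[OF U.one_closed c] U.l_one[OF c(2)] c by auto
    ultimately show ?thesis by (simp add: unitary_group_simps(3))
  qed
  obtain F :: "nat monoid" and \<pi> \<sigma> where F: "finite (carrier F)" "\<pi> \<in> hom G F" "\<forall>g\<in>carrier G. \<rho> g = \<sigma> (\<pi> g)"
    using ff unfolding factors_through_finite_group_def by blast
  show "finite_index G {g \<in> carrier G. \<rho> g = 1\<^sub>m n} (carrier G)"
  proof (rule finite_indexI_map[of \<pi>])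
    show "finite (\<pi> ` carrier G)" using F(1,2) by (auto simp: hom_def intro: finite_subset[of _ "carrier F"])
    fix x y assume xy: "x \<in> carrier G" "y \<in> carrier G" "\<pi> x = \<pi> y"
    then have "\<rho> x = \<rho> y" using F(3) by simp
    then show "x \<otimes> inv y \<in> {g \<in> carrier G. \<rho> g = 1\<^sub>m n}" using eq[OF xy(1,2)] xy(1,2) by simp
  qed
qed

text \<open>Representatives of finitely many f-points have \<open>\<phi>\<close>-invariant kernels of finite index, because
\<open>\<rho> \<circ> \<phi>\<close> has the same kernel as \<open>\<rho>\<close>. Modulo the intersection \<open>N\<close> of the kernels they remain distinct
f-points, and the Reidemeister number of a quotient is at most that of \<open>G\<close>.\<close>

lemma finite_f_points_le:
  assumes \<phi>: "\<phi> \<in> hom G G" and finR: "finite (reidemeister_classes G \<phi>)"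
    and J: "J \<subseteq> f_points_ff G \<phi>" "finite J"
  shows "card J \<le> card (reidemeister_classes G \<phi>)"
proof -
  interpret phi: group_hom G G \<phi> using \<phi> by unfold_locales
  note eqv = equiv_unitary_equiv[OF is_group]
  have "\<forall>c\<in>J. \<exists>n \<rho>. irreducible_unitary_rep G n \<rho> \<and> factors_through_finite_group G n \<rho> \<and>
    (\<rho>, \<rho> \<circ> \<phi>) \<in> unitary_equiv G \<and> c = unitary_equiv G `` {\<rho>}"
    using J(1) f_points_ff_iff[OF \<phi>] by blast
  then obtain n \<rho> where "\<forall>c\<in>J. irreducible_unitary_rep G (n c) (\<rho> c) \<and> factors_through_finite_group G (n c) (\<rho> c) \<and>
    (\<rho> c, \<rho> c \<circ> \<phi>) \<in> unitary_equiv G \<and> c = unitary_equiv G `` {\<rho> c}"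
    unfolding bchoice_iff by blast
  then have irr: "\<And>c. c \<in> J \<Longrightarrow> irreducible_unitary_rep G (n c) (\<rho> c)"
    and ff: "\<And>c. c \<in> J \<Longrightarrow> factors_through_finite_group G (n c) (\<rho> c)"
    and fp: "\<And>c. c \<in> J \<Longrightarrow> (\<rho> c, \<rho> c \<circ> \<phi>) \<in> unitary_equiv G"
    and cl: "\<And>c. c \<in> J \<Longrightarrow> c = unitary_equiv G `` {\<rho> c}"
    by blast+
  have rep: "\<And>c. c \<in> J \<Longrightarrow> unitary_rep G (n c) (\<rho> c)" using irr unfolding irreducible_unitary_rep_def by blast
  let ?K = "\<lambda>c. {g \<in> carrier G. \<rho> c g = 1\<^sub>m (n c)}"
  define N where "N = {g \<in> carrier G. \<forall>c\<in>J. g \<in> ?K c}"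
  have K: "?K c \<lhd> G" "finite_index G (?K c) (carrier G)" if "c \<in> J" for c
    using rep_kernel(1,2)[OF rep[OF that] ff[OF that]] by auto
  have fiN: "finite_index G N (carrier G)"
    unfolding N_def by (rule finite_index_Inter[OF J(2) subgroup_self normal_imp_subgroup[OF K(1)] K(2)])
  have N: "N \<lhd> G"
    unfolding normal_inv_iff
  proof (intro conjI ballI)
    note sK = normal_imp_subgroup[OF K(1)]
    show "subgroup N G"
    proof (rule subgroupI)
      show "N \<subseteq> carrier G" unfolding N_def by blast
      have "\<one> \<in> N" unfolding N_def using subgroup.one_closed[OF sK] by blast
      then show "N \<noteq> {}" by blast
      fix a assume a: "a \<in> N"
      have aK: "a \<in> ?K c" if "c \<in> J" for c using a that unfolding N_def by blast
      have aC: "a \<in> carrier G" using a unfolding N_def by blast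
      have "inv a \<in> ?K c" if "c \<in> J" for c by (rule subgroup.m_inv_closed[OF sK[OF that] aK[OF that]])
      then show "inv a \<in> N" using aC unfolding N_def by simp
      fix b assume b: "b \<in> N"
      have bK: "b \<in> ?K c" if "c \<in> J" for c using b that unfolding N_def by blast
      have bC: "b \<in> carrier G" using b unfolding N_def by blast
      have "a \<otimes> b \<in> ?K c" if "c \<in> J" for c by (rule subgroup.m_closed[OF sK[OF that] aK[OF that] bK[OF that]])
      then show "a \<otimes> b \<in> N" using aC bC unfolding N_def by simp
    qed
    fix x h assume x: "x \<in> carrier G" and h: "h \<in> N"
    have hK: "h \<in> ?K c" if "c \<in> J" for c using h that unfolding N_def by blast
    have "x \<otimes> h \<otimes> inv x \<in> ?K c" if "c \<in> J" for c
      by (rule normal.inv_op_closed2[OF K(1)[OF that] x hK[OF that]])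
    moreover have "h \<in> carrier G" using h unfolding N_def by blast
    ultimately show "x \<otimes> h \<otimes> inv x \<in> N" using x unfolding N_def by simp
  qed
  have \<phi>N: "\<phi> ` N \<subseteq> N"
  proof
    fix y assume "y \<in> \<phi> ` N"
    then obtain g where g: "g \<in> N" "y = \<phi> g" by blast
    have gC: "g \<in> carrier G" "\<phi> g \<in> carrier G" using g(1) unfolding N_def by auto
    have "\<rho> c (\<phi> g) = 1\<^sub>m (n c)" if c: "c \<in> J" for c
    proof -
      obtain U where U: "U \<in> carrier (unitary_group (n c))" "\<And>g. g \<in> carrier G \<Longrightarrow> U * \<rho> c g = (\<rho> c \<circ> \<phi>) g * U"
        by (rule unitary_equiv_obtain[OF fp[OF c] rep[OF c]]) (rule that; simp)
      have Uc: "U \<in> carrier_mat (n c) (n c)" "U * mat_adjoint U = 1\<^sub>m (n c)" using U(1) by (auto simp: unitary_group_simps)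
      have rc: "\<rho> c (\<phi> g) \<in> carrier_mat (n c) (n c)" by (rule rep_carrier[OF rep[OF c] gC(2)])
      have "\<rho> c g = 1\<^sub>m (n c)" using g(1) c unfolding N_def by blast
      then have "U = \<rho> c (\<phi> g) * U" using U(2)[OF gC(1)] Uc(1) by simp
      then have "U * mat_adjoint U = \<rho> c (\<phi> g) * (U * mat_adjoint U)"
        using assoc_mult_mat[OF rc Uc(1) mat_adjoint_carrier[OF Uc(1)]] by simp
      then show ?thesis unfolding Uc(2) using rc by simp
    qed
    then show "y \<in> N" using g(2) gC unfolding N_def by simp
  qed
  obtain \<phi>Q where "equivariant_quotient G (G Mod N) (\<lambda>x. N #> x) \<phi> \<phi>Q"
    by (rule equivariant_quotient_Mod[OF N fiN \<phi> \<phi>N])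
  then interpret Q: equivariant_quotient G "G Mod N" "\<lambda>x. N #> x" \<phi> \<phi>Q .
  have "\<exists>\<sigma>. unitary_rep (G Mod N) (n c) \<sigma> \<and> (\<forall>g\<in>carrier G. \<rho> c g = \<sigma> (N #> g))" if c: "c \<in> J" for c
  proof -
    have h: "\<rho> c \<in> hom G (unitary_group (n c))" using rep[OF c] unfolding unitary_rep_def .
    obtain \<sigma> where "\<sigma> \<in> hom (G Mod N) (unitary_group (n c))" "\<And>x. x \<in> carrier G \<Longrightarrow> \<sigma> (N #> x) = \<rho> c x"
    proof (rule FactGroup_universal[OF h N])
      fix x y assume xy: "x \<in> carrier G" "y \<in> carrier G" "N #> x = N #> y"
      have "x \<in> N #> y" using rcos_self[OF xy(1) normal_imp_subgroup[OF N]] xy(3) by simp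
      then have "x \<otimes> inv y \<in> N" by (rule subgroup.rcos_module_imp[OF normal_imp_subgroup[OF N] is_group xy(2)])
      then have "\<rho> c (x \<otimes> inv y) = 1\<^sub>m (n c)" using c unfolding N_def by blast
      then show "\<rho> c x = \<rho> c y" using rep_kernel(3)[OF rep[OF c] ff[OF c] xy(1,2)] by blast
    next
      fix \<sigma> assume "\<sigma> \<in> hom (G Mod N) (unitary_group (n c))" "\<And>x. x \<in> carrier G \<Longrightarrow> \<sigma> (N #> x) = \<rho> c x"
      then show thesis by (rule that)
    qed
    then show ?thesis unfolding unitary_rep_def by (intro exI[of _ \<sigma>]) simp
  qed
  then have "\<forall>c\<in>J. \<exists>\<sigma>. unitary_rep (G Mod N) (n c) \<sigma> \<and> (\<forall>g\<in>carrier G. \<rho> c g = \<sigma> (N #> g))" by blast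
  then obtain \<sigma> where "\<forall>c\<in>J. unitary_rep (G Mod N) (n c) (\<sigma> c) \<and> (\<forall>g\<in>carrier G. \<rho> c g = \<sigma> c (N #> g))"
    unfolding bchoice_iff by blast
  then have \<sigma>: "\<And>c. c \<in> J \<Longrightarrow> unitary_rep (G Mod N) (n c) (\<sigma> c)"
    and \<rho>\<sigma>: "\<And>c g. c \<in> J \<Longrightarrow> g \<in> carrier G \<Longrightarrow> \<rho> c g = \<sigma> c (N #> g)" by blast+
  let ?P = "f_points_ff (G Mod N) \<phi>Q"
  have T: "TBFT_ff (G Mod N) \<phi>Q" by (rule Q.Q.TBFT_ff_finite[OF Q.fin Q.\<phi>Q])
  let ?d = "\<lambda>c. unitary_equiv (G Mod N) `` {\<sigma> c}"
  have "inj_on ?d J"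
  proof (rule inj_onI)
    fix c d assume c: "c \<in> J" and d: "d \<in> J" and e: "?d c = ?d d"
    have "(\<sigma> c, \<sigma> d) \<in> unitary_equiv (G Mod N)"
      by (rule eq_equiv_class[OF e equiv_unitary_equiv[OF Q.Q.is_group]]) (use \<sigma>[OF d] in blast)
    then have "(\<rho> c, \<rho> d) \<in> unitary_equiv G"
      using Q.unitary_equiv_pullback[OF \<sigma>[OF c] \<sigma>[OF d] rep[OF c] \<rho>\<sigma>[OF c] rep[OF d] \<rho>\<sigma>[OF d]] by blast
    then show "c = d" using equiv_class_eq[OF eqv] cl[OF c] cl[OF d] by metis
  qed
  moreover have "?d ` J \<subseteq> ?P"
  proof clarify
    fix c assume c: "c \<in> J"
    show "?d c \<in> ?P" using Q.f_point_pullback(2)[OF \<sigma>[OF c] rep[OF c] \<rho>\<sigma>[OF c] irr[OF c]] fp[OF c] by blast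
  qed
  moreover have "finite ?P" using T unfolding TBFT_ff_def by blast
  ultimately have "card J \<le> card ?P" by (rule card_inj_on_le)
  also have "\<dots> = card (reidemeister_classes (G Mod N) \<phi>Q)"
    using T unfolding TBFT_ff_def reidemeister_number_def by simp
  also have "\<dots> \<le> card (reidemeister_classes G \<phi>)" by (rule Q.card_reidemeister_quotient_le[OF finR])
  finally show ?thesis .
qed

end

section \<open>Almost polycyclic groups\<close>

text \<open>The bound on the number of f-points comes from \<open>finite_f_points_le\<close>. Equality holds since the
f-points of a quotient with the same Reidemeister number pull back to distinct f-points of \<open>G\<close>.\<close>

theorem theorem6p3:
  fixes G :: "('a, 'b) monoid_scheme" and \<phi> :: "'a \<Rightarrow> 'a"
  assumes "group G"
    and "almost_polycyclic G"
    and "\<exists>H. fully_invariant H G \<and> polycyclic_finite_index_subgroup H G"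
    and "\<phi> \<in> hom G G"
    and "finite (reidemeister_classes G \<phi>)"
  shows "TBFT_ff G \<phi>"
proof -
  interpret group G by fact
  note \<phi> = assms(4) and finR = assms(5)
  note eqv = equiv_unitary_equiv[OF is_group]
  let ?P = "f_points_ff G \<phi>"
  have finP: "finite ?P" and le: "card ?P \<le> card (reidemeister_classes G \<phi>)"
    using finite_if_finite_subsets_card_bdd[of ?P "card (reidemeister_classes G \<phi>)"] finite_f_points_le[OF \<phi> finR] by auto
  obtain H where H: "fully_invariant H G" "polycyclic_finite_index_subgroup H G" using assms(3) by blast
  have sH: "subgroup H G" and poly: "polycyclic_seq G H" and fiH: "finite_index G H (carrier G)"
    using H(2) polycyclic_seq_of_subgroup[of H H] finite_index_if_finite_rcosets[of H]
    unfolding polycyclic_finite_index_subgroup_def polycyclic_def by auto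
  obtain N where N: "N \<lhd> G" "finite_index G N (carrier G)" "\<phi> ` N \<subseteq> N"
    and sat: "\<And>n g. n \<in> N \<Longrightarrow> g \<in> carrier G \<Longrightarrow> (g, n \<otimes>\<^bsub>G\<^esub> g) \<in> reidemeister_rel G \<phi>"
  proof (rule twisted_classes_saturated[OF poly H(1) fiH \<phi> finR])
    fix N assume "N \<lhd> G" "finite_index G N (carrier G)" "\<phi> ` N \<subseteq> N"
      "\<And>n g. n \<in> N \<Longrightarrow> g \<in> carrier G \<Longrightarrow> (g, n \<otimes>\<^bsub>G\<^esub> g) \<in> reidemeister_rel G \<phi>"
    then show thesis by (rule that)
  qed
  obtain \<phi>Q where "equivariant_quotient G (G Mod N) (\<lambda>x. N #>\<^bsub>G\<^esub> x) \<phi> \<phi>Q"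
    by (rule equivariant_quotient_Mod[OF N(1,2) \<phi> N(3)])
  then interpret Q: equivariant_quotient G "G Mod N" "\<lambda>x. N #>\<^bsub>G\<^esub> x" \<phi> \<phi>Q .
  let ?PQ = "f_points_ff (G Mod N) \<phi>Q"
  have T: "TBFT_ff (G Mod N) \<phi>Q" by (rule Q.Q.TBFT_ff_finite[OF Q.fin Q.\<phi>Q])
  have "card (reidemeister_classes (G Mod N) \<phi>Q) = card (reidemeister_classes G \<phi>)"
  proof (rule Q.card_reidemeister_quotient_eq)
    fix g h assume gh: "g \<in> carrier G" "h \<in> carrier G" "N #>\<^bsub>G\<^esub> g = N #>\<^bsub>G\<^esub> h"
    have "h \<in> N #>\<^bsub>G\<^esub> g" using rcos_self[OF gh(2) normal_imp_subgroup[OF N(1)]] gh(3) by simp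
    then obtain n where "n \<in> N" "h = n \<otimes>\<^bsub>G\<^esub> g" by (auto simp: r_coset_def)
    then show "(g, h) \<in> reidemeister_rel G \<phi>" using sat gh(1) by blast
  qed
  then have card_PQ: "card ?PQ = card (reidemeister_classes G \<phi>)"
    using T unfolding TBFT_ff_def reidemeister_number_def by simp
  have "\<forall>c\<in>?PQ. \<exists>n \<rho>. irreducible_unitary_rep (G Mod N) n \<rho> \<and> c = unitary_equiv (G Mod N) `` {\<rho>}"
    using Q.Q.f_points_ff_iff[OF Q.\<phi>Q] by blast
  then obtain n \<rho> where "\<forall>c\<in>?PQ. irreducible_unitary_rep (G Mod N) (n c) (\<rho> c) \<and> c = unitary_equiv (G Mod N) `` {\<rho> c}"
    unfolding bchoice_iff by blast
  then have irr: "\<And>c. c \<in> ?PQ \<Longrightarrow> irreducible_unitary_rep (G Mod N) (n c) (\<rho> c)"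
    and cl: "\<And>c. c \<in> ?PQ \<Longrightarrow> c = unitary_equiv (G Mod N) `` {\<rho> c}" by blast+
  have rep: "\<And>c. c \<in> ?PQ \<Longrightarrow> unitary_rep (G Mod N) (n c) (\<rho> c)" using irr unfolding irreducible_unitary_rep_def by blast
  let ?r = "\<lambda>c. \<rho> c \<circ> (\<lambda>x. N #>\<^bsub>G\<^esub> x)"
  have rep': "unitary_rep G (n c) (?r c)" if "c \<in> ?PQ" for c
    by (rule Q.Q.unitary_rep_comp_hom[OF Q.\<pi> rep[OF that]])
  have val: "?r c g = \<rho> c (N #>\<^bsub>G\<^esub> g)" for c g by simp
  let ?u = "\<lambda>c. unitary_equiv G `` {?r c}"
  have "inj_on ?u ?PQ"
  proof (rule inj_onI)
    fix c d assume c: "c \<in> ?PQ" and d: "d \<in> ?PQ" and e: "?u c = ?u d"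
    have "(?r c, ?r d) \<in> unitary_equiv G"
      by (rule eq_equiv_class[OF e eqv]) (use rep'[OF d] in blast)
    then have "(\<rho> c, \<rho> d) \<in> unitary_equiv (G Mod N)"
      using Q.unitary_equiv_pullback[OF rep[OF c] rep[OF d] rep'[OF c] val rep'[OF d] val] by blast
    then show "c = d" using equiv_class_eq[OF equiv_unitary_equiv[OF Q.Q.is_group]] cl[OF c] cl[OF d] by metis
  qed
  moreover have "?u ` ?PQ \<subseteq> ?P"
  proof
    fix u assume "u \<in> ?u ` ?PQ"
    then obtain c where c: "c \<in> ?PQ" "u = ?u c" by blast
    have irr': "irreducible_unitary_rep G (n c) (?r c)"
      using Q.irreducible_pullback[OF rep[OF c(1)] rep'[OF c(1)] val] irr[OF c(1)] by blast
    have "unitary_equiv (G Mod N) `` {\<rho> c} \<in> ?PQ" using c(1) cl[OF c(1)] by simp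
    then show "u \<in> ?P" unfolding c(2)
      using Q.f_point_pullback(1)[OF rep[OF c(1)] rep'[OF c(1)] val irr'] by blast
  qed
  ultimately have "card ?PQ \<le> card ?P" using finP by (rule card_inj_on_le)
  then show ?thesis unfolding TBFT_ff_def reidemeister_number_def using finR finP le card_PQ by simp
qed

end
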